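(* Let $f:[-\pi,\pi]\to\mathbb R$ be a real even Riemann integrable function with connected range. Then for every asymptotically uniform grid $\{\xi_{1,n},\xi_{2,n},\dots,\xi_{n,n}\}_n$ in $[0,\pi]$ there exist, for every $n\in\mathbb N$, real values $\psi_{1,n},\psi_{2,n},\dots,\psi_{n,n}$ and orderings (with multiplicity) $\lambda_1(T_n(f)),\dots,\lambda_n(T_n(f))$ of the eigenvalues of $T_n(f)$ and $\lambda_1(H_n(f)),\dots,\lambda_n(H_n(f))$ of the eigenvalues of $H_n(f)$ with the following properties. 1. For all $i=1,\dots,n$, $$\lambda_i(T_n(f))=f(\xi_{i,n})+\psi_{i,n},\qquad \lambda_i(H_n(f))=(-1)^{i+1}\lambda_i(T_n(f)).$$ 2. $\max_{i=1,\dots,n}|\psi_{i,n}|\to0$ as $n\to\infty$.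
   Context: For $f\in L^1(-\pi,\pi)$, with Fourier coefficients $\hat f_k=\frac1{2\pi}\int_{-\pi}^{\pi}f(\theta)e^{-\mathbf{i}k\theta}\,d\theta$, $k\in\mathbb Z$, $T_n(f)$ is the $n\times n$ Toeplitz matrix $(T_n(f))_{s,t}=\hat f_{s-t}$, $s,t=1,\dots,n$. $Y_n$ is the $n\times n$ flip matrix ($(Y_n)_{i,j}=1$ if $i+j=n+1$, $0$ otherwise), and $H_n(f)=Y_nT_n(f)$. A sequence of grids $\{\xi_{i,n}\}_{i=1,\dots,n}$ of points of $[a,b]$ is asymptotically uniform in $[a,b]$ if $\max_{i=1,\dots,n}\left|\xi_{i,n}-\left(a+i\,\frac{b-a}{n}\right)\right|\to0$ as $n\to\infty$.
   Formalization: As stated the claim fails if f takes values only on a null set (e.g. a Cantor-type f, zero a.e., with range [0,1]); it is proved with the added hypothesis that every value of f on [-π,π] lies in its essential range (automatic for continuous f). *)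

theory Defs
  imports
    "HOL-Analysis.Analysis"
    "Jordan_Normal_Form.Char_Poly"
begin

text \<open>
  Riemann integrability by Riemann sums over tagged divisions whose mesh tends to zero
  (the Henstock-Kurzweil predicate \<^const>\<open>integrable_on\<close> with gauges replaced by a uniform mesh).
  In particular such an \<open>f\<close> is bounded on \<open>{a..b}\<close>.
\<close>

definition riemann_integrable :: "(real \<Rightarrow> real) \<Rightarrow> real \<Rightarrow> real \<Rightarrow> bool" where
  "riemann_integrable f a b \<longleftrightarrow>
     (\<exists>I. \<forall>e>0. \<exists>d>0. \<forall>D. D tagged_division_of {a..b} \<and> (\<forall>(x, K) \<in> D. diameter K < d) \<longrightarrow>
        \<bar>(\<Sum>(x, K) \<in> D. measure lborel K * f x) - I\<bar> < e)"

text \<open>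
  The integral is taken over \<^const>\<open>lebesgue\<close>, not \<^const>\<open>lborel\<close>: a Riemann integrable function
  need not be Borel measurable, and the Bochner integral of a nonmeasurable function is 0.
\<close>

definition fourier_coeff :: "(real \<Rightarrow> complex) \<Rightarrow> int \<Rightarrow> complex" where
  "fourier_coeff f k =
     1 / (2 * complex_of_real pi) *
     (LINT \<theta>:{-pi..pi}|lebesgue. f \<theta> * exp (- \<i> * of_int k * complex_of_real \<theta>))"

text \<open>Matrix indices start at 0; this shift leaves \<open>s - t\<close> unchanged and turns
  \<open>i + j = n + 1\<close> into \<open>i + j + 1 = n\<close>.\<close>

definition toeplitz :: "nat \<Rightarrow> (real \<Rightarrow> complex) \<Rightarrow> complex mat" where
  "toeplitz n f = Matrix.mat n n (\<lambda>(s, t). fourier_coeff f (int s - int t))"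

definition flip_mat :: "nat \<Rightarrow> complex mat" where
  "flip_mat n = Matrix.mat n n (\<lambda>(i, j). if i + j + 1 = n then 1 else 0)"

definition flipped_toeplitz :: "nat \<Rightarrow> (real \<Rightarrow> complex) \<Rightarrow> complex mat" where
  "flipped_toeplitz n f = flip_mat n * toeplitz n f"

text \<open>\<open>ev 1, \<dots>, ev n\<close> lists the eigenvalues of the square matrix \<open>A\<close> of size \<open>n\<close>, each repeated
  according to its algebraic multiplicity.\<close>

definition eigenvalue_ordering :: "complex mat \<Rightarrow> (nat \<Rightarrow> complex) \<Rightarrow> bool" where
  "eigenvalue_ordering A ev \<longleftrightarrow> char_poly A = (\<Prod>i = 1..dim_row A. [:- ev i, 1:])"

text \<open>\<open>\<xi> n i\<close> is the \<open>i\<close>-th point of the \<open>n\<close>-th grid, \<open>1 \<le> i \<le> n\<close>. The value at \<open>n = 0\<close>, where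
  the maximum is over the empty set, is irrelevant to the limit.\<close>

definition asymptotically_uniform_grid :: "real \<Rightarrow> real \<Rightarrow> (nat \<Rightarrow> nat \<Rightarrow> real) \<Rightarrow> bool" where
  "asymptotically_uniform_grid a b \<xi> \<longleftrightarrow>
     (\<forall>n. \<forall>i \<in> {1..n}. \<xi> n i \<in> {a..b}) \<and>
     (\<lambda>n. MAX i \<in> {1..n}. \<bar>\<xi> n i - (a + real i * ((b - a) / real n))\<bar>) \<longlonglongrightarrow> 0"

text \<open>
  The matrices determine \<open>f\<close> only up to null sets, while the samples \<open>f (\<xi> n i)\<close> involve its
  pointwise values. Values attained only on a null set (say, a map of the Cantor set onto
  \<open>[0, 1]\<close>, extended by 0) can never be approximated by the spectra along all grids, so that the
  range is required not only to be connected but also to consist of essential values.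
  This is automatic if \<open>f\<close> is continuous, and more generally if \<open>f\<close> has connected range and
  only countably many discontinuities.
\<close>

definition essential_range :: "real set \<Rightarrow> (real \<Rightarrow> real) \<Rightarrow> real set" where
  "essential_range S f = {y. \<forall>e>0. \<not> negligible {x \<in> S. \<bar>f x - y\<bar> < e}}"

end

theory Submission
  imports Defs
begin

unbundle no vec_syntax
unbundle no inner_syntax

text \<open>
  The sine vectors \<open>u\<^sub>i\<close>, \<open>u\<^sub>i(s) = sqrt (2 / (n + 1)) sin (i s \<pi> / (n + 1))\<close>, form an orthonormal
  basis in which both matrices are almost diagonal: \<open>Y\<^sub>n u\<^sub>i = (-1)\<^sup>i\<^sup>+\<^sup>1 u\<^sub>i\<close>, and for a cosine
  polynomial \<open>p\<close> the residuals \<open>T\<^sub>n(p) u\<^sub>i - p(i \<pi> / (n + 1)) u\<^sub>i\<close> have a total square norm that is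
  bounded in \<open>n\<close>. Approximating \<open>f\<close> by such \<open>p\<close>, with Bessel's inequality for the matrices and
  Darboux sums for the samples, the total square norm of \<open>T\<^sub>n(f) u\<^sub>i - f(\<xi>\<^sub>i) u\<^sub>i\<close> is \<open>o(n)\<close>.
  Since \<open>T\<^sub>n(f)\<close> commutes with \<open>Y\<^sub>n\<close>, it has an orthonormal eigenbasis \<open>v\<^sub>j\<close>, with
  eigenvalues \<open>\<lambda>\<^sub>j\<close>, of vectors with the same parities, and \<open>Y\<^sub>n T\<^sub>n(f) v\<^sub>j = (-1)\<^sup>j\<^sup>+\<^sup>1 \<lambda>\<^sub>j v\<^sub>j\<close>.
  The squares \<open>w\<^sub>i\<^sub>j\<close> of the inner products of \<open>u\<^sub>i\<close> and \<open>v\<^sub>j\<close> form a doubly stochastic matrix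
  within each parity class, and that total is the sum of \<open>w\<^sub>i\<^sub>j (\<lambda>\<^sub>j - f(\<xi>\<^sub>i))\<^sup>2\<close>: a transport cost.
  Match samples and eigenvalues of each class in increasing order. As the samples are dense in the
  range of \<open>f\<close>, with a positive proportion near every value, one pair at distance above \<open>\<epsilon>\<close> would
  force a transport cost of order \<open>n\<close>.
\<close>

section \<open>Spectral theorem for real symmetric matrices\<close>

text \<open>The obstacle is the maximum: smallness in mean square still permits \<open>o(n)\<close>
  pairs that are far apart. Sorted matching excludes them by counting. If the eigenvalue matched
  with a sample \<open>y\<close> exceeds \<open>y + \<epsilon>\<close>, the eigenvalues up to
  \<open>y + \<epsilon>\<close> are too few for the samples below \<open>y + \<epsilon> / 2\<close>,
  and the surplus is at least the number of samples strictly between \<open>y\<close> and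
  \<open>y + \<epsilon> / 2\<close>. This window lies within the range because the eigenvalues do.
  The sine basis is dictated by the claim: \<open>i\<close> numbers both the grid point near
  \<open>i \<pi> / n\<close> and the sign \<open>(-1) ^ (i + 1)\<close>, and the sine vectors have
  the corresponding node and parity at the same index. Since the signs alternate, each parity class
  still samples the whole interval evenly, so matching inside a class, which keeps the sign
  relation, loses no density. The total residual is a squared Frobenius norm; hence its expansion in
  an eigenbasis, the transport cost, is an exact identity. Riemann integrability enters through the
  samples: \<open>f - p\<close> has to be small at most grid points, not only in the mean.\<close>

lemma symmetric_real_eigenvector_exists:
  fixes A :: "real mat"
  assumes A: "A \<in> carrier_mat n n" and sym: "A\<^sup>T = A" and n: "n > 0"
  shows "\<exists>l v. v \<in> carrier_vec n \<and> v \<bullet> v = 1 \<and> A *\<^sub>v v = l \<cdot>\<^sub>v v"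
proof -
  define C where "C = map_mat complex_of_real A"
  have C: "C \<in> carrier_mat n n" using A by (simp add: C_def)
  have entry: "\<And>i j. i < n \<Longrightarrow> j < n \<Longrightarrow> C $$ (i,j) = complex_of_real (A $$ (i,j))"
    using A by (simp add: C_def)
  have symA: "\<And>i j. i < n \<Longrightarrow> j < n \<Longrightarrow> A $$ (i,j) = A $$ (j,i)"
    using sym A by (metis carrier_matD index_transpose_mat(1))
  obtain as where as: "char_poly C = (\<Prod>a\<leftarrow>as. [:- a, 1:])" "length as = n"
    using char_poly_factorized[OF C] by blast
  then obtain z where "z \<in> set as" using n by (cases as) auto
  then have "poly (char_poly C) z = 0" unfolding as(1) by (simp add: poly_prod_list prod_list_zero_iff image_iff)
  then have "eigenvalue C z" using eigenvalue_root_char_poly[OF C] by simp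
  then obtain x where x: "x \<in> carrier_vec n" "x \<noteq> 0\<^sub>v n" "C *\<^sub>v x = z \<cdot>\<^sub>v x"
    using C by (auto simp: eigenvalue_def eigenvector_def)
  have ev: "(\<Sum>k<n. complex_of_real (A $$ (i,k)) * x $ k) = z * x $ i" if i: "i < n" for i
  proof -
    have "(C *\<^sub>v x) $ i = (\<Sum>k<n. C $$ (i,k) * x $ k)"
      using i C x(1) by (simp add: scalar_prod_def atLeast0LessThan)
    also have "\<dots> = (\<Sum>k<n. complex_of_real (A $$ (i,k)) * x $ k)"
      using entry i by (intro sum.cong) auto
    finally show ?thesis using x(1,3) i by simp
  qed
  obtain i0 where i0: "i0 < n" "x $ i0 \<noteq> 0" using x(1,2) by (metis carrier_vecD eq_vecI index_zero_vec)
  define N where "N = (\<Sum>i<n. (cmod (x $ i))^2)"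
  have N: "N > 0"
    unfolding N_def using i0 by (intro sum_pos2[of _ i0]) auto
  have q: "(\<Sum>i<n. cnj (x $ i) * (z * x $ i)) = z * of_real N"
    unfolding N_def of_real_sum sum_distrib_left complex_norm_square by (simp add: mult_ac)
  \<comment> \<open>The Hermitian form of a real symmetric matrix is real, and so is
    \<open>z\<close>, its quotient by \<open>N > 0\<close>.\<close>
  define Q where "Q = (\<Sum>i<n. \<Sum>k<n. cnj (x $ i) * of_real (A $$ (i,k)) * x $ k)"
  have Q1: "Q = z * of_real N"
    unfolding Q_def q[symmetric]
    by (intro sum.cong refl) (simp add: ev[symmetric] sum_distrib_left mult_ac)
  have "cnj Q = (\<Sum>i<n. \<Sum>k<n. x $ i * of_real (A $$ (i,k)) * cnj (x $ k))"
    unfolding Q_def by (simp add: mult_ac)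
  also have "\<dots> = (\<Sum>k<n. \<Sum>i<n. x $ i * of_real (A $$ (i,k)) * cnj (x $ k))"
    by (rule sum.swap)
  also have "\<dots> = Q" unfolding Q_def using symA by (intro sum.cong refl) (simp add: mult_ac)
  finally have "cnj z = z" using Q1 N by simp
  then obtain l where l: "z = of_real l" by (metis Reals_cases Reals_cnj_iff)
  \<comment> \<open>The real part of a complex eigenvector may vanish; the factor
    \<open>\<i>\<close> moves a nonzero imaginary entry into it.\<close>
  obtain r :: complex where r: "Re (r * x $ i0) \<noteq> 0"
  proof (cases "Re (x $ i0) = 0")
    case True
    then have "Im (x $ i0) \<noteq> 0" using i0(2) by (simp add: complex_eq_iff)
    then show ?thesis using that[of "\<i>"] by simp
  next
    case False
    then show ?thesis using that[of 1] by simp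
  qed
  define y where "y = Matrix.vec n (\<lambda>i. Re (r * x $ i))"
  have y: "y \<in> carrier_vec n" by (simp add: y_def)
  have Ay: "A *\<^sub>v y = l \<cdot>\<^sub>v y"
  proof (rule eq_vecI)
    fix i assume "i < dim_vec (l \<cdot>\<^sub>v y)"
    then have i: "i < n" using y by simp
    have "(A *\<^sub>v y) $ i = (\<Sum>k<n. A $$ (i,k) * Re (r * x $ k))"
      using i A y by (simp add: scalar_prod_def atLeast0LessThan y_def)
    also have "\<dots> = Re (r * (\<Sum>k<n. complex_of_real (A $$ (i,k)) * x $ k))"
      by (simp add: sum_distrib_left algebra_simps sum_subtractf)
    also have "\<dots> = l * Re (r * x $ i)" unfolding ev[OF i] l by (simp add: algebra_simps)
    finally show "(A *\<^sub>v y) $ i = (l \<cdot>\<^sub>v y) $ i" using i by (simp add: y_def)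
  qed (use A y in auto)
  have yy: "y \<bullet> y > 0"
  proof -
    have "y \<bullet> y = (\<Sum>i<n. (y $ i)^2)" using y by (simp add: scalar_prod_def atLeast0LessThan power2_eq_square)
    also have "\<dots> > 0" using i0 r by (intro sum_pos2[of _ i0]) (auto simp: y_def)
    finally show ?thesis .
  qed
  define v where "v = (1 / sqrt (y \<bullet> y)) \<cdot>\<^sub>v y"
  have "v \<in> carrier_vec n" using y by (simp add: v_def)
  moreover have "v \<bullet> v = 1" using y yy by (simp add: v_def field_simps)
  moreover have "A *\<^sub>v v = l \<cdot>\<^sub>v v"
    unfolding v_def using A y Ay by (simp add: mult_mat_vec smult_smult_assoc mult.commute)
  ultimately show ?thesis by blast
qed

text \<open>With \<open>e\<close> the first unit vector, the reflection along \<open>v - e\<close>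
  exchanges \<open>e\<close> and \<open>v\<close>, as both have norm 1. For \<open>v = e\<close> it
  degenerates and the identity takes its place.\<close>

lemma householder_reflection:
  fixes v :: "real vec"
  assumes v: "v \<in> carrier_vec n" and n: "n > 0" and vv: "v \<bullet> v = 1"
  shows "\<exists>H \<in> carrier_mat n n. H\<^sup>T = H \<and> H * H = 1\<^sub>m n \<and> Matrix.col H 0 = v"
proof (cases "v $ 0 = 1")
  case True
  have "(\<Sum>i<n. (v $ i)^2) = 1"
    using v vv by (simp add: scalar_prod_def atLeast0LessThan power2_eq_square)
  moreover have "(\<Sum>i<n. (v $ i)^2) = (v $ 0)^2 + (\<Sum>i\<in>{..<n}-{0}. (v $ i)^2)"
    using n by (simp add: sum.remove[of _ 0])
  ultimately have "(\<Sum>i\<in>{..<n}-{0}. (v $ i)^2) = 0" using True by simp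
  then have "\<forall>i\<in>{..<n}-{0}. v $ i = 0" by (simp add: sum_nonneg_eq_0_iff)
  then have "Matrix.col (1\<^sub>m n) 0 = v" using True v n by (intro eq_vecI) (auto simp: one_mat_def)
  then show ?thesis by (intro bexI[of _ "1\<^sub>m n"]) auto
next
  case False
  \<comment> \<open>This is 2 over the squared norm of \<open>h\<close>, which is
    \<open>2 * (1 - v $ 0)\<close> for a unit vector \<open>v\<close>.\<close>
  define c where "c = 1 / (1 - v $ 0)"
  define h where "h i = v $ i - (if i = 0 then 1 else 0)" for i
  define H where "H = Matrix.mat n n (\<lambda>(i,k). (if i = k then 1 else 0) - c * h i * h k)"
  have c: "c * (1 - v $ 0) = 1" using False by (simp add: c_def)
  have vs: "(\<Sum>i<n. (v $ i)^2) = 1"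
    using v vv by (simp add: scalar_prod_def atLeast0LessThan power2_eq_square)
  have "(\<Sum>i<n. (h i)^2) = (\<Sum>i<n. (v $ i)^2 - 2 * (if i = 0 then v $ 0 else 0) + (if i = 0 then 1 else 0))"
    by (intro sum.cong) (auto simp: h_def power2_eq_square algebra_simps)
  also have "\<dots> = 2 * (1 - v $ 0)"
    using n vs by (simp add: sum.distrib sum_subtractf sum_distrib_left[symmetric])
  finally have hh: "(\<Sum>i<n. (h i)^2) = 2 * (1 - v $ 0)" .
  have HH: "H * H = 1\<^sub>m n"
  proof (rule eq_matI)
    fix i k assume "i < dim_row (1\<^sub>m n)" "k < dim_col (1\<^sub>m n)"
    then have i: "i < n" and k: "k < n" by auto
    have "(H * H) $$ (i,k) = (\<Sum>p<n. ((if i = p then 1 else 0) - c * h i * h p) * ((if p = k then 1 else 0) - c * h p * h k))"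
      using i k by (simp add: H_def scalar_prod_def atLeast0LessThan)
    also have "\<dots> = (\<Sum>p<n. (if p = i then (if i = k then 1 else 0) else 0) - (if p = k then c * h i * h k else 0)
        - (if p = i then c * h i * h k else 0) + c^2 * h i * h k * (h p)^2)"
      by (intro sum.cong) (auto simp: algebra_simps power2_eq_square)
    also have "\<dots> = (if i = k then 1 else 0) - 2 * c * h i * h k + c^2 * h i * h k * (2 * (1 - v $ 0))"
      using i k by (simp add: sum.distrib sum_subtractf sum_distrib_left[symmetric] hh)
    also have "c^2 * h i * h k * (2 * (1 - v $ 0)) = 2 * c * h i * h k * (c * (1 - v $ 0))"
      by (simp add: power2_eq_square algebra_simps)
    finally show "(H * H) $$ (i,k) = 1\<^sub>m n $$ (i,k)" using i k c by simp
  qed (auto simp: H_def)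
  have "Matrix.col H 0 = v"
  proof (rule eq_vecI)
    fix i assume "i < dim_vec v"
    then have i: "i < n" using v by simp
    have "c * h i * h 0 = - h i * (c * (1 - v $ 0))" by (simp add: h_def algebra_simps)
    then show "Matrix.col H 0 $ i = v $ i" using i n c by (simp add: H_def h_def)
  qed (use v in \<open>auto simp: H_def\<close>)
  moreover have "H\<^sup>T = H" by (rule eq_matI) (auto simp: H_def)
  ultimately show ?thesis using HH by (intro bexI[of _ H]) (auto simp: H_def)
qed


lemma mult_block_diag_mat:
  fixes X X' Y Y' :: "'a :: comm_ring_1 mat"
  assumes "X \<in> carrier_mat m m" "X' \<in> carrier_mat m m" "Y \<in> carrier_mat n n" "Y' \<in> carrier_mat n n"
  shows "four_block_mat X (0\<^sub>m m n) (0\<^sub>m n m) Y * four_block_mat X' (0\<^sub>m m n) (0\<^sub>m n m) Y' =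
    four_block_mat (X * X') (0\<^sub>m m n) (0\<^sub>m n m) (Y * Y')"
  by (subst mult_four_block_mat[of _ m m _ n _ n _ _ m _ n]) (use assms in auto)

text \<open>Deflation: conjugation by a reflection whose first column is a unit eigenvector leaves,
  by symmetry, a scalar block and a symmetric block of size one less.\<close>

lemma real_spectral_theorem_mat:
  fixes A :: "real mat"
  assumes "A \<in> carrier_mat n n" "A\<^sup>T = A"
  shows "\<exists>P D. P \<in> carrier_mat n n \<and> D \<in> carrier_mat n n \<and> diagonal_mat D \<and>
    P\<^sup>T * P = 1\<^sub>m n \<and> A = P * D * P\<^sup>T"
  using assms
proof (induction n arbitrary: A)
  case 0
  then show ?case
    by (intro exI[of _ "1\<^sub>m 0"] exI[of _ A]) (auto simp: diagonal_mat_def)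
next
  case (Suc n)
  note A = Suc.prems(1) and sym = Suc.prems(2)
  obtain l v where v: "v \<in> carrier_vec (Suc n)" "v \<bullet> v = 1" "A *\<^sub>v v = l \<cdot>\<^sub>v v"
    using symmetric_real_eigenvector_exists[OF A sym] by auto
  obtain H where H: "H \<in> carrier_mat (Suc n) (Suc n)" "H\<^sup>T = H" "H * H = 1\<^sub>m (Suc n)" "Matrix.col H 0 = v"
    using householder_reflection[OF v(1) _ v(2)] by auto
  define B where "B = H * A * H"
  have B: "B \<in> carrier_mat (Suc n) (Suc n)" using H A by (simp add: B_def)
  have Bsym: "B\<^sup>T = B"
  proof -
    have "B\<^sup>T = H\<^sup>T * (H * A)\<^sup>T" unfolding B_def by (rule transpose_mult) (use H A in auto)
    also have "(H * A)\<^sup>T = A\<^sup>T * H\<^sup>T" by (rule transpose_mult) (use H A in auto)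
    finally show ?thesis using H A sym by (simp add: B_def assoc_mult_mat[of _ "Suc n" "Suc n"])
  qed
  have col0: "Matrix.col B 0 = l \<cdot>\<^sub>v unit_vec (Suc n) 0"
  proof -
    have "Matrix.col B 0 = (H * A) *\<^sub>v v" unfolding B_def using H A by (subst col_mult2) auto
    also have "\<dots> = H *\<^sub>v (A *\<^sub>v v)" using H A v by auto
    also have "\<dots> = l \<cdot>\<^sub>v (H *\<^sub>v v)" using H v by (simp add: mult_mat_vec)
    also have "H *\<^sub>v v = Matrix.col (H * H) 0" using H by (subst col_mult2) auto
    also have "\<dots> = unit_vec (Suc n) 0" using H(3) by simp
    finally show ?thesis .
  qed
  have B0: "B $$ (i,0) = (if i = 0 then l else 0)" if "i < Suc n" for i
  proof -
    have "B $$ (i,0) = Matrix.col B 0 $ i" using that B by simp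
    then show ?thesis using that by (simp add: col0)
  qed
  have B0': "B $$ (0,i) = (if i = 0 then l else 0)" if "i < Suc n" for i
    using B0[OF that] Bsym B that by (metis carrier_matD index_transpose_mat(1) zero_less_Suc)
  define A' where "A' = Matrix.mat n n (\<lambda>(i,j). B $$ (Suc i, Suc j))"
  have A': "A' \<in> carrier_mat n n" by (simp add: A'_def)
  have "A'\<^sup>T = A'"
  proof (rule eq_matI)
    fix i j assume "i < dim_row A'" "j < dim_col A'"
    then have "i < n" "j < n" by (auto simp: A'_def)
    moreover have "B\<^sup>T $$ (Suc i, Suc j) = B $$ (Suc j, Suc i)" using B calculation by simp
    ultimately show "A'\<^sup>T $$ (i,j) = A' $$ (i,j)" by (simp add: A'_def Bsym)
  qed (auto simp: A'_def)
  from Suc.IH[OF A' this] obtain P D where PD: "P \<in> carrier_mat n n" "D \<in> carrier_mat n n" "diagonal_mat D"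
    "P\<^sup>T * P = 1\<^sub>m n" "A' = P * D * P\<^sup>T" by blast
  define L where "L = Matrix.mat 1 1 (\<lambda>_. l)"
  define P1 where "P1 = four_block_mat (1\<^sub>m 1) (0\<^sub>m 1 n) (0\<^sub>m n 1) P"
  define D1 where "D1 = four_block_mat L (0\<^sub>m 1 n) (0\<^sub>m n 1) D"
  have L: "L \<in> carrier_mat 1 1" by (simp add: L_def)
  have P1: "P1 \<in> carrier_mat (Suc n) (Suc n)" and D1: "D1 \<in> carrier_mat (Suc n) (Suc n)"
    using PD L unfolding P1_def D1_def by auto
  have P1T: "P1\<^sup>T = four_block_mat (1\<^sub>m 1) (0\<^sub>m 1 n) (0\<^sub>m n 1) P\<^sup>T"
    unfolding P1_def using PD(1) by (subst transpose_four_block_mat[of _ 1 1 _ n _ n]) auto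
  have "P1 * D1 * P1\<^sup>T = four_block_mat L (0\<^sub>m 1 n) (0\<^sub>m n 1) A'"
    unfolding P1T PD(5) unfolding P1_def D1_def
    using mult_block_diag_mat[of "1\<^sub>m 1" 1 L P n D] mult_block_diag_mat[of L 1 "1\<^sub>m 1" "P * D" n "P\<^sup>T"] PD L
    by (simp del: assoc_mult_mat)
  also have "\<dots> = B"
  proof (rule eq_matI)
    fix i j assume "i < dim_row B" "j < dim_col B"
    then have ij: "i < Suc n" "j < Suc n" using B by auto
    then show "four_block_mat L (0\<^sub>m 1 n) (0\<^sub>m n 1) A' $$ (i,j) = B $$ (i,j)"
      using B0[of i] B0'[of j] A' L by (cases i; cases j) (auto simp: L_def A'_def)
  qed (use B A' L in auto)
  finally have BP: "B = P1 * D1 * P1\<^sup>T" ..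
  have PP1: "P1\<^sup>T * P1 = 1\<^sub>m (Suc n)"
  proof -
    have "P1\<^sup>T * P1 = four_block_mat (1\<^sub>m 1) (0\<^sub>m 1 n) (0\<^sub>m n 1) (1\<^sub>m n)"
      unfolding P1T unfolding P1_def
      using mult_block_diag_mat[of "1\<^sub>m 1" 1 "1\<^sub>m 1" "P\<^sup>T" n P] PD by simp
    then show ?thesis by (simp add: four_block_one_mat)
  qed
  define R where "R = H * P1"
  have R: "R \<in> carrier_mat (Suc n) (Suc n)" using H P1 by (simp add: R_def)
  have RT: "R\<^sup>T = P1\<^sup>T * H" unfolding R_def using transpose_mult[OF H(1) P1] H(2) by simp
  have HBH: "A = H * B * H"
  proof -
    have "H * B * H = (H * H) * A * (H * H)"
      unfolding B_def using H(1) A by (simp add: assoc_mult_mat[of _ "Suc n" "Suc n" _ "Suc n" _ "Suc n"])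
    then show ?thesis using A H(3) by simp
  qed
  have "R\<^sup>T * R = P1\<^sup>T * (H * H) * P1" unfolding RT unfolding R_def
    using H(1) P1 by (simp add: assoc_mult_mat[of _ "Suc n" "Suc n" _ "Suc n" _ "Suc n"])
  then have "R\<^sup>T * R = 1\<^sub>m (Suc n)" using H(3) P1 PP1 by simp
  moreover have "A = R * D1 * R\<^sup>T"
    unfolding RT unfolding R_def HBH BP
    using H(1) P1 D1 by (simp add: assoc_mult_mat[of _ "Suc n" "Suc n" _ "Suc n" _ "Suc n"])
  moreover have "diagonal_mat D1"
    using PD(2,3) L unfolding diagonal_mat_def D1_def by (auto split: if_splits)
  ultimately show ?case using R D1 by blast
qed

text \<open>Stated over an arbitrary finite index set, so that it applies to the even and to the odd
  indices as they are; each eigenvector then carries an index of its own class.\<close>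

lemma real_spectral_theorem_on:
  fixes a :: "'i \<Rightarrow> 'i \<Rightarrow> real"
  assumes fin: "finite I" and sym: "\<And>i k. i \<in> I \<Longrightarrow> k \<in> I \<Longrightarrow> a i k = a k i"
  shows "\<exists>w l. (\<forall>i\<in>I. \<forall>k\<in>I. (\<Sum>j\<in>I. w i j * w k j) = (if i = k then 1 else 0)) \<and>
    (\<forall>i\<in>I. \<forall>k\<in>I. (\<Sum>j\<in>I. w j i * w j k) = (if i = k then 1 else 0)) \<and>
    (\<forall>i\<in>I. \<forall>k\<in>I. a i k = (\<Sum>j\<in>I. w i j * l j * w k j))"
proof -
  define n where "n = card I"
  obtain b where b: "bij_betw b {..<n} I"
    using ex_bij_betw_nat_finite[OF fin] unfolding n_def atLeast0LessThan by blast
  define A where "A = Matrix.mat n n (\<lambda>(i,k). a (b i) (b k))"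
  have A: "A \<in> carrier_mat n n" by (simp add: A_def)
  have bI: "b i \<in> I" if "i < n" for i using b that by (auto simp: bij_betw_def)
  have "A\<^sup>T = A" by (rule eq_matI) (auto simp: A_def sym bI)
  from real_spectral_theorem_mat[OF A this] obtain P D where PD: "P \<in> carrier_mat n n" "D \<in> carrier_mat n n"
    "diagonal_mat D" "P\<^sup>T * P = 1\<^sub>m n" "A = P * D * P\<^sup>T" by blast
  have PP: "P * P\<^sup>T = 1\<^sub>m n" by (rule mat_mult_left_right_inverse[OF _ PD(1,4)]) (use PD in auto)
  define c where "c = the_inv_into {..<n} b"
  have cb: "c (b i) = i" if "i < n" for i
    using b that unfolding c_def bij_betw_def by (simp add: the_inv_into_f_f)
  have cI: "c i < n" "b (c i) = i" if "i \<in> I" for i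
    using b that unfolding bij_betw_def by (auto simp: cb)
  define w where "w i j = P $$ (c i, c j)" for i j
  define l where "l j = D $$ (c j, c j)" for j
  have re: "(\<Sum>j\<in>I. g (c j)) = (\<Sum>j<n. g j)" for g :: "nat \<Rightarrow> real"
    using sum.reindex_bij_betw[OF b, of "\<lambda>j. g (c j)"] cb by simp
  have inj: "c i = c k \<longleftrightarrow> i = k" if "i \<in> I" "k \<in> I" for i k using that cI by metis
  have 1: "(\<Sum>j\<in>I. w i j * w k j) = (if i = k then 1 else 0)" if "i \<in> I" "k \<in> I" for i k
  proof -
    have "(\<Sum>j\<in>I. w i j * w k j) = (P * P\<^sup>T) $$ (c i, c k)"
      unfolding w_def using PD(1) cI that
      by (subst re[of "\<lambda>j. P $$ (c i, j) * P $$ (c k, j)"]) (simp add: scalar_prod_def atLeast0LessThan)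
    then show ?thesis using cI that inj by (simp add: PP)
  qed
  have 2: "(\<Sum>j\<in>I. w j i * w j k) = (if i = k then 1 else 0)" if "i \<in> I" "k \<in> I" for i k
  proof -
    have "(\<Sum>j\<in>I. w j i * w j k) = (P\<^sup>T * P) $$ (c i, c k)"
      unfolding w_def using PD(1) cI that
      by (subst re[of "\<lambda>j. P $$ (j, c i) * P $$ (j, c k)"]) (simp add: scalar_prod_def atLeast0LessThan)
    then show ?thesis using cI that inj by (simp add: PD(4))
  qed
  have 3: "a i k = (\<Sum>j\<in>I. w i j * l j * w k j)" if "i \<in> I" "k \<in> I" for i k
  proof -
    have D: "(P * D) $$ (p,j) = P $$ (p,j) * D $$ (j,j)" if "p < n" "j < n" for p j
    proof -
      have "(P * D) $$ (p,j) = (\<Sum>q<n. P $$ (p,q) * D $$ (q,j))"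
        using PD(1,2) that by (simp add: scalar_prod_def atLeast0LessThan)
      also have "\<dots> = (\<Sum>q<n. if q = j then P $$ (p,j) * D $$ (j,j) else 0)"
        using PD(2,3) that by (intro sum.cong) (auto simp: diagonal_mat_def)
      finally show ?thesis using that by simp
    qed
    have "a i k = ((P * D) * P\<^sup>T) $$ (c i, c k)" using cI that unfolding PD(5)[symmetric] by (simp add: A_def)
    also have "\<dots> = (\<Sum>j<n. (P * D) $$ (c i, j) * P $$ (c k, j))"
      using PD(1,2) cI that unfolding times_mat_def[of "P * D"]
      by (simp add: scalar_prod_def atLeast0LessThan)
    also have "\<dots> = (\<Sum>j<n. P $$ (c i, j) * D $$ (j,j) * P $$ (c k, j))"
      using D cI that by (intro sum.cong) auto
    also have "\<dots> = (\<Sum>j\<in>I. w i j * l j * w k j)" unfolding w_def l_def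
      by (subst re[of "\<lambda>j. P $$ (c i, j) * D $$ (j,j) * P $$ (c k, j)"]) simp
    finally show ?thesis .
  qed
  show ?thesis using 1 2 3 by blast
qed

section \<open>The discrete sine basis\<close>

text \<open>With indices from 0, the matrix of the discrete sine transform of type I, normalized to
  be orthogonal.\<close>

definition dst :: "nat \<Rightarrow> nat \<Rightarrow> nat \<Rightarrow> real" where
  "dst n i s = sqrt (2 / (real n + 1)) * sin (real (Suc i) * real (Suc s) * pi / (real n + 1))"

text \<open>The Dirichlet kernel, with its denominator multiplied out so that \<open>x\<close> may
  be arbitrary.\<close>

lemma sum_cos_telescope:
  "2 * sin (x / 2) * (\<Sum>s<n. cos (real (Suc s) * x)) = sin ((real n + 1 / 2) * x) - sin (x / 2)"
proof (induction n)
  case (Suc n)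
  have "2 * sin (x / 2) * cos (real (Suc n) * x) = sin ((real (Suc n) + 1/2) * x) - sin ((real n + 1/2) * x)"
  proof -
    have "(real (Suc n) + 1/2) * x = real (Suc n) * x + x / 2" "(real n + 1/2) * x = real (Suc n) * x - x / 2"
      by (simp_all add: algebra_simps)
    then show ?thesis by (simp only: sin_add sin_diff) simp
  qed
  then show ?case using Suc by (simp add: distrib_left)
qed simp

text \<open>At these angles \<open>(n + 1/2) * x = m * pi - x / 2\<close>, so the kernel collapses
  to a value that depends only on the parity of \<open>m\<close>. The bounds on \<open>m\<close>
  keep \<open>x / 2\<close> strictly between 0 and \<open>pi\<close>, where the sine can be
  cancelled.\<close>

lemma sum_cos_grid:
  assumes m: "0 < m" "m < 2 * (n + 1)"
  shows "(\<Sum>s<n. cos (real (Suc s) * (real m * pi / (real n + 1)))) = (- 1 - (-1) ^ m) / 2"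
proof -
  define x where "x = real m * pi / (real n + 1)"
  have "x / 2 < pi"
  proof -
    have "real m < real (2 * (n + 1))" using m(2) by (simp only: of_nat_less_iff)
    then have "pi * real m < pi * real (2 * (n + 1))" by (intro mult_strict_left_mono) auto
    then show ?thesis by (simp add: x_def field_simps)
  qed
  moreover have "x / 2 > 0" using m by (simp add: x_def)
  ultimately have s: "sin (x / 2) > 0" using sin_gt_zero by blast
  have "(real n + 1/2) * x = real m * pi - x / 2" by (simp add: x_def field_simps)
  then have "sin ((real n + 1/2) * x) = - ((-1) ^ m * sin (x / 2))"
    by (simp add: sin_diff cos_npi sin_npi mult.commute)
  with sum_cos_telescope[of x n] have "sin (x/2) * (2 * (\<Sum>s<n. cos (real (Suc s) * x))) = sin (x/2) * (- 1 - (-1) ^ m)"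
    by (simp add: algebra_simps)
  then have "2 * (\<Sum>s<n. cos (real (Suc s) * x)) = - 1 - (-1) ^ m"
    using s by (metis mult_left_cancel less_irrefl)
  then show ?thesis unfolding x_def[symmetric] by simp
qed

text \<open>A product of sines is a difference of cosines with frequencies \<open>i - k\<close> and
  \<open>i + k + 2\<close>. These have the same parity, so by \<open>sum_cos_grid\<close> the two
  sums cancel unless \<open>i = k\<close>, where the first is \<open>n\<close> and the second is
  -1.\<close>

lemma dst_orthonormal:
  assumes i: "i < n" and k: "k < n"
  shows "(\<Sum>s<n. dst n i s * dst n k s) = (if i = k then 1 else 0)"
proof -
  define S where "S m = (\<Sum>s<n. cos (real (Suc s) * (real m * pi / (real n + 1))))" for m
  have "dst n i s * dst n k s = 1 / (real n + 1) *
      (cos (real (Suc s) * (real (if i \<le> k then k - i else i - k) * pi / (real n + 1)))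
       - cos (real (Suc s) * (real (i + k + 2) * pi / (real n + 1))))" for s
  proof -
    define a where "a = real (Suc i) * real (Suc s) * pi / (real n + 1)"
    define b where "b = real (Suc k) * real (Suc s) * pi / (real n + 1)"
    have e1: "real (Suc s) * (real (i + k + 2) * pi / (real n + 1)) = a + b"
      by (simp add: a_def b_def algebra_simps add_divide_distrib)
    have e2: "cos (real (Suc s) * (real (if i \<le> k then k - i else i - k) * pi / (real n + 1))) = cos (a - b)"
    proof (cases "i \<le> k")
      case True
      then have "real (Suc s) * (real (k - i) * pi / (real n + 1)) = - (a - b)"
        by (simp add: a_def b_def algebra_simps add_divide_distrib diff_divide_distrib)
      then show ?thesis using True by (simp del: minus_diff_eq)
    next
      case False
      then have "real (Suc s) * (real (i - k) * pi / (real n + 1)) = a - b"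
        by (simp add: a_def b_def algebra_simps add_divide_distrib diff_divide_distrib)
      then show ?thesis using False by simp
    qed
    have e3: "dst n i s * dst n k s = 2 / (real n + 1) * (sin a * sin b)"
    proof -
      have "dst n i s * dst n k s = (sqrt (2 / (real n + 1)) * sqrt (2 / (real n + 1))) * (sin a * sin b)"
        by (simp only: dst_def a_def b_def mult_ac)
      then show ?thesis by simp
    qed
    show ?thesis unfolding e1 e2 e3 cos_add cos_diff by (simp add: field_simps)
  qed
  then have f1: "(\<Sum>s<n. dst n i s * dst n k s) =
     1 / (real n + 1) * (S (if i \<le> k then k - i else i - k) - S (i + k + 2))"
    unfolding S_def by (simp only: sum_distrib_left[symmetric] sum_subtractf)
  have f2: "S (i + k + 2) = (- 1 - (-1) ^ (i + k + 2)) / 2"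
    unfolding S_def by (rule sum_cos_grid) (use i k in auto)
  have f3: "S (if i \<le> k then k - i else i - k) = (if i = k then real n else (- 1 - (-1) ^ (i + k + 2)) / 2)"
  proof (cases "i = k")
    case True
    then show ?thesis by (simp add: S_def)
  next
    case False
    then have "S (if i \<le> k then k - i else i - k) = (- 1 - (-1) ^ (if i \<le> k then k - i else i - k)) / 2"
      unfolding S_def by (intro sum_cos_grid) (use i k in auto)
    moreover have "even (if i \<le> k then k - i else i - k) \<longleftrightarrow> even (i + k + 2)" by auto
    ultimately show ?thesis using False by (simp only: minus_one_power_iff if_False)
  qed
  show ?thesis unfolding f1 f2 f3 by (auto simp: power_add field_simps)
qed

lemma dst_sym: "dst n i s = dst n s i"
  by (simp add: dst_def mult_ac)

text \<open>Reversal turns the angle \<open>x\<close> into \<open>(i + 1) * pi - x\<close>. The sign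
  is \<open>(-1) ^ i\<close> because \<open>i\<close> starts at 0.\<close>

lemma dst_flip:
  assumes "s < n"
  shows "dst n i (n - 1 - s) = (-1) ^ i * dst n i s"
proof -
  define x where "x = real (Suc i) * real (Suc s) * pi / (real n + 1)"
  have "real (Suc (n - 1 - s)) = real n - real s" using assms by (simp add:)
  then have "real (Suc i) * real (Suc (n - 1 - s)) * pi / (real n + 1) = real (Suc i) * pi - x"
    by (simp add: x_def field_simps)
  then have "sin (real (Suc i) * real (Suc (n - 1 - s)) * pi / (real n + 1)) = (-1) ^ i * sin x"
    by (simp only: sin_diff sin_npi cos_npi) simp
  then show ?thesis by (simp add: dst_def x_def)
qed

text \<open>The Toeplitz matrix of \<open>cos (k \<theta>)\<close> acts on the sine vectors as multiplication by
  \<open>cos (k \<theta>)\<close>, except in the rows within distance \<open>k\<close> of the boundary.\<close>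

lemma dst_shift:
  assumes i: "i < n" and s: "s < n"
  defines "\<theta> \<equiv> real (Suc i) * pi / (real n + 1)"
  shows "\<bar>((if k \<le> s then dst n i (s - k) else 0) + (if s + k < n then dst n i (s + k) else 0)) / 2
       - cos (real k * \<theta>) * dst n i s\<bar>
     \<le> (if s < k \<or> n \<le> s + k then sqrt (2 / (real n + 1)) else 0)"
proof -
  define r where "r = sqrt (2 / (real n + 1))"
  define u where "u x = r * sin (x * \<theta>)" for x :: real
  have r: "r \<ge> 0" by (simp add: r_def)
  have d: "dst n i t = u (real t + 1)" for t
    by (simp add: u_def dst_def r_def \<theta>_def mult_ac add.commute)
  have ub: "\<bar>u x\<bar> \<le> r" for x unfolding u_def abs_mult using r by (simp add: mult_left_le)
  have c: "cos (real k * \<theta>) * dst n i s = (u (real s - real k + 1) + u (real s + real k + 1)) / 2"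
  proof -
    have "(real s - real k + 1) * \<theta> = (real s + 1) * \<theta> - real k * \<theta>"
      "(real s + real k + 1) * \<theta> = (real s + 1) * \<theta> + real k * \<theta>" by (simp_all add: algebra_simps)
    then show ?thesis unfolding d u_def by (simp only: sin_add sin_diff) (simp add: algebra_simps)
  qed
  \<comment> \<open>The sine wave \<open>u\<close> continues beyond the matrix. Only its values
    outside the index range are missing: at most two, each of size at most \<open>r\<close>, and
    their sum is halved at the end.\<close>
  have "(if k \<le> s then dst n i (s - k) else 0) + (if s + k < n then dst n i (s + k) else 0)
      - (u (real s - real k + 1) + u (real s + real k + 1)) =
      - (if k \<le> s then 0 else u (real s - real k + 1)) - (if s + k < n then 0 else u (real s + real k + 1))"
    by (simp add: d)
  moreover have "\<bar>- (if k \<le> s then 0 else u (real s - real k + 1)) - (if s + k < n then 0 else u (real s + real k + 1))\<bar>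
      \<le> (if s < k \<or> n \<le> s + k then 2 * r else 0)"
    using ub[of "real s - real k + 1"] ub[of "real s + real k + 1"] r by (auto simp: abs_if split: if_splits)
  ultimately have "\<bar>(if k \<le> s then dst n i (s - k) else 0) + (if s + k < n then dst n i (s + k) else 0)
      - (u (real s - real k + 1) + u (real s + real k + 1))\<bar> \<le> (if s < k \<or> n \<le> s + k then 2 * r else 0)"
    by simp
  then show ?thesis unfolding c r_def[symmetric] by (auto simp: field_simps split: if_splits)
qed

section \<open>Doubly stochastic transport\<close>

lemma sorted_enumeration:
  fixes g :: "'i \<Rightarrow> real"
  assumes "finite I"
  shows "\<exists>b. bij_betw b {..<card I} I \<and> (\<forall>p q. p \<le> q \<longrightarrow> q < card I \<longrightarrow> g (b p) \<le> g (b q))"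
proof -
  obtain ys where ys: "set ys = I" "distinct ys" using finite_distinct_list[OF assms] by blast
  define xs where "xs = sort_key g ys"
  have xs: "set xs = I" "distinct xs" "length xs = card I" "sorted (map g xs)"
    using ys by (auto simp: xs_def distinct_card[symmetric])
  have "bij_betw ((!) xs) {..<card I} I" using bij_betw_nth[OF xs(2)] xs by simp
  moreover have "g (xs ! p) \<le> g (xs ! q)" if "p \<le> q" "q < card I" for p q
    using sorted_nth_mono[OF xs(4), of p q] that xs(3) by simp
  ultimately show ?thesis by blast
qed

text \<open>Elements of equal rank in the two sorted orders are matched. The strict
  \<open>\<mu> i < \<mu> k\<close> leaves ties free.\<close>

lemma comonotone_bijection:
  fixes \<mu> \<nu> :: "'i \<Rightarrow> real"
  assumes "finite I"
  shows "\<exists>\<sigma>. bij_betw \<sigma> I I \<and> (\<forall>i\<in>I. \<forall>k\<in>I. \<mu> i < \<mu> k \<longrightarrow> \<nu> (\<sigma> i) \<le> \<nu> (\<sigma> k))"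
proof -
  obtain b where b: "bij_betw b {..<card I} I" "\<And>p q. p \<le> q \<Longrightarrow> q < card I \<Longrightarrow> \<mu> (b p) \<le> \<mu> (b q)"
    using sorted_enumeration[OF assms, of \<mu>] by blast
  obtain c where c: "bij_betw c {..<card I} I" "\<And>p q. p \<le> q \<Longrightarrow> q < card I \<Longrightarrow> \<nu> (c p) \<le> \<nu> (c q)"
    using sorted_enumeration[OF assms, of \<nu>] by blast
  define \<sigma> where "\<sigma> = c \<circ> inv_into {..<card I} b"
  have "bij_betw \<sigma> I I"
    unfolding \<sigma>_def using bij_betw_trans[OF bij_betw_inv_into[OF b(1)] c(1)] .
  moreover have "\<nu> (\<sigma> i) \<le> \<nu> (\<sigma> k)" if ik: "i \<in> I" "k \<in> I" "\<mu> i < \<mu> k" for i k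
  proof -
    obtain p q where pq: "p < card I" "i = b p" "q < card I" "k = b q"
      using b(1) ik(1,2) unfolding bij_betw_def by (metis imageE lessThan_iff)
    have "p \<le> q" using b(2)[of q p] pq ik(3) by (metis linorder_not_less nat_le_linear)
    moreover have "\<sigma> i = c p" "\<sigma> k = c q"
      using b(1) pq by (auto simp: \<sigma>_def bij_betw_def)
    ultimately show ?thesis using c(2) pq by simp
  qed
  ultimately show ?thesis by blast
qed

text \<open>The columns outside \<open>B\<close> absorb at most \<open>card I - card B\<close> of
  the mass \<open>card A\<close> sent out by the rows in \<open>A\<close>. The rest stays in
  \<open>A \<times> B\<close>, where each unit costs at least the square of
  \<open>e\<close>.\<close>

lemma transport_cost_ge:
  fixes W :: "'i \<Rightarrow> 'i \<Rightarrow> real"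
  assumes fin: "finite I" and W0: "\<And>i j. i \<in> I \<Longrightarrow> j \<in> I \<Longrightarrow> W i j \<ge> 0"
    and row: "\<And>i. i \<in> I \<Longrightarrow> (\<Sum>j\<in>I. W i j) = 1"
    and col: "\<And>j. j \<in> I \<Longrightarrow> (\<Sum>i\<in>I. W i j) = 1"
    and A: "A \<subseteq> I" and B: "B \<subseteq> I" and e: "e \<ge> 0"
    and sep: "\<And>i j. i \<in> A \<Longrightarrow> j \<in> B \<Longrightarrow> \<bar>\<nu> j - \<mu> i\<bar> \<ge> e"
  shows "(real (card A) + real (card B) - real (card I)) * e\<^sup>2 \<le> (\<Sum>i\<in>I. \<Sum>j\<in>I. W i j * (\<nu> j - \<mu> i)\<^sup>2)"
proof -
  have finAB: "finite A" "finite B" using A B fin finite_subset by auto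
  have "(\<Sum>i\<in>A. \<Sum>j\<in>I-B. W i j) \<le> (\<Sum>i\<in>I. \<Sum>j\<in>I-B. W i j)"
    using A fin W0 by (intro sum_mono2) (auto intro!: sum_nonneg)
  also have "\<dots> = (\<Sum>j\<in>I-B. \<Sum>i\<in>I. W i j)" by (rule sum.swap)
  also have "\<dots> = real (card I) - real (card B)"
    using col fin B finAB by (simp add: card_Diff_subset card_mono of_nat_diff)
  finally have 1: "(\<Sum>i\<in>A. \<Sum>j\<in>I-B. W i j) \<le> real (card I) - real (card B)" .
  have "(\<Sum>i\<in>A. \<Sum>j\<in>B. W i j) = (\<Sum>i\<in>A. 1 - (\<Sum>j\<in>I-B. W i j))"
  proof (rule sum.cong[OF refl])
    fix i assume "i \<in> A"
    then show "(\<Sum>j\<in>B. W i j) = 1 - (\<Sum>j\<in>I-B. W i j)"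
      using sum.subset_diff[OF B fin, of "W i"] row[of i] A by auto
  qed
  then have 2: "real (card A) + real (card B) - real (card I) \<le> (\<Sum>i\<in>A. \<Sum>j\<in>B. W i j)"
    using 1 by (simp add: sum_subtractf)
  have "(real (card A) + real (card B) - real (card I)) * e\<^sup>2 \<le> (\<Sum>i\<in>A. \<Sum>j\<in>B. W i j) * e\<^sup>2"
    using 2 by (intro mult_right_mono) auto
  also have "\<dots> = (\<Sum>i\<in>A. \<Sum>j\<in>B. W i j * e\<^sup>2)" by (simp add: sum_distrib_right)
  also have "\<dots> \<le> (\<Sum>i\<in>A. \<Sum>j\<in>B. W i j * (\<nu> j - \<mu> i)\<^sup>2)"
  proof (intro sum_mono mult_left_mono)
    fix i j assume ij: "i \<in> A" "j \<in> B"
    show "e\<^sup>2 \<le> (\<nu> j - \<mu> i)\<^sup>2" using power_mono[OF sep[OF ij] e, of 2] by simp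
    show "0 \<le> W i j" using W0 ij A B by auto
  qed
  also have "\<dots> \<le> (\<Sum>i\<in>A. \<Sum>j\<in>I. W i j * (\<nu> j - \<mu> i)\<^sup>2)"
    using A B fin W0 by (intro sum_mono sum_mono2) auto
  also have "\<dots> \<le> (\<Sum>i\<in>I. \<Sum>j\<in>I. W i j * (\<nu> j - \<mu> i)\<^sup>2)"
    using A fin W0 by (intro sum_mono2) (auto intro!: sum_nonneg)
  finally show ?thesis .
qed

text \<open>All samples above \<open>\<mu> k\<close> are matched with values above
  \<open>\<mu> k + e\<close>. With \<open>A\<close> the samples below \<open>\<mu> k + e / 2\<close>
  and \<open>B\<close> the values above \<open>\<mu> k + e\<close>, the surplus in
  \<open>transport_cost_ge\<close> is therefore at least the number of samples in the window, and
  each unit travels at least \<open>e / 2\<close>.\<close>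

lemma comonotone_transport_above:
  fixes W :: "'i \<Rightarrow> 'i \<Rightarrow> real"
  assumes fin: "finite I" and W0: "\<And>i j. i \<in> I \<Longrightarrow> j \<in> I \<Longrightarrow> W i j \<ge> 0"
    and row: "\<And>i. i \<in> I \<Longrightarrow> (\<Sum>j\<in>I. W i j) = 1"
    and col: "\<And>j. j \<in> I \<Longrightarrow> (\<Sum>i\<in>I. W i j) = 1"
    and \<sigma>: "bij_betw \<sigma> I I" "\<And>i k. i \<in> I \<Longrightarrow> k \<in> I \<Longrightarrow> \<mu> i < \<mu> k \<Longrightarrow> \<nu> (\<sigma> i) \<le> \<nu> (\<sigma> k)"
    and e: "e > 0" and k: "k \<in> I" and gap: "\<nu> (\<sigma> k) > \<mu> k + e"
  shows "real (card {i\<in>I. \<mu> k < \<mu> i \<and> \<mu> i < \<mu> k + e / 2}) * (e / 2)\<^sup>2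
    \<le> (\<Sum>i\<in>I. \<Sum>j\<in>I. W i j * (\<nu> j - \<mu> i)\<^sup>2)"
proof -
  define A where "A = {i\<in>I. \<mu> i < \<mu> k + e / 2}"
  define B where "B = {j\<in>I. \<nu> j > \<mu> k + e}"
  define D where "D = {i\<in>I. \<mu> k < \<mu> i \<and> \<mu> i < \<mu> k + e / 2}"
  define L where "L = {i\<in>I. \<mu> i \<le> \<mu> k}"
  have "A = L \<union> D" "L \<inter> D = {}" using e by (auto simp: A_def L_def D_def)
  then have cA: "card A = card L + card D" using fin by (simp add: card_Un_disjoint L_def D_def)
  have "\<sigma> ` (I - L) \<subseteq> B"
  proof
    fix j assume "j \<in> \<sigma> ` (I - L)"
    then obtain i where "i \<in> I - L" "j = \<sigma> i" by blast
    then have i: "i \<in> I" "\<mu> k < \<mu> i" "j = \<sigma> i" by (auto simp: L_def)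
    then show "j \<in> B" using \<sigma>(2)[OF k i(1,2)] gap \<sigma>(1) by (auto simp: B_def bij_betw_def)
  qed
  then have "card (\<sigma> ` (I - L)) \<le> card B" using fin by (intro card_mono) (auto simp: B_def)
  moreover have "card (\<sigma> ` (I - L)) = card I - card L"
    using \<sigma>(1) fin by (subst card_image) (auto simp: bij_betw_def L_def card_Diff_subset intro: inj_on_subset)
  moreover have "card L \<le> card I" using fin by (intro card_mono) (auto simp: L_def)
  ultimately have "real (card D) \<le> real (card A) + real (card B) - real (card I)" using cA by linarith
  then have "real (card D) * (e / 2)\<^sup>2 \<le> (real (card A) + real (card B) - real (card I)) * (e / 2)\<^sup>2"
    by (intro mult_right_mono) auto
  also have "\<dots> \<le> (\<Sum>i\<in>I. \<Sum>j\<in>I. W i j * (\<nu> j - \<mu> i)\<^sup>2)"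
  proof (rule transport_cost_ge[OF fin W0 row col])
    fix i j assume "i \<in> A" "j \<in> B"
    then show "e / 2 \<le> \<bar>\<nu> j - \<mu> i\<bar>" unfolding A_def B_def by (simp add: abs_if)
  qed (use e in \<open>auto simp: A_def B_def\<close>)
  finally show ?thesis unfolding D_def .
qed

text \<open>The mirror image of \<open>comonotone_transport_above\<close>: \<open>\<sigma>\<close>
  stays comonotone when both \<open>\<mu>\<close> and \<open>\<nu>\<close> are negated.\<close>

lemma comonotone_transport_below:
  fixes W :: "'i \<Rightarrow> 'i \<Rightarrow> real"
  assumes fin: "finite I" and W0: "\<And>i j. i \<in> I \<Longrightarrow> j \<in> I \<Longrightarrow> W i j \<ge> 0"
    and row: "\<And>i. i \<in> I \<Longrightarrow> (\<Sum>j\<in>I. W i j) = 1"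
    and col: "\<And>j. j \<in> I \<Longrightarrow> (\<Sum>i\<in>I. W i j) = 1"
    and \<sigma>: "bij_betw \<sigma> I I" "\<And>i k. i \<in> I \<Longrightarrow> k \<in> I \<Longrightarrow> \<mu> i < \<mu> k \<Longrightarrow> \<nu> (\<sigma> i) \<le> \<nu> (\<sigma> k)"
    and e: "e > 0" and k: "k \<in> I" and gap: "\<nu> (\<sigma> k) < \<mu> k - e"
  shows "real (card {i\<in>I. \<mu> k - e / 2 < \<mu> i \<and> \<mu> i < \<mu> k}) * (e / 2)\<^sup>2
    \<le> (\<Sum>i\<in>I. \<Sum>j\<in>I. W i j * (\<nu> j - \<mu> i)\<^sup>2)"
proof -
  have "real (card {i\<in>I. - \<mu> k < - \<mu> i \<and> - \<mu> i < - \<mu> k + e / 2}) * (e / 2)\<^sup>2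
    \<le> (\<Sum>i\<in>I. \<Sum>j\<in>I. W i j * (- \<nu> j - - \<mu> i)\<^sup>2)"
    by (rule comonotone_transport_above[where \<mu> = "\<lambda>i. - \<mu> i" and \<nu> = "\<lambda>j. - \<nu> j" and \<sigma> = \<sigma>, OF fin W0 row col \<sigma>(1)])
      (use \<sigma>(2) e k gap in auto)
  moreover have "{i\<in>I. - \<mu> k < - \<mu> i \<and> - \<mu> i < - \<mu> k + e / 2} = {i\<in>I. \<mu> k - e / 2 < \<mu> i \<and> \<mu> i < \<mu> k}"
    by auto
  moreover have "(- \<nu> j - - \<mu> i)\<^sup>2 = (\<nu> j - \<mu> i)\<^sup>2" for i j by (simp add: power2_eq_square algebra_simps)
  ultimately show ?thesis by simp
qed

section \<open>Cosine coefficients of bounded measurable functions\<close>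

text \<open>A class that contains the Riemann integrable functions and the cosine polynomials and is
  closed under products, as the integrable functions are not; introduction rules then settle the
  integrability conditions.\<close>

definition bounded_meas :: "(real \<Rightarrow> real) \<Rightarrow> bool" where
  "bounded_meas h \<longleftrightarrow> h \<in> borel_measurable (lebesgue_on {-pi..pi}) \<and> bounded (h ` {-pi..pi})"

lemma bounded_meas_bound: "bounded_meas h \<Longrightarrow> \<exists>B. \<forall>x\<in>{-pi..pi}. \<bar>h x\<bar> \<le> B"
  by (auto simp: bounded_meas_def bounded_iff)

lemma bounded_meas_integrable:
  assumes "bounded_meas h"
  shows "h absolutely_integrable_on {-pi..pi}"
proof -
  obtain B where B: "\<forall>x\<in>{-pi..pi}. \<bar>h x\<bar> \<le> B"
    using bounded_meas_bound[OF assms] by blast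
  show ?thesis
    using assms B unfolding bounded_meas_def
    by (intro measurable_bounded_by_integrable_imp_absolutely_integrable[where g = "\<lambda>_. B"]) auto
qed

lemma bounded_meas_integrable_on: "bounded_meas h \<Longrightarrow> h integrable_on {-pi..pi}"
  using bounded_meas_integrable absolutely_integrable_on_def by blast

lemma bounded_meas_continuous: "continuous_on {-pi..pi} h \<Longrightarrow> bounded_meas h"
  unfolding bounded_meas_def
  by (auto intro!: continuous_imp_measurable_on_sets_lebesgue compact_imp_bounded compact_continuous_image)

lemma bounded_meas_const: "bounded_meas (\<lambda>_. c)"
  by (rule bounded_meas_continuous) auto

lemma bounded_meas_cos: "bounded_meas (\<lambda>x. cos (c * x))" "bounded_meas (\<lambda>x. sin (c * x))"
  by (intro bounded_meas_continuous continuous_intros)+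

lemma bounded_meas_add: "bounded_meas f \<Longrightarrow> bounded_meas g \<Longrightarrow> bounded_meas (\<lambda>x. f x + g x)"
  unfolding bounded_meas_def by (auto intro: bounded_plus_comp)

lemma bounded_meas_minus: "bounded_meas f \<Longrightarrow> bounded_meas g \<Longrightarrow> bounded_meas (\<lambda>x. f x - g x)"
  unfolding bounded_meas_def by (auto intro: bounded_minus_comp)

lemma bounded_meas_mult:
  assumes "bounded_meas f" "bounded_meas g" shows "bounded_meas (\<lambda>x. f x * g x)"
proof -
  obtain a b where ab: "\<forall>x\<in>{-pi..pi}. \<bar>f x\<bar> \<le> a" "\<forall>x\<in>{-pi..pi}. \<bar>g x\<bar> \<le> b"
    using bounded_meas_bound[OF assms(1)] bounded_meas_bound[OF assms(2)] by blast
  have "norm (f x * g x) \<le> a * b" if "x \<in> {-pi..pi}" for x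
  proof -
    have "\<bar>f x\<bar> \<le> a" "\<bar>g x\<bar> \<le> b" using ab that by blast+
    then have "\<bar>f x\<bar> * \<bar>g x\<bar> \<le> a * b" by (intro mult_mono) auto
    then show ?thesis by (simp add: abs_mult)
  qed
  then have "bounded ((\<lambda>x. f x * g x) ` {-pi..pi})" unfolding bounded_iff by blast
  then show ?thesis using assms by (auto simp: bounded_meas_def)
qed

lemma bounded_meas_sum:
  "(\<And>i. i \<in> I \<Longrightarrow> bounded_meas (f i)) \<Longrightarrow> bounded_meas (\<lambda>x. \<Sum>i\<in>I. f i x)"
  by (induction I rule: infinite_finite_induct) (simp_all add: bounded_meas_const bounded_meas_add)

lemma bounded_meas_power2: "bounded_meas f \<Longrightarrow> bounded_meas (\<lambda>x. (f x)\<^sup>2)"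
  unfolding power2_eq_square by (rule bounded_meas_mult)

lemmas bounded_meas_intros = bounded_meas_const bounded_meas_cos bounded_meas_add bounded_meas_minus
  bounded_meas_mult bounded_meas_sum bounded_meas_power2

text \<open>Uses the Henstock-Kurzweil integral, which on \<open>bounded_meas\<close> functions
  agrees with the Lebesgue integral.\<close>

definition circle_mean :: "(real \<Rightarrow> real) \<Rightarrow> real" where
  "circle_mean h = integral {-pi..pi} h / (2 * pi)"

lemma circle_mean_add: "bounded_meas f \<Longrightarrow> bounded_meas g \<Longrightarrow> circle_mean (\<lambda>x. f x + g x) = circle_mean f + circle_mean g"
  by (simp add: circle_mean_def integral_add bounded_meas_integrable_on add_divide_distrib)

lemma circle_mean_diff: "bounded_meas f \<Longrightarrow> bounded_meas g \<Longrightarrow> circle_mean (\<lambda>x. f x - g x) = circle_mean f - circle_mean g"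
  by (simp add: circle_mean_def integral_diff bounded_meas_integrable_on diff_divide_distrib)

lemma circle_mean_cmult [simp]: "circle_mean (\<lambda>x. c * f x) = c * circle_mean f"
  by (simp add: circle_mean_def)

lemma circle_mean_sum:
  "finite I \<Longrightarrow> (\<And>i. i \<in> I \<Longrightarrow> bounded_meas (f i)) \<Longrightarrow> circle_mean (\<lambda>x. \<Sum>i\<in>I. f i x) = (\<Sum>i\<in>I. circle_mean (f i))"
  by (simp add: circle_mean_def integral_sum bounded_meas_integrable_on sum_divide_distrib)

lemma circle_mean_nonneg:
  assumes "bounded_meas f" "\<And>x. x \<in> {-pi..pi} \<Longrightarrow> f x \<ge> 0" shows "circle_mean f \<ge> 0"
  unfolding circle_mean_def using assms by (intro divide_nonneg_pos integral_nonneg bounded_meas_integrable_on) auto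

lemma circle_mean_cos: "circle_mean (\<lambda>x. cos (real_of_int k * x)) = (if k = 0 then 1 else 0)"
proof (cases "k = 0")
  case False
  have "((\<lambda>x. cos (real_of_int k * x)) has_integral
      (sin (real_of_int k * pi) / real_of_int k - sin (real_of_int k * (-pi)) / real_of_int k)) {-pi..pi}"
    using False by (intro fundamental_theorem_of_calculus)
      (auto intro!: derivative_eq_intros simp: has_real_derivative_iff_has_vector_derivative[symmetric])
  then show ?thesis using False by (simp add: circle_mean_def integral_unique sin_int_times_real mult.commute)
qed (simp add: circle_mean_def)

text \<open>Normalized as a two-sided Fourier coefficient, without the factor 2 of a cosine
  series.\<close>

definition cosine_coeff :: "(real \<Rightarrow> real) \<Rightarrow> int \<Rightarrow> real" where
  "cosine_coeff h k = circle_mean (\<lambda>x. h x * cos (real_of_int k * x))"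

lemma cosine_coeff_minus [simp]: "cosine_coeff h (- k) = cosine_coeff h k"
  by (simp add: cosine_coeff_def)

lemma cosine_coeff_add: "bounded_meas f \<Longrightarrow> bounded_meas g \<Longrightarrow> cosine_coeff (\<lambda>x. f x + g x) k = cosine_coeff f k + cosine_coeff g k"
  unfolding cosine_coeff_def distrib_right by (intro circle_mean_add bounded_meas_intros)

lemma cosine_coeff_diff: "bounded_meas f \<Longrightarrow> bounded_meas g \<Longrightarrow> cosine_coeff (\<lambda>x. f x - g x) k = cosine_coeff f k - cosine_coeff g k"
  unfolding cosine_coeff_def left_diff_distrib by (intro circle_mean_diff bounded_meas_intros)

lemma cosine_coeff_cmult: "cosine_coeff (\<lambda>x. c * f x) k = c * cosine_coeff f k"
  unfolding cosine_coeff_def by (simp add: mult.assoc)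

lemma cosine_coeff_cos:
  "cosine_coeff (\<lambda>x. cos (real_of_int m * x)) k = ((if k = m then 1 else 0) + (if k = - m then 1 else 0)) / 2"
proof -
  have "cos a * cos b = (1/2) * cos (a - b) + (1/2) * cos (a + b)" for a b :: real
    by (simp add: cos_add cos_diff field_simps)
  from this[of "real_of_int m * x" "real_of_int k * x" for x]
  have "(\<lambda>x. cos (real_of_int m * x) * cos (real_of_int k * x)) =
    (\<lambda>x. (1/2) * cos (real_of_int (m - k) * x) + (1/2) * cos (real_of_int (m + k) * x))"
    by (simp only: of_int_diff of_int_add left_diff_distrib distrib_right)
  then have "cosine_coeff (\<lambda>x. cos (real_of_int m * x)) k =
      (1/2) * circle_mean (\<lambda>x. cos (real_of_int (m - k) * x)) + (1/2) * circle_mean (\<lambda>x. cos (real_of_int (m + k) * x))"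
    unfolding cosine_coeff_def by (simp only: circle_mean_cmult circle_mean_add bounded_meas_intros)
  then show ?thesis unfolding circle_mean_cos by auto
qed

lemma cosine_coeff_one: "cosine_coeff (\<lambda>_. 1) k = (if k = 0 then 1 else 0)"
  using circle_mean_cos[of k] by (simp add: cosine_coeff_def)

text \<open>By reflection the sine part has integral 0. Absolute integrability identifies the
  Lebesgue integral in \<open>fourier_coeff\<close> with the Henstock-Kurzweil integral.\<close>

lemma fourier_coeff_eq_cosine_coeff:
  assumes f: "bounded_meas f" and even: "\<forall>x\<in>{-pi..pi}. f (- x) = f x"
  shows "fourier_coeff (\<lambda>x. complex_of_real (f x)) k = complex_of_real (cosine_coeff f k)"
proof -
  define C where "C = integral {-pi..pi} (\<lambda>x. f x * cos (real_of_int k * x))"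
  define S where "S = integral {-pi..pi} (\<lambda>x. f x * sin (real_of_int k * x))"
  have bm: "bounded_meas (\<lambda>x. f x * cos (real_of_int k * x))" "bounded_meas (\<lambda>x. f x * sin (real_of_int k * x))"
    by (intro bounded_meas_intros f)+
  have "S = integral {-pi..pi} (\<lambda>x. (\<lambda>y. f y * sin (real_of_int k * y)) (- x))"
    unfolding S_def using Henstock_Kurzweil_Integration.integral_reflect_real[of pi "-pi" "\<lambda>y. f y * sin (real_of_int k * y)"] by simp
  also have "\<dots> = integral {-pi..pi} (\<lambda>x. - (f x * sin (real_of_int k * x)))"
    using even by (intro Henstock_Kurzweil_Integration.integral_cong) auto
  finally have S0: "S = 0" by (simp add: S_def)
  have eq: "complex_of_real (f x) * exp (- \<i> * of_int k * complex_of_real x) =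
      complex_of_real (f x * cos (real_of_int k * x)) - \<i> * complex_of_real (f x * sin (real_of_int k * x))" for x
  proof -
    have "exp (- \<i> * of_int k * complex_of_real x) = cis (- (real_of_int k * x))"
      by (simp add: cis_conv_exp mult.assoc)
    then show ?thesis by (simp add: complex_eq_iff)
  qed
  have hi: "((\<lambda>x. complex_of_real (f x) * exp (- \<i> * of_int k * complex_of_real x)) has_integral
      (complex_of_real C - \<i> * complex_of_real S)) {-pi..pi}"
    unfolding eq C_def S_def
    by (intro has_integral_diff has_integral_mult_right has_integral_of_real integrable_integral
        bounded_meas_integrable_on bm)
  have ofr: "(\<lambda>x. complex_of_real (h x)) absolutely_integrable_on {-pi..pi}" if "bounded_meas h" for h
    using absolutely_integrable_linear[OF bounded_meas_integrable[OF that] bounded_linear_of_real]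
    by (simp add: o_def)
  have si: "set_integrable lebesgue {-pi..pi} (\<lambda>x. complex_of_real (f x) * exp (- \<i> * of_int k * complex_of_real x))"
    unfolding eq
    by (intro set_integral_diff set_integrable_mult_right ofr bm)
  have "(LINT x:{-pi..pi}|lebesgue. complex_of_real (f x) * exp (- \<i> * of_int k * complex_of_real x)) = complex_of_real C"
    using set_lebesgue_integral_eq_integral(2)[OF si] integral_unique[OF hi] S0 by simp
  then show ?thesis unfolding fourier_coeff_def cosine_coeff_def circle_mean_def C_def[symmetric] by simp
qed

text \<open>The weight is the squared modulus of the trigonometric polynomial with coefficients
  \<open>x\<close>, split into real and imaginary part to stay over the reals. Its nonnegativity
  yields the eigenvalue bounds.\<close>

lemma toeplitz_quadratic_form:
  assumes f: "bounded_meas f"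
  shows "(\<Sum>s<n. \<Sum>t<n. x s * x t * cosine_coeff f (int s - int t)) =
    circle_mean (\<lambda>\<theta>. f \<theta> * ((\<Sum>s<n. x s * cos (real s * \<theta>))\<^sup>2 + (\<Sum>s<n. x s * sin (real s * \<theta>))\<^sup>2))"
proof -
  have "f \<theta> * ((\<Sum>s<n. x s * cos (real s * \<theta>))\<^sup>2 + (\<Sum>s<n. x s * sin (real s * \<theta>))\<^sup>2) =
    (\<Sum>s<n. \<Sum>t<n. x s * x t * (f \<theta> * cos (real_of_int (int s - int t) * \<theta>)))" for \<theta>
  proof -
    have 1: "(\<Sum>s<n. x s * cos (real s * \<theta>))\<^sup>2 = (\<Sum>s<n. \<Sum>t<n. x s * cos (real s * \<theta>) * (x t * cos (real t * \<theta>)))"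
      "(\<Sum>s<n. x s * sin (real s * \<theta>))\<^sup>2 = (\<Sum>s<n. \<Sum>t<n. x s * sin (real s * \<theta>) * (x t * sin (real t * \<theta>)))"
      by (simp_all only: power2_eq_square sum_product)
    have "cos (real_of_int (int s - int t) * \<theta>) =
        cos (real s * \<theta>) * cos (real t * \<theta>) + sin (real s * \<theta>) * sin (real t * \<theta>)" for s t
      by (simp add: left_diff_distrib cos_diff)
    then show ?thesis
      unfolding 1 sum.distrib[symmetric] sum_distrib_left
      by (intro sum.cong refl) (simp add: algebra_simps)
  qed
  moreover have "bounded_meas (\<lambda>\<theta>. x s * x t * (f \<theta> * cos (real_of_int (int s - int t) * \<theta>)))" for s t
    by (intro bounded_meas_intros f)
  ultimately have "circle_mean (\<lambda>\<theta>. f \<theta> * ((\<Sum>s<n. x s * cos (real s * \<theta>))\<^sup>2 + (\<Sum>s<n. x s * sin (real s * \<theta>))\<^sup>2)) =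
      (\<Sum>s<n. \<Sum>t<n. circle_mean (\<lambda>\<theta>. x s * x t * (f \<theta> * cos (real_of_int (int s - int t) * \<theta>))))"
    by (simp only: circle_mean_sum bounded_meas_sum finite_lessThan)
  then show ?thesis unfolding circle_mean_cmult cosine_coeff_def ..
qed

text \<open>For a unit eigenvector the weight in \<open>toeplitz_quadratic_form\<close> has mean 1
  (take the symbol 1), so \<open>l\<close> is a weighted mean of \<open>f\<close>.\<close>

lemma toeplitz_eigenvalue_le:
  assumes f: "bounded_meas f" and M: "\<And>x. x \<in> {-pi..pi} \<Longrightarrow> f x \<le> M"
    and ev: "\<And>s. s < n \<Longrightarrow> (\<Sum>t<n. cosine_coeff f (int s - int t) * x t) = l * x s"
    and x: "(\<Sum>s<n. (x s)\<^sup>2) = 1"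
  shows "l \<le> M"
proof -
  define P where "P \<theta> = (\<Sum>s<n. x s * cos (real s * \<theta>))\<^sup>2 + (\<Sum>s<n. x s * sin (real s * \<theta>))\<^sup>2" for \<theta>
  have P: "bounded_meas P" unfolding P_def by (intro bounded_meas_intros)
  have "circle_mean (\<lambda>\<theta>. f \<theta> * P \<theta>) = (\<Sum>s<n. \<Sum>t<n. x s * x t * cosine_coeff f (int s - int t))"
    unfolding P_def toeplitz_quadratic_form[OF f] ..
  also have "\<dots> = (\<Sum>s<n. x s * (\<Sum>t<n. cosine_coeff f (int s - int t) * x t))"
    by (intro sum.cong refl) (simp add: sum_distrib_left mult_ac)
  also have "\<dots> = (\<Sum>s<n. x s * (l * x s))" by (intro sum.cong refl) (simp add: ev)
  also have "\<dots> = l * (\<Sum>s<n. (x s)\<^sup>2)"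
    by (simp add: sum_distrib_left power2_eq_square mult_ac)
  finally have 1: "circle_mean (\<lambda>\<theta>. f \<theta> * P \<theta>) = l" using x by simp
  have "circle_mean (\<lambda>\<theta>. 1 * P \<theta>) = (\<Sum>s<n. \<Sum>t<n. x s * x t * cosine_coeff (\<lambda>_. 1) (int s - int t))"
    unfolding P_def by (intro toeplitz_quadratic_form[symmetric] bounded_meas_const)
  also have "\<dots> = (\<Sum>s<n. \<Sum>t<n. if t = s then (x s)\<^sup>2 else 0)"
    unfolding cosine_coeff_one by (intro sum.cong refl) (auto simp: power2_eq_square)
  finally have 2: "circle_mean P = 1" using x by simp
  have "0 \<le> circle_mean (\<lambda>\<theta>. (M - f \<theta>) * P \<theta>)"
    using M by (intro circle_mean_nonneg bounded_meas_intros P f) (auto simp: P_def)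
  also have "\<dots> = circle_mean (\<lambda>\<theta>. M * P \<theta> - f \<theta> * P \<theta>)" by (simp add: left_diff_distrib)
  also have "\<dots> = circle_mean (\<lambda>\<theta>. M * P \<theta>) - circle_mean (\<lambda>\<theta>. f \<theta> * P \<theta>)"
    by (intro circle_mean_diff bounded_meas_intros P f)
  also have "\<dots> = M - l" by (simp add: 1 2)
  finally show ?thesis by simp
qed

lemma toeplitz_eigenvalue_ge:
  assumes f: "bounded_meas f" and M: "\<And>x. x \<in> {-pi..pi} \<Longrightarrow> M \<le> f x"
    and ev: "\<And>s. s < n \<Longrightarrow> (\<Sum>t<n. cosine_coeff f (int s - int t) * x t) = l * x s"
    and x: "(\<Sum>s<n. (x s)\<^sup>2) = 1"
  shows "M \<le> l"
proof -
  have "bounded_meas (\<lambda>x. (-1) * f x)" by (intro bounded_meas_intros f)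
  moreover have "(\<Sum>t<n. cosine_coeff (\<lambda>x. (-1) * f x) (int s - int t) * x t) = (- l) * x s" if "s < n" for s
    unfolding cosine_coeff_cmult using ev[OF that] by (simp add: sum_negf)
  ultimately have "- l \<le> - M" using M x by (intro toeplitz_eigenvalue_le[of "\<lambda>x. (-1) * f x" "- M" n x "- l"]) simp_all
  then show ?thesis by simp
qed

text \<open>The frequencies \<open>k\<close> and \<open>- k\<close> give the same cosine and the
  same coefficient; each contributes one half to a coefficient of the two-sided sum
  \<open>G\<close>. Hence \<open>G\<close> reproduces the coefficients of \<open>g\<close> up to
  \<open>K\<close>, and the mean of the square of \<open>g - G\<close> gives the inequality.\<close>

lemma bessel_cos:
  assumes g: "bounded_meas g"
  shows "(\<Sum>k\<in>{-K..K}. (cosine_coeff g k)\<^sup>2) \<le> circle_mean (\<lambda>x. (g x)\<^sup>2)"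
proof -
  define c where "c = cosine_coeff g"
  define G where "G x = (\<Sum>k\<in>{-K..K}. c k * cos (real_of_int k * x))" for x
  have Gb: "bounded_meas G" unfolding G_def by (intro bounded_meas_intros)
  have GX: "circle_mean (\<lambda>x. h x * G x) = (\<Sum>k\<in>{-K..K}. c k * cosine_coeff h k)" if h: "bounded_meas h" for h
  proof -
    have "circle_mean (\<lambda>x. h x * G x) = circle_mean (\<lambda>x. \<Sum>k\<in>{-K..K}. c k * (h x * cos (real_of_int k * x)))"
      unfolding G_def by (simp add: sum_distrib_left mult_ac)
    also have "\<dots> = (\<Sum>k\<in>{-K..K}. c k * cosine_coeff h k)"
      by (subst circle_mean_sum) (auto simp: cosine_coeff_def intro!: bounded_meas_intros h)
    finally show ?thesis .
  qed
  have "cosine_coeff G k = c k" if k: "k \<in> {-K..K}" for k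
  proof -
    have "cosine_coeff G k = circle_mean (\<lambda>x. cos (real_of_int k * x) * G x)"
      by (simp add: cosine_coeff_def mult.commute)
    also have "\<dots> = (\<Sum>j\<in>{-K..K}. (if j = k then c j / 2 else 0) + (if j = - k then c j / 2 else 0))"
      unfolding GX[OF bounded_meas_cos(1)] cosine_coeff_cos by (intro sum.cong) auto
    also have "\<dots> = c k" using k by (simp add: sum.distrib c_def)
    finally show ?thesis .
  qed
  then have GG: "circle_mean (\<lambda>x. G x * G x) = (\<Sum>k\<in>{-K..K}. (c k)\<^sup>2)"
    by (simp add: GX[OF Gb] power2_eq_square)
  have gG: "circle_mean (\<lambda>x. g x * G x) = (\<Sum>k\<in>{-K..K}. (c k)\<^sup>2)"
    by (simp add: GX[OF g] power2_eq_square c_def)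
  have "0 \<le> circle_mean (\<lambda>x. (g x - G x)\<^sup>2)" by (intro circle_mean_nonneg bounded_meas_intros g Gb) auto
  also have "\<dots> = circle_mean (\<lambda>x. ((g x)\<^sup>2 - 2 * (g x * G x)) + G x * G x)"
    by (simp add: power2_eq_square algebra_simps)
  also have "\<dots> = circle_mean (\<lambda>x. (g x)\<^sup>2) - 2 * circle_mean (\<lambda>x. g x * G x) + circle_mean (\<lambda>x. G x * G x)"
  proof -
    have "bounded_meas (\<lambda>x. (g x)\<^sup>2)" "bounded_meas (\<lambda>x. 2 * (g x * G x))" "bounded_meas (\<lambda>x. G x * G x)"
      by (intro bounded_meas_intros g Gb)+
    then show ?thesis by (simp add: circle_mean_add circle_mean_diff bounded_meas_minus)
  qed
  finally show ?thesis unfolding GG gG c_def by simp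
qed

text \<open>A row consists of coefficients with distinct indices, so Bessel's inequality bounds its
  square norm independently of \<open>n\<close>.\<close>

lemma toeplitz_frobenius_le:
  assumes g: "bounded_meas g"
  shows "(\<Sum>s<n. \<Sum>t<n. (cosine_coeff g (int s - int t))\<^sup>2) \<le> real n * circle_mean (\<lambda>x. (g x)\<^sup>2)"
proof -
  have "(\<Sum>t<n. (cosine_coeff g (int s - int t))\<^sup>2) \<le> circle_mean (\<lambda>x. (g x)\<^sup>2)" if s: "s < n" for s
  proof -
    have "(\<Sum>t<n. (cosine_coeff g (int s - int t))\<^sup>2) = (\<Sum>k\<in>(\<lambda>t. int s - int t) ` {..<n}. (cosine_coeff g k)\<^sup>2)"
      by (subst sum.reindex) (auto simp: inj_on_def)
    also have "\<dots> \<le> (\<Sum>k\<in>{- int n..int n}. (cosine_coeff g k)\<^sup>2)"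
      using s by (intro sum_mono2) auto
    also have "\<dots> \<le> circle_mean (\<lambda>x. (g x)\<^sup>2)" by (rule bessel_cos[OF g])
    finally show ?thesis .
  qed
  then have "(\<Sum>s<n. \<Sum>t<n. (cosine_coeff g (int s - int t))\<^sup>2) \<le> (\<Sum>s<n. circle_mean (\<lambda>x. (g x)\<^sup>2))"
    by (intro sum_mono) auto
  then show ?thesis by simp
qed

section \<open>Darboux sums\<close>

lemma cells_Union:
  fixes a h :: real
  assumes "h \<ge> 0" "N > 0"
  shows "(\<Union>j<N. {a + real j * h .. a + real (Suc j) * h}) = {a .. a + real N * h}"
  using assms(2)
proof (induction N rule: nat_induct_non_zero)
  case (Suc N)
  have "{a .. a + real N * h} \<union> {a + real N * h .. a + real (Suc N) * h} = {a .. a + real (Suc N) * h}"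
    using assms(1) by (intro ivl_disj_un_two_touch) (auto simp: algebra_simps)
  then show ?case using Suc by (simp add: lessThan_Suc Un_commute)
qed (simp add: lessThan_Suc)

lemma cells_tagged_division:
  fixes a h :: real
  assumes h: "h > 0" and N: "N > 0"
    and t: "\<And>j. j < N \<Longrightarrow> t j \<in> {a + real j * h .. a + real (Suc j) * h}"
  shows "(\<lambda>j. (t j, {a + real j * h .. a + real (Suc j) * h})) ` {..<N} tagged_division_of {a .. a + real N * h}"
proof (rule tagged_division_ofI)
  define K where "K j = {a + real j * h .. a + real (Suc j) * h}" for j
  show "finite ((\<lambda>j. (t j, {a + real j * h .. a + real (Suc j) * h})) ` {..<N})" by simp
  fix x L assume xL: "(x, L) \<in> (\<lambda>j. (t j, {a + real j * h .. a + real (Suc j) * h})) ` {..<N}"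
  then obtain j where j: "j < N" "x = t j" "L = K j" by (auto simp: K_def)
  show "x \<in> L" using t j by (simp add: K_def)
  have "K j \<subseteq> (\<Union>j<N. K j)" using j by blast
  then show "L \<subseteq> {a .. a + real N * h}" using cells_Union[of h N a] h N j unfolding K_def by simp
  show "\<exists>p q. L = cbox p q" unfolding j(3) K_def by (metis box_real(2))
  fix y M assume "(y, M) \<in> (\<lambda>j. (t j, {a + real j * h .. a + real (Suc j) * h})) ` {..<N}" "(x, L) \<noteq> (y, M)"
  then obtain i where i: "y = t i" "M = K i" "i \<noteq> j" using j by (auto simp: K_def)
  have disj: "interior (K p) \<inter> interior (K q) = {}" if "p < q" for p q
  proof -
    have "real (Suc p) * h \<le> real q * h" using that h by (intro mult_right_mono) auto
    then show ?thesis by (auto simp: K_def)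
  qed
  show "interior L \<inter> interior M = {}"
    using disj[of i j] disj[of j i] i j by (metis Int_commute linorder_neqE_nat)
next
  have "{K. \<exists>x. (x, K) \<in> (\<lambda>j. (t j, {a + real j * h .. a + real (Suc j) * h})) ` {..<N}} =
      (\<lambda>j. {a + real j * h .. a + real (Suc j) * h}) ` {..<N}" by auto
  then show "\<Union> {K. \<exists>x. (x, K) \<in> (\<lambda>j. (t j, {a + real j * h .. a + real (Suc j) * h})) ` {..<N}} = {a .. a + real N * h}"
    using cells_Union[of h N a] h N by simp
qed

text \<open>Riemann sums over a fine equidistant division are close to the integral whatever the
  tags. Exchanging \<open>x j\<close> and \<open>y j\<close> so that the larger values form one sum
  turns the difference of two such sums into a sum of absolute values.\<close>

lemma riemann_integrable_cells:
  assumes f: "riemann_integrable f a b" and ab: "a < b" and e: "e > 0"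
  shows "\<exists>N0>0. \<forall>N\<ge>N0. \<forall>x y. (\<forall>j<N. x j \<in> {a + real j * ((b - a) / real N) .. a + real (Suc j) * ((b - a) / real N)} \<and>
       y j \<in> {a + real j * ((b - a) / real N) .. a + real (Suc j) * ((b - a) / real N)}) \<longrightarrow>
      (\<Sum>j<N. \<bar>f (x j) - f (y j)\<bar>) \<le> e * real N"
proof -
  \<comment> \<open>Two sums within \<open>e'\<close> of \<open>I\<close> differ by less than
    \<open>e * (b - a)\<close>; division by the mesh \<open>(b - a) / N\<close> gives
    \<open>e * N\<close>.\<close>
  define e' where "e' = e * (b - a) / 2"
  have e': "e' > 0" using e ab by (simp add: e'_def)
  obtain I where I: "\<And>e. e > 0 \<Longrightarrow> \<exists>d>0. \<forall>D. D tagged_division_of {a..b} \<and> (\<forall>(x, K) \<in> D. diameter K < d) \<longrightarrow>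
        \<bar>(\<Sum>(x, K) \<in> D. measure lborel K * f x) - I\<bar> < e"
    using f unfolding riemann_integrable_def by blast
  obtain d where d: "d > 0" "\<And>D. D tagged_division_of {a..b} \<Longrightarrow> (\<forall>(x, K) \<in> D. diameter K < d) \<Longrightarrow>
        \<bar>(\<Sum>(x, K) \<in> D. measure lborel K * f x) - I\<bar> < e'"
    using I[OF e'] by blast
  obtain N0 :: nat where N0: "(b - a) / d < real N0" using reals_Archimedean2 by blast
  have "real N0 > 0" using N0 ab d(1) by (meson diff_gt_0_iff_gt divide_pos_pos order_less_trans)
  then have N0p: "N0 > 0" by simp
  have "(\<Sum>j<N. \<bar>f (x j) - f (y j)\<bar>) \<le> e * real N"
    if N: "N \<ge> N0" and xy: "\<forall>j<N. x j \<in> {a + real j * ((b - a) / real N) .. a + real (Suc j) * ((b - a) / real N)} \<and>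
       y j \<in> {a + real j * ((b - a) / real N) .. a + real (Suc j) * ((b - a) / real N)}" for N x y
  proof -
    define h where "h = (b - a) / real N"
    define K where "K j = {a + real j * h .. a + real (Suc j) * h}" for j
    have Np: "N > 0" using N N0p by simp
    have h: "h > 0" using Np ab by (simp add: h_def)
    have hN: "a + real N * h = b" using Np by (simp add: h_def)
    have "h \<le> (b - a) / real N0" unfolding h_def using N N0p ab by (intro divide_left_mono) auto
    also have "\<dots> < d" using N0 d(1) N0p by (simp add: field_simps)
    finally have hd: "h < d" .
    have S: "\<bar>(\<Sum>j<N. h * f (t j)) - I\<bar> < e'" if t: "\<And>j. j < N \<Longrightarrow> t j \<in> K j" for t
    proof -
      have inj: "inj_on (\<lambda>j. (t j, K j)) {..<N}"
      proof (rule inj_onI)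
        fix p q assume "(t p, K p) = (t q, K q)"
        then have "K p = K q" by simp
        then have "real p * h = real q * h" unfolding K_def using h by (subst (asm) Icc_eq_Icc) (auto simp: algebra_simps)
        then show "p = q" using h by simp
      qed
      have "(\<lambda>j. (t j, K j)) ` {..<N} tagged_division_of {a..b}"
        using cells_tagged_division[OF h Np, of t a] t unfolding K_def hN by simp
      moreover have "diameter (K j) < d" for j
        using hd h by (simp add: K_def diameter_closed_interval algebra_simps)
      ultimately have "\<bar>(\<Sum>(x, K) \<in> (\<lambda>j. (t j, K j)) ` {..<N}. measure lborel K * f x) - I\<bar> < e'"
        by (intro d(2)) auto
      moreover have "(\<Sum>(x, K) \<in> (\<lambda>j. (t j, K j)) ` {..<N}. measure lborel K * f x) = (\<Sum>j<N. h * f (t j))"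
        using h by (subst sum.reindex[OF inj]) (auto simp: K_def algebra_simps intro!: sum.cong)
      ultimately show ?thesis by simp
    qed
    define u where "u j = (if f (x j) \<ge> f (y j) then x j else y j)" for j
    define v where "v j = (if f (x j) \<ge> f (y j) then y j else x j)" for j
    have "\<bar>(\<Sum>j<N. h * f (u j)) - I\<bar> < e'" "\<bar>(\<Sum>j<N. h * f (v j)) - I\<bar> < e'"
      using xy unfolding h_def[symmetric] by (auto intro!: S simp: u_def v_def K_def)
    then have "(\<Sum>j<N. h * f (u j)) - (\<Sum>j<N. h * f (v j)) \<le> 2 * e'" by linarith
    moreover have "(\<Sum>j<N. h * f (u j)) - (\<Sum>j<N. h * f (v j)) = h * (\<Sum>j<N. \<bar>f (x j) - f (y j)\<bar>)"
      unfolding sum_subtractf[symmetric] sum_distrib_left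
      by (intro sum.cong) (auto simp: u_def v_def algebra_simps)
    ultimately have "h * (\<Sum>j<N. \<bar>f (x j) - f (y j)\<bar>) \<le> h * (e * real N)"
      using Np by (simp add: e'_def h_def mult.commute)
    then show ?thesis using h by simp
  qed
  then show ?thesis using N0p by blast
qed

text \<open>Passes from one pair of points per cell to all pairs. The oscillation \<open>c j\<close>
  is finite because the other cells may be given equal points, and it is attained up to
  \<open>e / 2\<close> in each cell, which uses up the other half of \<open>e\<close>.\<close>

lemma riemann_integrable_oscillation:
  assumes f: "riemann_integrable f a b" and ab: "a < b" and e: "e > 0"
  shows "\<exists>N0>0. \<forall>N\<ge>N0. \<exists>c. (\<forall>j<N. c j \<ge> 0) \<and>
      (\<forall>j<N. \<forall>x \<in> {a + real j * ((b - a) / real N) .. a + real (Suc j) * ((b - a) / real N)}.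
         \<forall>y \<in> {a + real j * ((b - a) / real N) .. a + real (Suc j) * ((b - a) / real N)}. \<bar>f x - f y\<bar> \<le> c j) \<and>
      (\<Sum>j<N. c j) \<le> e * real N"
proof -
  obtain N0 where N0: "N0 > 0" and R: "\<And>N x y. N \<ge> N0 \<Longrightarrow>
      (\<forall>j<N. x j \<in> {a + real j * ((b - a) / real N) .. a + real (Suc j) * ((b - a) / real N)} \<and>
       y j \<in> {a + real j * ((b - a) / real N) .. a + real (Suc j) * ((b - a) / real N)}) \<Longrightarrow>
      (\<Sum>j<N. \<bar>f (x j) - f (y j)\<bar>) \<le> e / 2 * real N"
    using riemann_integrable_cells[OF f ab, of "e / 2"] e by (auto simp: half_gt_zero)
  have "\<exists>c. (\<forall>j<N. c j \<ge> 0) \<and> (\<forall>j<N. \<forall>x \<in> {a + real j * ((b - a) / real N) .. a + real (Suc j) * ((b - a) / real N)}.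
         \<forall>y \<in> {a + real j * ((b - a) / real N) .. a + real (Suc j) * ((b - a) / real N)}. \<bar>f x - f y\<bar> \<le> c j) \<and>
      (\<Sum>j<N. c j) \<le> e * real N" if N: "N \<ge> N0" for N
  proof -
    define K where "K j = {a + real j * ((b - a) / real N) .. a + real (Suc j) * ((b - a) / real N)}" for j
    define V where "V j = (\<lambda>(x,y). \<bar>f x - f y\<bar>) ` (K j \<times> K j)" for j
    have Np: "N > 0" using N N0 by simp
    have node: "a + real j * ((b - a) / real N) \<in> K j" for j
      using ab Np by (auto simp: K_def field_simps)
    have V0: "0 \<in> V j" for j using node[of j] by (force simp: V_def)
    have bdd: "bdd_above (V j)" if j: "j < N" for j
    proof (rule bdd_aboveI)
      fix v assume "v \<in> V j"
      then obtain x y where xy: "x \<in> K j" "y \<in> K j" "v = \<bar>f x - f y\<bar>" by (auto simp: V_def)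
      define n where "n i = a + real i * ((b - a) / real N)" for i
      have "\<bar>f ((n(j:=x)) j) - f ((n(j:=y)) j)\<bar> \<le> (\<Sum>i<N. \<bar>f ((n(j:=x)) i) - f ((n(j:=y)) i)\<bar>)"
        using j by (intro member_le_sum) auto
      also have "\<dots> \<le> e / 2 * real N" using node xy by (intro R[OF N]) (auto simp: n_def K_def)
      finally show "v \<le> e / 2 * real N" using xy by simp
    qed
    define c where "c j = Sup (V j)" for j
    have c0: "c j \<ge> 0" if "j < N" for j unfolding c_def using V0 bdd[OF that] by (rule cSup_upper)
    have cV: "\<bar>f x - f y\<bar> \<le> c j" if "j < N" "x \<in> K j" "y \<in> K j" for j x y
      unfolding c_def using that bdd by (intro cSup_upper) (auto simp: V_def)
    have "\<forall>j. \<exists>p. j < N \<longrightarrow> fst p \<in> K j \<and> snd p \<in> K j \<and> c j - e / 2 < \<bar>f (fst p) - f (snd p)\<bar>"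
    proof
      fix j show "\<exists>p. j < N \<longrightarrow> fst p \<in> K j \<and> snd p \<in> K j \<and> c j - e / 2 < \<bar>f (fst p) - f (snd p)\<bar>"
      proof (cases "j < N")
        case True
        have "c j - e / 2 < Sup (V j)" using e by (simp add: c_def)
        then obtain v where "v \<in> V j" "c j - e / 2 < v" using less_cSup_iff[of "V j"] V0 bdd[OF True] by blast
        then show ?thesis by (auto simp: V_def)
      qed simp
    qed
    then obtain p where p: "\<And>j. j < N \<Longrightarrow> fst (p j) \<in> K j \<and> snd (p j) \<in> K j \<and> c j - e / 2 < \<bar>f (fst (p j)) - f (snd (p j))\<bar>"
      by metis
    have "(\<Sum>j<N. c j) \<le> (\<Sum>j<N. \<bar>f (fst (p j)) - f (snd (p j))\<bar> + e / 2)"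
      using p by (intro sum_mono) force
    also have "\<dots> \<le> e / 2 * real N + e / 2 * real N"
      using R[OF N, of "\<lambda>j. fst (p j)" "\<lambda>j. snd (p j)"] p unfolding K_def sum.distrib
      by (simp add: mult.commute)
    also have "\<dots> = e * real N" by (simp add: field_simps)
    finally have "(\<Sum>j<N. c j) \<le> e * real N" .
    then show ?thesis using c0 cV unfolding K_def by blast
  qed
  then show ?thesis using N0 by blast
qed

lemma riemann_integrable_imp_bounded:
  assumes f: "riemann_integrable f a b" and ab: "a < b"
  shows "bounded (f ` {a..b})"
proof -
  obtain N where N: "N > 0" and ex: "\<exists>c. (\<forall>j<N. c j \<ge> 0) \<and> (\<forall>j<N. \<forall>x \<in> {a + real j * ((b - a) / real N) .. a + real (Suc j) * ((b - a) / real N)}.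
         \<forall>y \<in> {a + real j * ((b - a) / real N) .. a + real (Suc j) * ((b - a) / real N)}. \<bar>f x - f y\<bar> \<le> c j) \<and>
      (\<Sum>j<N. c j) \<le> 1 * real N"
    using riemann_integrable_oscillation[OF f ab, of 1] by auto
  from ex obtain c where c: "\<forall>j<N. \<forall>x \<in> {a + real j * ((b - a) / real N) .. a + real (Suc j) * ((b - a) / real N)}.
         \<forall>y \<in> {a + real j * ((b - a) / real N) .. a + real (Suc j) * ((b - a) / real N)}. \<bar>f x - f y\<bar> \<le> c j"
    by blast
  define h where "h = (b - a) / real N"
  have h: "h \<ge> 0" using ab by (simp add: h_def)
  have "bounded (f ` {a + real j * h .. a + real (Suc j) * h})" if "j < N" for j
  proof (rule boundedI)
    fix v assume "v \<in> f ` {a + real j * h .. a + real (Suc j) * h}"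
    then obtain x where x: "x \<in> {a + real j * h .. a + real (Suc j) * h}" "v = f x" by blast
    have "a + real j * h \<in> {a + real j * h .. a + real (Suc j) * h}" using h by (auto simp: algebra_simps)
    then have "\<bar>f x - f (a + real j * h)\<bar> \<le> c j" using c that x unfolding h_def by blast
    then show "norm v \<le> \<bar>f (a + real j * h)\<bar> + c j" using x by simp
  qed
  then have "bounded (\<Union>j<N. f ` {a + real j * h .. a + real (Suc j) * h})" by (intro bounded_UN) auto
  moreover have "(\<Union>j<N. f ` {a + real j * h .. a + real (Suc j) * h}) = f ` {a..b}"
    using cells_Union[OF h N, of a] N by (simp add: image_UN[symmetric] h_def)
  ultimately show ?thesis by simp
qed

lemma riemann_integrable_imp_integrable_on:
  assumes "riemann_integrable f a b"
  shows "f integrable_on {a..b}"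
proof -
  obtain I where I: "\<And>e. e > 0 \<Longrightarrow> \<exists>d>0. \<forall>D. D tagged_division_of {a..b} \<and> (\<forall>(x, K) \<in> D. diameter K < d) \<longrightarrow>
        \<bar>(\<Sum>(x, K) \<in> D. measure lborel K * f x) - I\<bar> < e"
    using assms unfolding riemann_integrable_def by blast
  have "(f has_integral I) {a..b}" unfolding has_integral_real
  proof (intro allI impI)
    fix e :: real assume "e > 0"
    from I[OF this] obtain d where d: "d > 0" "\<And>D. D tagged_division_of {a..b} \<Longrightarrow> (\<forall>(x, K) \<in> D. diameter K < d) \<Longrightarrow>
        \<bar>(\<Sum>(x, K) \<in> D. measure lborel K * f x) - I\<bar> < e" by blast
    \<comment> \<open>A ball of radius \<open>d / 3\<close> has diameter less than \<open>d\<close>,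
      so this gauge enforces the mesh condition.\<close>
    have "norm ((\<Sum>(x, K)\<in>D. Henstock_Kurzweil_Integration.content K *\<^sub>R f x) - I) < e"
      if D: "D tagged_division_of {a..b}" "(\<lambda>x. ball x (d / 3)) fine D" for D
    proof -
      have "diameter K < d" if "(x, K) \<in> D" for x K
      proof -
        have "diameter K \<le> diameter (ball x (d / 3))" using D(2) that by (intro diameter_subset) (auto simp: fine_def)
        also have "\<dots> < d" using d(1) by simp
        finally show ?thesis .
      qed
      then show ?thesis using d(2)[OF D(1)] by auto
    qed
    moreover have "gauge (\<lambda>x. ball x (d / 3))" using d(1) by (intro gauge_ball) auto
    ultimately show "\<exists>\<gamma>. gauge \<gamma> \<and> (\<forall>D. D tagged_division_of {a..b} \<and> \<gamma> fine D \<longrightarrow>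
        norm ((\<Sum>(x, K)\<in>D. Henstock_Kurzweil_Integration.content K *\<^sub>R f x) - I) < e)" by blast
  qed
  then show ?thesis by blast
qed

lemma riemann_integrable_imp_bounded_meas:
  "riemann_integrable f (-pi) pi \<Longrightarrow> bounded_meas f"
  unfolding bounded_meas_def
  by (simp add: riemann_integrable_imp_bounded riemann_integrable_imp_integrable_on integrable_imp_measurable)

text \<open>Cells of the half interval only: the grid lies there, and evenness covers the
  rest.\<close>

definition half_cell :: "nat \<Rightarrow> nat \<Rightarrow> real set" where
  "half_cell N j = {real j * (pi / real N) .. real (Suc j) * (pi / real N)}"

lemma half_cell_Union: "N > 0 \<Longrightarrow> (\<Union>j<N. half_cell N j) = {0..pi}"
  using cells_Union[of "pi / real N" N 0] by (simp add: half_cell_def)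

lemma riemann_integrable_half_oscillation:
  assumes f: "riemann_integrable f (-pi) pi" and e: "e > 0"
  shows "\<exists>N c. N > 0 \<and> (\<forall>j. 0 \<le> (c j::real)) \<and>
      (\<forall>j<N. \<forall>x\<in>half_cell N j. \<forall>y\<in>half_cell N j. \<bar>f x - f y\<bar> \<le> c j) \<and> (\<Sum>j<N. c j) \<le> e * real N"
proof -
  obtain N0 where N0: "N0 > 0" and R: "\<forall>N\<ge>N0. \<exists>c. (\<forall>j<N. c j \<ge> 0) \<and>
      (\<forall>j<N. \<forall>x \<in> {-pi + real j * ((pi - -pi) / real N) .. -pi + real (Suc j) * ((pi - -pi) / real N)}.
         \<forall>y \<in> {-pi + real j * ((pi - -pi) / real N) .. -pi + real (Suc j) * ((pi - -pi) / real N)}. \<bar>f x - f y\<bar> \<le> c j) \<and>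
      (\<Sum>j<N. c j) \<le> e / 2 * real N"
    using riemann_integrable_oscillation[OF f _, of "e / 2"] e by auto
  \<comment> \<open>An even number of cells makes 0 a division point. The right half of the cells
    may carry the whole sum, hence \<open>e / 2\<close>.\<close>
  obtain c where c: "\<forall>j<2*N0. c j \<ge> 0" and osc:
      "\<forall>j<2*N0. \<forall>x \<in> {-pi + real j * ((pi - -pi) / real (2*N0)) .. -pi + real (Suc j) * ((pi - -pi) / real (2*N0))}.
         \<forall>y \<in> {-pi + real j * ((pi - -pi) / real (2*N0)) .. -pi + real (Suc j) * ((pi - -pi) / real (2*N0))}. \<bar>f x - f y\<bar> \<le> c j"
      and s: "(\<Sum>j<2*N0. c j) \<le> e / 2 * real (2*N0)"
    using R[rule_format, of "2 * N0"] by auto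
  define c' where "c' j = (if j < N0 then c (N0 + j) else 0)" for j
  have cell: "{-pi + real (N0 + j) * ((pi - -pi) / real (2*N0)) .. -pi + real (Suc (N0 + j)) * ((pi - -pi) / real (2*N0))} = half_cell N0 j" for j
    using N0 by (simp add: half_cell_def field_simps)
  have "(\<Sum>j<N0. c' j) = (\<Sum>j\<in>(+) N0 ` {..<N0}. c j)" by (subst sum.reindex) (auto simp: c'_def)
  also have "\<dots> \<le> (\<Sum>j<2*N0. c j)" using c by (intro sum_mono2) auto
  finally have "(\<Sum>j<N0. c' j) \<le> e * real N0" using s by simp
  moreover have "\<forall>j<N0. \<forall>x\<in>half_cell N0 j. \<forall>y\<in>half_cell N0 j. \<bar>f x - f y\<bar> \<le> c' j"
  proof (intro allI impI)
    fix j assume j: "j < N0"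
    then have "N0 + j < 2 * N0" by simp
    from osc[rule_format, OF this] show "\<forall>x\<in>half_cell N0 j. \<forall>y\<in>half_cell N0 j. \<bar>f x - f y\<bar> \<le> c' j"
      unfolding cell using j by (simp add: c'_def)
  qed
  moreover have "\<forall>j. 0 \<le> c' j" using c by (auto simp: c'_def)
  ultimately show ?thesis using N0 by blast
qed

section \<open>Cosine polynomials\<close>

text \<open>Generated by sums only, so that bounds for single cosines extend by induction; closure
  under products is derived by the product-to-sum formula.\<close>

inductive cos_poly :: "(real \<Rightarrow> real) \<Rightarrow> bool" where
  cos_poly_cos: "cos_poly (\<lambda>x. a * cos (real k * x))"
| cos_poly_add: "cos_poly p \<Longrightarrow> cos_poly q \<Longrightarrow> cos_poly (\<lambda>x. p x + q x)"

lemma cos_poly_const: "cos_poly (\<lambda>_. c)"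
  using cos_poly_cos[of c 0] by simp

lemma cos_poly_mult_cos:
  assumes "cos_poly p"
  shows "cos_poly (\<lambda>x. p x * (a * cos (real k * x)))"
  using assms
proof induction
  case (cos_poly_cos b m)
  have "b * cos (real m * x) * (a * cos (real k * x)) =
     (a * b / 2) * cos (real (m + k) * x) + (a * b / 2) * cos (real (if k \<le> m then m - k else k - m) * x)" for x
  proof -
    have "cos (real (if k \<le> m then m - k else k - m) * x) = cos (real m * x - real k * x)"
    proof (cases "k \<le> m")
      case False
      then have "real (k - m) * x = - (real m * x - real k * x)" by (simp add: algebra_simps)
      then show ?thesis using False by (simp only: if_False cos_minus)
    qed (simp add: left_diff_distrib)
    then show ?thesis by (simp add: cos_add cos_diff field_simps)
  qed
  then show ?case by (simp only: cos_poly.intros)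
next
  case (cos_poly_add p q)
  then show ?case by (simp only: distrib_right cos_poly.intros)
qed

lemma cos_poly_mult:
  assumes "cos_poly p" "cos_poly q"
  shows "cos_poly (\<lambda>x. p x * q x)"
  using assms(2,1)
proof induction
  case (cos_poly_cos a k)
  then show ?case by (rule cos_poly_mult_cos)
next
  case (cos_poly_add q r)
  then show ?case by (simp only: distrib_left cos_poly.intros)
qed

lemma cos_poly_continuous: "cos_poly p \<Longrightarrow> continuous_on S p"
  by (induction rule: cos_poly.induct) (auto intro!: continuous_intros)

lemma cos_poly_even: "cos_poly p \<Longrightarrow> p (- x) = p x"
  by (induction rule: cos_poly.induct) auto

lemma cos_poly_lipschitz:
  assumes "cos_poly p"
  shows "\<exists>L\<ge>0. \<forall>x y. \<bar>p x - p y\<bar> \<le> L * \<bar>x - y\<bar>"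
  using assms
proof induction
  case (cos_poly_cos a k)
  have "\<bar>a * cos (real k * x) - a * cos (real k * y)\<bar> \<le> (\<bar>a\<bar> * real k) * \<bar>x - y\<bar>" for x y
  proof -
    have "\<bar>cos u - cos v\<bar> \<le> \<bar>u - v\<bar>" for u v :: real
    proof -
      have "\<bar>cos u - cos v\<bar> = 2 * \<bar>sin ((u + v) / 2)\<bar> * \<bar>sin ((v - u) / 2)\<bar>"
        by (simp add: cos_diff_cos abs_mult)
      also have "\<dots> \<le> 2 * 1 * \<bar>(v - u) / 2\<bar>"
        by (intro mult_mono) (auto simp: abs_sin_x_le_abs_x simp del: abs_divide)
      finally show ?thesis by (simp add: abs_minus_commute)
    qed
    from this[of "real k * x" "real k * y"]
    have "\<bar>a\<bar> * \<bar>cos (real k * x) - cos (real k * y)\<bar> \<le> \<bar>a\<bar> * \<bar>real k * x - real k * y\<bar>"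
      by (intro mult_left_mono) auto
    then show ?thesis by (simp add: abs_mult mult.assoc flip: right_diff_distrib)
  qed
  then show ?case by (intro exI[of _ "\<bar>a\<bar> * real k"]) auto
next
  case (cos_poly_add p q)
  then obtain L M where L: "L \<ge> 0" "\<And>x y. \<bar>p x - p y\<bar> \<le> L * \<bar>x - y\<bar>" and M: "M \<ge> 0" "\<And>x y. \<bar>q x - q y\<bar> \<le> M * \<bar>x - y\<bar>"
    by blast
  have "\<bar>p x + q x - (p y + q y)\<bar> \<le> (L + M) * \<bar>x - y\<bar>" for x y
    using L(2)[of x y] M(2)[of x y] unfolding distrib_right by linarith
  then show ?case using L M by (intro exI[of _ "L + M"]) auto
qed

text \<open>Stone-Weierstrass applies because the cosine separates the points of
  \<open>{0..pi}\<close>, as it does not on the full interval.\<close>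

lemma cos_poly_dense:
  assumes "continuous_on {0..pi} g" "e > 0"
  shows "\<exists>p. cos_poly p \<and> (\<forall>x\<in>{0..pi}. \<bar>g x - p x\<bar> < e)"
proof -
  interpret function_ring_on "Collect cos_poly" "{0..pi}"
  proof
    fix x y :: real assume "x \<in> {0..pi}" "y \<in> {0..pi}" "x \<noteq> y"
    then have "cos x \<noteq> cos y" by (auto dest: cos_inj_pi)
    moreover have "cos_poly cos" using cos_poly_cos[of 1 1] by simp
    ultimately show "\<exists>f\<in>Collect cos_poly. f x \<noteq> f y" by blast
  qed (simp_all add: cos_poly_const cos_poly_mult cos_poly_add cos_poly_continuous)
  show ?thesis using Stone_Weierstrass_basic[OF assms] by blast
qed

definition dst_node :: "nat \<Rightarrow> nat \<Rightarrow> real" where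
  "dst_node n i = real (Suc i) * pi / (real n + 1)"

text \<open>The squared Frobenius norm of \<open>T U - U D\<close>, with \<open>T\<close> the
  Toeplitz matrix, \<open>U\<close> the sine basis and \<open>D\<close> the diagonal matrix of the
  values of \<open>h\<close> at the nodes.\<close>

definition dst_defect :: "nat \<Rightarrow> (real \<Rightarrow> real) \<Rightarrow> real" where
  "dst_defect n h = (\<Sum>i<n. \<Sum>s<n. ((\<Sum>t<n. cosine_coeff h (int s - int t) * dst n i t) - h (dst_node n i) * dst n i s)\<^sup>2)"

lemma power2_sum_le: "((a::real) + b)\<^sup>2 \<le> 2 * a\<^sup>2 + 2 * b\<^sup>2"
  using zero_le_power2[of "a - b"] by (simp add: power2_eq_square algebra_simps)

lemma dst_defect_add:
  assumes "bounded_meas p" "bounded_meas q"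
  shows "dst_defect n (\<lambda>x. p x + q x) \<le> 2 * dst_defect n p + 2 * dst_defect n q"
proof -
  define D where "D h i s = (\<Sum>t<n. cosine_coeff h (int s - int t) * dst n i t) - h (dst_node n i) * dst n i s" for h i s
  have "D (\<lambda>x. p x + q x) i s = D p i s + D q i s" for i s
    using assms by (simp add: D_def cosine_coeff_add distrib_right sum.distrib)
  then have "dst_defect n (\<lambda>x. p x + q x) = (\<Sum>i<n. \<Sum>s<n. (D p i s + D q i s)\<^sup>2)"
    by (simp add: dst_defect_def D_def)
  also have "\<dots> \<le> (\<Sum>i<n. \<Sum>s<n. 2 * (D p i s)\<^sup>2 + 2 * (D q i s)\<^sup>2)"
    by (intro sum_mono power2_sum_le)
  also have "\<dots> = 2 * dst_defect n p + 2 * dst_defect n q"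
    by (simp add: dst_defect_def D_def sum.distrib sum_distrib_left)
  finally show ?thesis .
qed

lemma dst_defect_cmult: "dst_defect n (\<lambda>x. a * h x) = a\<^sup>2 * dst_defect n h"
proof -
  have "(\<Sum>t<n. cosine_coeff (\<lambda>x. a * h x) (int s - int t) * dst n i t) - a * h (dst_node n i) * dst n i s =
    a * ((\<Sum>t<n. cosine_coeff h (int s - int t) * dst n i t) - h (dst_node n i) * dst n i s)" for i s
    by (simp add: cosine_coeff_cmult right_diff_distrib sum_distrib_left mult.assoc)
  then show ?thesis by (simp add: dst_defect_def power_mult_distrib sum_distrib_left)
qed

text \<open>By \<open>dst_shift\<close> a column has at most \<open>2 * k\<close> nonzero residuals,
  each of square at most \<open>2 / (n + 1)\<close>; over the \<open>n\<close> columns this stays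
  bounded uniformly in \<open>n\<close>.\<close>

lemma dst_defect_cos: "dst_defect n (\<lambda>x. cos (real k * x)) \<le> 4 * real k"
proof (cases "n = 0")
  case False
  have row: "(\<Sum>t<n. cosine_coeff (\<lambda>x. cos (real k * x)) (int s - int t) * dst n i t) =
      ((if k \<le> s then dst n i (s - k) else 0) + (if s + k < n then dst n i (s + k) else 0)) / 2" if s: "s < n" for i s
  proof -
    have "cosine_coeff (\<lambda>x. cos (real k * x)) (int s - int t) * dst n i t =
      ((if k \<le> s \<and> t = s - k then dst n i t else 0) + (if t = s + k then dst n i t else 0)) / 2" for t
    proof -
      have eq: "int s - int t = int k \<longleftrightarrow> k \<le> s \<and> t = s - k" "int s - int t = - int k \<longleftrightarrow> t = s + k" by auto
      have "cosine_coeff (\<lambda>x. cos (real k * x)) (int s - int t) =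
          ((if k \<le> s \<and> t = s - k then 1 else 0) + (if t = s + k then 1 else 0)) / 2"
        using cosine_coeff_cos[of "int k" "int s - int t"] unfolding eq of_int_of_nat_eq .
      then show ?thesis by (simp only: distrib_right times_divide_eq_left mult_1 mult_zero_left if_distrib[of "\<lambda>c. c * dst n i t"])
    qed
    then have "(\<Sum>t<n. cosine_coeff (\<lambda>x. cos (real k * x)) (int s - int t) * dst n i t) =
      ((\<Sum>t<n. if k \<le> s \<and> t = s - k then dst n i t else 0) + (\<Sum>t<n. if t = s + k then dst n i t else 0)) / 2"
      by (simp only: sum_divide_distrib[symmetric] sum.distrib)
    moreover have "(\<Sum>t<n. if k \<le> s \<and> t = s - k then dst n i t else 0) = (if k \<le> s then dst n i (s - k) else 0)"
      using s by (cases "k \<le> s") simp_all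
    moreover have "(\<Sum>t<n. if t = s + k then dst n i t else 0) = (if s + k < n then dst n i (s + k) else 0)"
      by simp
    ultimately show ?thesis by (simp only:)
  qed
  have "dst_defect n (\<lambda>x. cos (real k * x)) \<le> (\<Sum>i<n. \<Sum>s<n. (if s < k \<or> n \<le> s + k then 2 / (real n + 1) else 0))"
    unfolding dst_defect_def
  proof (intro sum_mono)
    fix i s assume "i \<in> {..<n}" "s \<in> {..<n}"
    then have ins: "i < n" "s < n" by auto
    define d where "d = (\<Sum>t<n. cosine_coeff (\<lambda>x. cos (real k * x)) (int s - int t) * dst n i t) - cos (real k * dst_node n i) * dst n i s"
    have "\<bar>d\<bar> \<le> (if s < k \<or> n \<le> s + k then sqrt (2 / (real n + 1)) else 0)"
      using dst_shift[OF ins, of k] unfolding d_def row[OF ins(2)] dst_node_def .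
    then have "\<bar>d\<bar>\<^sup>2 \<le> (if s < k \<or> n \<le> s + k then sqrt (2 / (real n + 1)) else 0)\<^sup>2" by (intro power_mono) auto
    then show "d\<^sup>2 \<le> (if s < k \<or> n \<le> s + k then 2 / (real n + 1) else 0)" by (auto split: if_splits)
  qed
  also have "\<dots> = real n * (2 / (real n + 1) * real (card {s. s < n \<and> (s < k \<or> n \<le> s + k)}))"
  proof -
    have "(\<Sum>s<n. (if s < k \<or> n \<le> s + k then 2 / (real n + 1) else 0)) =
        (\<Sum>s\<in>{s. s < n \<and> (s < k \<or> n \<le> s + k)}. 2 / (real n + 1))"
      by (rule sum.mono_neutral_cong_right) auto
    then show ?thesis by simp
  qed
  also have "\<dots> \<le> real n * (2 / (real n + 1) * (2 * real k))"
  proof (intro mult_left_mono)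
    have "card {s. s < n \<and> (s < k \<or> n \<le> s + k)} \<le> card ({..<k} \<union> {n-k..<n})"
      by (intro card_mono) auto
    also have "\<dots> \<le> k + k" by (rule order_trans[OF card_Un_le]) simp
    finally show "real (card {s. s < n \<and> (s < k \<or> n \<le> s + k)}) \<le> 2 * real k" by simp
  qed auto
  also have "\<dots> \<le> 4 * real k" by (simp add: field_simps)
  finally show ?thesis .
qed (simp add: dst_defect_def)

lemma dst_defect_cos_poly_bounded:
  assumes "cos_poly p"
  shows "\<exists>C. \<forall>n. dst_defect n p \<le> C"
  using assms
proof induction
  case (cos_poly_cos a k)
  have "dst_defect n (\<lambda>x. a * cos (real k * x)) \<le> a\<^sup>2 * (4 * real k)" for n
    unfolding dst_defect_cmult by (intro mult_left_mono dst_defect_cos) auto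
  then show ?case by blast
next
  case (cos_poly_add p q)
  then obtain C D where CD: "\<And>n. dst_defect n p \<le> C" "\<And>n. dst_defect n q \<le> D" by blast
  have bm: "bounded_meas p" "bounded_meas q"
    using cos_poly_add by (auto intro: bounded_meas_continuous cos_poly_continuous)
  have "dst_defect n (\<lambda>x. p x + q x) \<le> 2 * C + 2 * D" for n
    using dst_defect_add[OF bm, of n] CD[of n] by linarith
  then show ?case by blast
qed

section \<open>Almost diagonalization in the sine basis\<close>

lemma abs_convex_combination_le:
  fixes a b :: real
  assumes "\<bar>a\<bar> \<le> K" "\<bar>b\<bar> \<le> K" "0 \<le> t" "t \<le> 1"
  shows "\<bar>(1 - t) * a + t * b\<bar> \<le> K"
proof -
  have "\<bar>(1 - t) * a + t * b\<bar> \<le> (1 - t) * \<bar>a\<bar> + t * \<bar>b\<bar>"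
    using assms by (intro order_trans[OF abs_triangle_ineq]) (simp add: abs_mult)
  also have "\<dots> \<le> (1 - t) * K + t * K" using assms by (intro add_mono mult_left_mono) auto
  finally show ?thesis by (simp add: algebra_simps)
qed

text \<open>A pointwise bound by a step function, since the same \<open>c\<close> has to control
  both the mean of the squared error and its samples on any grid. The passage from \<open>f\<close>
  to \<open>p\<close> goes through the piecewise linear interpolant \<open>g\<close>, whose distance
  to \<open>f\<close> is at most the oscillation on a cell.\<close>

lemma riemann_integrable_cos_poly_approx:
  assumes f: "riemann_integrable f (-pi) pi" and \<delta>: "\<delta> > 0"
  shows "\<exists>p N c. cos_poly p \<and> N > 0 \<and> (\<forall>j. 0 \<le> (c j :: real)) \<and>
     (\<forall>j<N. \<forall>x\<in>half_cell N j. (f x - p x)\<^sup>2 \<le> c j) \<and> (\<Sum>j<N. c j) \<le> \<delta> * real N"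
proof -
  obtain B0 where B0: "\<forall>x\<in>{-pi..pi}. \<bar>f x\<bar> \<le> B0"
    using bounded_meas_bound[OF riemann_integrable_imp_bounded_meas[OF f]] by blast
  define B where "B = max B0 1"
  have B: "B > 0" "\<And>x. x \<in> {-pi..pi} \<Longrightarrow> \<bar>f x\<bar> \<le> B" using B0 by (auto simp: B_def intro: max.coboundedI1)
  \<comment> \<open>The final bound on a cell is \<open>4 * B * c j + \<delta> / 2\<close>; with
    this constant the first terms sum up to at most half of \<open>\<delta> * N\<close>.\<close>
  have "\<delta> / (8 * B) > 0" using \<delta> B(1) by simp
  from riemann_integrable_half_oscillation[OF f this]
  obtain N c where N: "N > 0" and c0: "\<And>j. 0 \<le> c j"
    and osc: "\<And>j x y. j < N \<Longrightarrow> x \<in> half_cell N j \<Longrightarrow> y \<in> half_cell N j \<Longrightarrow> \<bar>f x - f y\<bar> \<le> c j"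
    and cs: "(\<Sum>j<N. c j) \<le> \<delta> / (8 * B) * real N"
    by blast
  define h where "h = pi / real N"
  have h: "h > 0" "real N * h = pi" using N by (auto simp: h_def)
  \<comment> \<open>A sum of hat functions; on cell \<open>j\<close> only the hats at its two
    endpoints can be nonzero.\<close>
  define g where "g x = (\<Sum>i\<le>N. f (real i * h) * max 0 (1 - \<bar>x / h - real i\<bar>))" for x
  have "continuous_on {0..pi} g" unfolding g_def
    by (intro continuous_intros) (use h in auto)
  then obtain p where p: "cos_poly p" "\<And>x. x \<in> {0..pi} \<Longrightarrow> \<bar>g x - p x\<bar> < sqrt \<delta> / 2"
    using cos_poly_dense[of g "sqrt \<delta> / 2"] \<delta> by auto
  have "(f x - p x)\<^sup>2 \<le> 4 * B * c j + \<delta> / 2" if j: "j < N" and x: "x \<in> half_cell N j" for j x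
  proof -
    define t where "t = x / h - real j"
    have xj: "real j * h \<le> x" "x \<le> real (Suc j) * h" using x by (auto simp: half_cell_def h_def)
    have t: "0 \<le> t" "t \<le> 1" using xj h(1) by (auto simp: t_def field_simps)
    have "x \<in> (\<Union>j<N. half_cell N j)" using j x by blast
    then have xpi: "x \<in> {0..pi}" using half_cell_Union[OF N] by simp
    have nodes: "real j * h \<in> half_cell N j" "real (Suc j) * h \<in> half_cell N j"
      using h(1) by (auto simp: half_cell_def h_def[symmetric] algebra_simps)
    have "half_cell N j \<subseteq> {0..pi}" using half_cell_Union[OF N] j by blast
    then have sub: "y \<in> half_cell N j \<Longrightarrow> y \<in> {-pi..pi}" for y using pi_gt_zero by fastforce
    have "g x = (\<Sum>i\<in>{j, Suc j}. f (real i * h) * max 0 (1 - \<bar>x / h - real i\<bar>))"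
      unfolding g_def
    proof (rule sum.mono_neutral_right)
      show "\<forall>i\<in>{..N} - {j, Suc j}. f (real i * h) * max 0 (1 - \<bar>x / h - real i\<bar>) = 0"
      proof
        fix i assume "i \<in> {..N} - {j, Suc j}"
        then have "i < j \<or> i > Suc j" by auto
        then have "real i + 1 \<le> real j \<or> real i \<ge> real j + 2" by linarith
        then have "\<bar>x / h - real i\<bar> \<ge> 1" using t unfolding t_def by linarith
        then show "f (real i * h) * max 0 (1 - \<bar>x / h - real i\<bar>) = 0" by simp
      qed
    qed (use j in auto)
    also have "\<dots> = (1 - t) * f (real j * h) + t * f (real (Suc j) * h)"
    proof -
      have 1: "max 0 (1 - \<bar>x / h - real j\<bar>) = 1 - t" "max 0 (1 - \<bar>x / h - real (Suc j)\<bar>) = t"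
        using t unfolding t_def by auto
      have "(\<Sum>i\<in>{j, Suc j}. f (real i * h) * max 0 (1 - \<bar>x / h - real i\<bar>)) =
          f (real j * h) * max 0 (1 - \<bar>x / h - real j\<bar>) + f (real (Suc j) * h) * max 0 (1 - \<bar>x / h - real (Suc j)\<bar>)"
        by simp
      then show ?thesis unfolding 1 by (simp only: mult.commute)
    qed
    finally have "f x - g x = (1 - t) * (f x - f (real j * h)) + t * (f x - f (real (Suc j) * h))"
      by (simp add: algebra_simps)
    \<comment> \<open>The oscillations are small only in the sum of their first powers, so one
      factor of the square is bounded by \<open>c j\<close> and the other by
      \<open>2 * B\<close>.\<close>
    then have "\<bar>f x - g x\<bar> \<le> c j" "\<bar>f x - g x\<bar> \<le> 2 * B"
      using osc[OF j x nodes(1)] osc[OF j x nodes(2)] t B(2)[OF sub[OF x]] B(2)[OF sub[OF nodes(1)]] B(2)[OF sub[OF nodes(2)]]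
      by (auto intro!: abs_convex_combination_le)
    then have "\<bar>f x - g x\<bar> * \<bar>f x - g x\<bar> \<le> 2 * B * c j" using c0[of j] by (intro mult_mono) auto
    then have 1: "(f x - g x)\<^sup>2 \<le> 2 * B * c j" by (simp add: power2_eq_square abs_mult_self_eq)
    have "\<bar>g x - p x\<bar>\<^sup>2 \<le> (sqrt \<delta> / 2)\<^sup>2" using p(2)[OF xpi] by (intro power_mono) auto
    then have 2: "(g x - p x)\<^sup>2 \<le> \<delta> / 4" using \<delta> by (simp add: power_divide)
    show ?thesis using power2_sum_le[of "f x - g x" "g x - p x"] 1 2 by simp
  qed
  moreover have "(\<Sum>j<N. 4 * B * c j + \<delta> / 2) \<le> \<delta> * real N"
  proof -
    have "4 * B * (\<Sum>j<N. c j) \<le> 4 * B * (\<delta> / (8 * B) * real N)" using cs B(1) by (intro mult_left_mono) auto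
    also have "\<dots> = \<delta> / 2 * real N" using B(1) by simp
    finally have "4 * B * (\<Sum>j<N. c j) \<le> \<delta> / 2 * real N" .
    moreover have "(\<Sum>j<N. 4 * B * c j + \<delta> / 2) = 4 * B * (\<Sum>j<N. c j) + \<delta> / 2 * real N"
      by (simp add: sum.distrib sum_distrib_left)
    ultimately show ?thesis by simp
  qed
  moreover have "\<forall>j. 0 \<le> 4 * B * c j + \<delta> / 2" using c0 B(1) \<delta> by simp
  ultimately show ?thesis using p(1) N
    by (intro exI[of _ p] exI[of _ N] exI[of _ "\<lambda>j. 4 * B * c j + \<delta> / 2"]) auto
qed

lemma circle_mean_le_cells:
  assumes h: "bounded_meas h" and even: "\<And>x. x \<in> {-pi..pi} \<Longrightarrow> h (- x) = h x"
    and N: "N > 0" and c: "\<And>j x. j < N \<Longrightarrow> x \<in> half_cell N j \<Longrightarrow> h x \<le> c j"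
    and s: "(\<Sum>j<N. c j) \<le> \<delta> * real N"
  shows "circle_mean h \<le> \<delta>"
proof -
  define w where "w = pi / real N"
  have w: "w > 0" "real N * w = pi" using N by (auto simp: w_def)
  have int: "h integrable_on {-pi..pi}" using h by (rule bounded_meas_integrable_on)
  have sub: "h integrable_on {a..b}" if "-pi \<le> a" "b \<le> pi" for a b
    using integrable_on_subinterval[OF int] that by simp
  have "integral {0..real k * w} h \<le> w * (\<Sum>j<k. c j)" if "k \<le> N" for k
    using that
  proof (induction k)
    case (Suc k)
    have kN: "real (Suc k) * w \<le> pi" using Suc.prems w by (metis mult_right_mono of_nat_le_iff less_imp_le)
    have le: "0 \<le> real k * w" "real k * w \<le> real (Suc k) * w" using w(1) by (auto simp: algebra_simps)
    have "integral {0..real (Suc k) * w} h = integral {0..real k * w} h + integral {real k * w..real (Suc k) * w} h"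
      by (rule Henstock_Kurzweil_Integration.integral_combine[symmetric]) (use le kN in \<open>auto intro!: sub\<close>)
    also have "integral {real k * w..real (Suc k) * w} h \<le> integral {real k * w..real (Suc k) * w} (\<lambda>_. c k)"
    proof (rule integral_le)
      show "h integrable_on {real k * w..real (Suc k) * w}" using le kN by (intro sub) auto
      fix x assume "x \<in> {real k * w..real (Suc k) * w}"
      then show "h x \<le> c k" using Suc.prems by (intro c) (auto simp: half_cell_def w_def)
    qed auto
    also have "\<dots> = w * c k" using w(1) by (simp add: algebra_simps)
    also have "integral {0..real k * w} h \<le> w * (\<Sum>j<k. c j)" using Suc by simp
    finally show ?case by (simp add: distrib_left)
  qed simp
  from this[of N] have 1: "integral {0..pi} h \<le> w * (\<Sum>j<N. c j)" using w by simp
  have "integral {-pi..0} h = integral {-pi..0} (\<lambda>x. h (- x))"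
    by (intro Henstock_Kurzweil_Integration.integral_cong) (simp add: even)
  also have "\<dots> = integral {0..pi} h"
    using Henstock_Kurzweil_Integration.integral_reflect_real[of pi 0 h] by simp
  finally have "integral {-pi..pi} h = 2 * integral {0..pi} h"
    using Henstock_Kurzweil_Integration.integral_combine[OF _ _ int, of 0] by simp
  also have "\<dots> \<le> 2 * (w * (\<delta> * real N))"
    using 1 s w(1) by (smt (verit) mult_left_mono)
  also have "\<dots> = 2 * pi * \<delta>" using w(2) by (simp add: mult_ac)
  finally show ?thesis by (simp add: circle_mean_def field_simps)
qed

section \<open>Counting grid points in cells\<close>

lemma asymptotically_uniform_grid_eventually:
  assumes grid: "asymptotically_uniform_grid 0 pi \<xi>" and e: "e > 0"
  shows "\<forall>\<^sub>F n in sequentially. \<forall>i\<in>{1..n}. \<bar>\<xi> n i - real i * (pi / real n)\<bar> < e"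
proof -
  have "(\<lambda>n. MAX i \<in> {1..n}. \<bar>\<xi> n i - (0 + real i * ((pi - 0) / real n))\<bar>) \<longlonglongrightarrow> 0"
    using grid unfolding asymptotically_uniform_grid_def by blast
  from order_tendstoD(2)[OF this e]
  have "\<forall>\<^sub>F n in sequentially. (MAX i \<in> {1..n}. \<bar>\<xi> n i - real i * (pi / real n)\<bar>) < e" by simp
  then show ?thesis
  proof eventually_elim
    case (elim n)
    show ?case
    proof
      fix i assume i: "i \<in> {1..n}"
      have "\<bar>\<xi> n i - real i * (pi / real n)\<bar> \<le> (MAX i \<in> {1..n}. \<bar>\<xi> n i - real i * (pi / real n)\<bar>)"
        using i by (intro Max_ge) auto
      then show "\<bar>\<xi> n i - real i * (pi / real n)\<bar> < e" using elim by linarith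
    qed
  qed
qed

lemma card_nat_real_interval_le:
  assumes "x \<le> y + 1"
  shows "finite {i::nat. x \<le> real i \<and> real i \<le> y}" "real (card {i::nat. x \<le> real i \<and> real i \<le> y}) \<le> y - x + 1"
proof -
  have sub: "int ` {i::nat. x \<le> real i \<and> real i \<le> y} \<subseteq> {\<lceil>x\<rceil>..\<lfloor>y\<rfloor>}"
    by (auto simp: ceiling_le_iff le_floor_iff)
  have "finite (int ` {i::nat. x \<le> real i \<and> real i \<le> y})" using sub finite_subset by blast
  then show "finite {i::nat. x \<le> real i \<and> real i \<le> y}" using finite_imageD inj_on_of_nat by blast
  have "card {i::nat. x \<le> real i \<and> real i \<le> y} = card (int ` {i::nat. x \<le> real i \<and> real i \<le> y})"
    by (rule card_image[symmetric]) simp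
  also have "\<dots> \<le> card {\<lceil>x\<rceil>..\<lfloor>y\<rfloor>}" using sub by (intro card_mono) auto
  also have "\<dots> = nat (\<lfloor>y\<rfloor> - \<lceil>x\<rceil> + 1)" by simp
  finally have "real (card {i::nat. x \<le> real i \<and> real i \<le> y}) \<le> real (nat (\<lfloor>y\<rfloor> - \<lceil>x\<rceil> + 1))" by simp
  also have "\<dots> \<le> y - x + 1" using assms by (cases "\<lfloor>y\<rfloor> - \<lceil>x\<rceil> + 1 \<ge> 0") (simp_all, linarith+)
  finally show "real (card {i::nat. x \<le> real i \<and> real i \<le> y}) \<le> y - x + 1" .
qed

text \<open>The grid points of a cell have their indices in an interval of length
  \<open>2 * n / N\<close>, the cell widened by half its width on each side. The additional index at
  the boundary is absorbed by \<open>N \<le> n\<close>, which gives the factor 3.\<close>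

lemma grid_sum_le_cells:
  assumes grid: "asymptotically_uniform_grid 0 pi \<xi>" and N: "N > 0"
    and c0: "\<And>j. 0 \<le> c j" and c: "\<And>j x. j < N \<Longrightarrow> x \<in> half_cell N j \<Longrightarrow> h x \<le> c j"
    and s: "(\<Sum>j<N. c j) \<le> \<delta> * real N"
  shows "\<forall>\<^sub>F n in sequentially. (\<Sum>i\<in>{1..n}. h (\<xi> n i)) \<le> 3 * \<delta> * real n"
proof -
  define w where "w = pi / real N"
  have w: "w > 0" using N by (simp add: w_def)
  have "\<forall>\<^sub>F n in sequentially. \<forall>i\<in>{1..n}. \<bar>\<xi> n i - real i * (pi / real n)\<bar> < w / 2"
    using w by (intro asymptotically_uniform_grid_eventually[OF grid]) auto
  then show ?thesis using eventually_ge_at_top[of N]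
  proof eventually_elim
    case (elim n)
    have n: "n > 0" using elim(2) N by simp
    have cnt: "real (card {i\<in>{1..n}. \<xi> n i \<in> half_cell N j}) \<le> 3 * real n / real N" for j
    proof -
      define x where "x = (real j - 1/2) * (real n / real N)"
      define y where "y = (real j + 3/2) * (real n / real N)"
      have yx: "y - x = 2 * (real n / real N)" by (simp add: x_def y_def algebra_simps)
      have xy: "x \<le> y + 1" using yx by (smt (verit) divide_nonneg_nonneg of_nat_0_le_iff)
      have "{i\<in>{1..n}. \<xi> n i \<in> half_cell N j} \<subseteq> {i. x \<le> real i \<and> real i \<le> y}"
      proof safe
        fix i assume i: "i \<in> {1..n}" "\<xi> n i \<in> half_cell N j"
        have "\<bar>\<xi> n i - real i * (pi / real n)\<bar> < w / 2" using elim(1) i(1) by blast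
        moreover have "real j * w \<le> \<xi> n i" "\<xi> n i \<le> real (Suc j) * w" using i(2) by (auto simp: half_cell_def w_def)
        ultimately have "real j * w - w / 2 \<le> real i * (pi / real n)" "real i * (pi / real n) \<le> real (Suc j) * w + w / 2"
          unfolding abs_less_iff by linarith+
        moreover have "real j * w - w / 2 = (real j - 1/2) * w" "real (Suc j) * w + w / 2 = (real j + 3/2) * w"
          by (simp_all add: algebra_simps)
        ultimately have l: "(real j - 1/2) * w \<le> real i * (pi / real n)" and u: "real i * (pi / real n) \<le> (real j + 3/2) * w"
          by simp_all
        have "real n / pi \<ge> 0" by simp
        from mult_right_mono[OF l this] mult_right_mono[OF u this]
        have "(real j - 1/2) * w * (real n / pi) \<le> real i * (pi / real n) * (real n / pi)"
            "real i * (pi / real n) * (real n / pi) \<le> (real j + 3/2) * w * (real n / pi)" .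
        moreover have "real i * (pi / real n) * (real n / pi) = real i" using n by simp
        moreover have "w * (real n / pi) = real n / real N" by (simp add: w_def)
        ultimately show "x \<le> real i" "real i \<le> y" unfolding x_def y_def by (simp_all only: mult.assoc)
      qed
      then have "card {i\<in>{1..n}. \<xi> n i \<in> half_cell N j} \<le> card {i. x \<le> real i \<and> real i \<le> y}"
        using card_nat_real_interval_le(1)[OF xy] by (intro card_mono)
      then have "real (card {i\<in>{1..n}. \<xi> n i \<in> half_cell N j}) \<le> y - x + 1"
        using card_nat_real_interval_le(2)[OF xy] by linarith
      also have "\<dots> \<le> 3 * real n / real N" using elim(2) N unfolding yx by (simp add: field_simps)
      finally show ?thesis .
    qed
    have "(\<Sum>i\<in>{1..n}. h (\<xi> n i)) \<le> (\<Sum>i\<in>{1..n}. \<Sum>j<N. if \<xi> n i \<in> half_cell N j then c j else 0)"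
    proof (rule sum_mono)
      fix i assume "i \<in> {1..n}"
      then have "\<xi> n i \<in> {0..pi}" using grid unfolding asymptotically_uniform_grid_def by blast
      then obtain j where j: "j < N" "\<xi> n i \<in> half_cell N j" using half_cell_Union[OF N] by blast
      have "h (\<xi> n i) \<le> (if \<xi> n i \<in> half_cell N j then c j else 0)" using c j by simp
      also have "\<dots> \<le> (\<Sum>j<N. if \<xi> n i \<in> half_cell N j then c j else 0)"
        using j c0 by (intro member_le_sum) auto
      finally show "h (\<xi> n i) \<le> (\<Sum>j<N. if \<xi> n i \<in> half_cell N j then c j else 0)" .
    qed
    also have "\<dots> = (\<Sum>j<N. \<Sum>i\<in>{1..n}. if \<xi> n i \<in> half_cell N j then c j else 0)" by (rule sum.swap)
    also have "\<dots> = (\<Sum>j<N. c j * real (card {i\<in>{1..n}. \<xi> n i \<in> half_cell N j}))"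
    proof (intro sum.cong refl)
      fix j
      have "(\<Sum>i\<in>{1..n}. if \<xi> n i \<in> half_cell N j then c j else 0) = (\<Sum>i\<in>{i\<in>{1..n}. \<xi> n i \<in> half_cell N j}. c j)"
        by (rule sum.mono_neutral_cong_right) auto
      then show "(\<Sum>i\<in>{1..n}. if \<xi> n i \<in> half_cell N j then c j else 0) = c j * real (card {i\<in>{1..n}. \<xi> n i \<in> half_cell N j})"
        by simp
    qed
    also have "\<dots> \<le> (\<Sum>j<N. c j * (3 * real n / real N))" using cnt c0 by (intro sum_mono mult_left_mono) auto
    also have "\<dots> = (3 * real n / real N) * (\<Sum>j<N. c j)"
      unfolding sum_distrib_left by (simp only: mult.commute)
    also have "\<dots> \<le> (3 * real n / real N) * (\<delta> * real N)" using s by (intro mult_left_mono) auto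
    also have "\<dots> = 3 * \<delta> * real n" using N by simp
    finally show ?case .
  qed
qed

section \<open>Residuals of the Toeplitz matrix in the sine basis\<close>

lemma orthogonal_sum_squares:
  fixes q :: "nat \<Rightarrow> nat \<Rightarrow> real"
  assumes q: "\<And>j k. j < n \<Longrightarrow> k < n \<Longrightarrow> (\<Sum>i<n. q i j * q i k) = (if j = k then 1 else 0)"
  shows "(\<Sum>i<n. (\<Sum>j<n. q i j * x j)\<^sup>2) = (\<Sum>j<n. (x j)\<^sup>2)"
proof -
  have "(\<Sum>i<n. (\<Sum>j<n. q i j * x j)\<^sup>2) = (\<Sum>i<n. \<Sum>j<n. \<Sum>k<n. x j * x k * (q i j * q i k))"
    by (intro sum.cong refl) (simp add: power2_eq_square sum_product mult_ac)
  also have "\<dots> = (\<Sum>j<n. \<Sum>i<n. \<Sum>k<n. x j * x k * (q i j * q i k))" by (rule sum.swap)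
  also have "\<dots> = (\<Sum>j<n. \<Sum>k<n. \<Sum>i<n. x j * x k * (q i j * q i k))" by (intro sum.cong refl sum.swap)
  also have "\<dots> = (\<Sum>j<n. \<Sum>k<n. if k = j then (x j)\<^sup>2 else 0)"
    by (intro sum.cong refl) (simp add: q sum_distrib_left[symmetric] power2_eq_square)
  finally show ?thesis by simp
qed

lemma dst_parseval: "(\<Sum>i<n. (\<Sum>t<n. x t * dst n i t)\<^sup>2) = (\<Sum>t<n. (x t)\<^sup>2)"
proof -
  have "(\<Sum>i<n. (\<Sum>t<n. dst n i t * x t)\<^sup>2) = (\<Sum>t<n. (x t)\<^sup>2)"
  proof (rule orthogonal_sum_squares)
    fix j k assume "j < n" "k < n"
    then show "(\<Sum>i<n. dst n i j * dst n i k) = (if j = k then 1 else 0)"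
      using dst_orthonormal[of j n k] by (simp only: dst_sym[of n j] dst_sym[of n k])
  qed
  then show ?thesis by (simp only: mult.commute)
qed

text \<open>As \<open>dst_defect\<close>, but with free approximate eigenvalues
  \<open>\<mu>\<close>; with the samples for \<open>\<mu>\<close> this is the transport
  cost.\<close>

definition dst_cost :: "nat \<Rightarrow> (real \<Rightarrow> real) \<Rightarrow> (nat \<Rightarrow> real) \<Rightarrow> real" where
  "dst_cost n f \<mu> = (\<Sum>i<n. \<Sum>s<n. ((\<Sum>t<n. cosine_coeff f (int s - int t) * dst n i t) - \<mu> i * dst n i s)\<^sup>2)"

lemma power2_sum3_le: "((a::real) + b + c)\<^sup>2 \<le> 3 * a\<^sup>2 + 3 * b\<^sup>2 + 3 * c\<^sup>2"
  using zero_le_power2[of "a - b"] zero_le_power2[of "a - c"] zero_le_power2[of "b - c"]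
  by (simp add: power2_eq_square algebra_simps)

text \<open>The residual splits into the Toeplitz matrix of \<open>f - p\<close> applied to a sine
  vector, the residual of \<open>p\<close>, and the change from \<open>p (dst_node n i)\<close> to
  \<open>\<mu> i\<close>. For the first part, Parseval in the sine basis leaves a Frobenius
  norm.\<close>

lemma dst_cost_le:
  assumes f: "bounded_meas f" and p: "bounded_meas p"
  shows "dst_cost n f \<mu> \<le> 3 * (real n * circle_mean (\<lambda>x. (f x - p x)\<^sup>2)) + 3 * dst_defect n p
     + 3 * (\<Sum>i<n. (p (dst_node n i) - \<mu> i)\<^sup>2)"
proof -
  define q where "q x = f x - p x" for x
  have q: "bounded_meas q" unfolding q_def by (intro bounded_meas_intros f p)
  define R where "R h i s = (\<Sum>t<n. cosine_coeff h (int s - int t) * dst n i t)" for h i s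
  have "q = (\<lambda>x. f x - p x)" by (simp add: q_def fun_eq_iff)
  then have "cosine_coeff q k = cosine_coeff f k - cosine_coeff p k" for k
    by (simp add: cosine_coeff_diff f p)
  then have "R f i s = R q i s + R p i s" for i s
    by (simp add: R_def left_diff_distrib sum_subtractf)
  then have "dst_cost n f \<mu> = (\<Sum>i<n. \<Sum>s<n. (R q i s + (R p i s - p (dst_node n i) * dst n i s)
        + (p (dst_node n i) - \<mu> i) * dst n i s)\<^sup>2)"
    unfolding dst_cost_def R_def[symmetric] by (intro sum.cong refl) (simp add: algebra_simps)
  also have "\<dots> \<le> (\<Sum>i<n. \<Sum>s<n. 3 * (R q i s)\<^sup>2 + 3 * (R p i s - p (dst_node n i) * dst n i s)\<^sup>2
        + 3 * ((p (dst_node n i) - \<mu> i) * dst n i s)\<^sup>2)"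
    by (intro sum_mono power2_sum3_le)
  also have "\<dots> = 3 * (\<Sum>i<n. \<Sum>s<n. (R q i s)\<^sup>2) + 3 * dst_defect n p
        + 3 * (\<Sum>i<n. \<Sum>s<n. ((p (dst_node n i) - \<mu> i) * dst n i s)\<^sup>2)"
    by (simp add: dst_defect_def R_def sum.distrib sum_distrib_left)
  also have "(\<Sum>i<n. \<Sum>s<n. (R q i s)\<^sup>2) = (\<Sum>s<n. \<Sum>t<n. (cosine_coeff q (int s - int t))\<^sup>2)"
    unfolding R_def by (subst sum.swap) (simp only: dst_parseval)
  also have "\<dots> \<le> real n * circle_mean (\<lambda>x. (q x)\<^sup>2)" by (rule toeplitz_frobenius_le[OF q])
  also have "(\<Sum>i<n. \<Sum>s<n. ((p (dst_node n i) - \<mu> i) * dst n i s)\<^sup>2) = (\<Sum>i<n. (p (dst_node n i) - \<mu> i)\<^sup>2)"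
  proof (intro sum.cong refl)
    fix i assume "i \<in> {..<n}"
    then have "(\<Sum>s<n. (dst n i s)\<^sup>2) = 1" using dst_orthonormal[of i n i] by (simp add: power2_eq_square)
    then show "(\<Sum>s<n. ((p (dst_node n i) - \<mu> i) * dst n i s)\<^sup>2) = (p (dst_node n i) - \<mu> i)\<^sup>2"
      by (simp add: power_mult_distrib sum_distrib_left[symmetric])
  qed
  finally show ?thesis by (simp add: q_def)
qed

lemma dst_cost_grid_small:
  assumes f: "riemann_integrable f (-pi) pi" and even: "\<forall>x\<in>{-pi..pi}. f (- x) = f x"
    and grid: "asymptotically_uniform_grid 0 pi \<xi>" and \<eta>: "\<eta> > 0"
  shows "\<forall>\<^sub>F n in sequentially. dst_cost n f (\<lambda>i. f (\<xi> n (Suc i))) \<le> \<eta> * real n"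
proof -
  \<comment> \<open>The terms of \<open>dst_cost_le\<close> amount to \<open>3 + 1 + 19 = 23\<close>
    times \<open>\<delta> * n\<close>, where 19 is \<open>3 * (1/3 + 2 * 3)\<close>.\<close>
  define \<delta> where "\<delta> = \<eta> / 24"
  have \<delta>: "\<delta> > 0" using \<eta> by (simp add: \<delta>_def)
  obtain p N c where p: "cos_poly p" and N: "N > 0" and c0: "\<And>j. 0 \<le> c j"
    and c: "\<And>j x. j < N \<Longrightarrow> x \<in> half_cell N j \<Longrightarrow> (f x - p x)\<^sup>2 \<le> c j" and cs: "(\<Sum>j<N. c j) \<le> \<delta> * real N"
    using riemann_integrable_cos_poly_approx[OF f \<delta>] by blast
  have fb: "bounded_meas f" by (rule riemann_integrable_imp_bounded_meas[OF f])
  have pb: "bounded_meas p" by (rule bounded_meas_continuous[OF cos_poly_continuous[OF p]])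
  have mean: "circle_mean (\<lambda>x. (f x - p x)\<^sup>2) \<le> \<delta>"
    by (rule circle_mean_le_cells[OF _ _ N c cs])
      (auto intro!: bounded_meas_intros fb pb simp: even cos_poly_even[OF p])
  have gs: "\<forall>\<^sub>F n in sequentially. (\<Sum>i\<in>{1..n}. (f (\<xi> n i) - p (\<xi> n i))\<^sup>2) \<le> 3 * \<delta> * real n"
    by (rule grid_sum_le_cells[OF grid N c0 c cs])
  obtain L where L: "L \<ge> 0" "\<And>x y. \<bar>p x - p y\<bar> \<le> L * \<bar>x - y\<bar>" using cos_poly_lipschitz[OF p] by blast
  obtain C where C: "\<And>n. dst_defect n p \<le> C" using dst_defect_cos_poly_bounded[OF p] by blast
  \<comment> \<open>At distance at most \<open>e\<close> the values of \<open>p\<close> differ by at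
    most \<open>sqrt (\<delta> / 6)\<close>; \<open>L + 1\<close> avoids a division by 0.\<close>
  define e where "e = sqrt (\<delta> / 6) / (L + 1)"
  have e: "e > 0" using \<delta> L(1) by (simp add: e_def)
  have "(\<lambda>n. pi / (real n + 1)) \<longlonglongrightarrow> 0"
    using tendsto_mult_right_zero[OF LIMSEQ_inverse_real_of_nat, of pi] by (simp add: divide_inverse add.commute)
  then have ev1: "\<forall>\<^sub>F n in sequentially. pi / (real n + 1) < e / 2" using e by (intro order_tendstoD(2)) auto
  have ev2: "\<forall>\<^sub>F n in sequentially. \<forall>i\<in>{1..n}. \<bar>\<xi> n i - real i * (pi / real n)\<bar> < e / 2"
    using e by (intro asymptotically_uniform_grid_eventually[OF grid]) auto
  have ev3: "\<forall>\<^sub>F n in sequentially. 3 * C / \<delta> \<le> real n"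
    using filterlim_real_sequentially by (simp add: filterlim_at_top)
  from gs ev1 ev2 ev3 show ?thesis
  proof eventually_elim
    case (elim n)
    have near: "(p (dst_node n i) - f (\<xi> n (Suc i)))\<^sup>2 \<le> 2 * (\<delta> / 6) + 2 * (f (\<xi> n (Suc i)) - p (\<xi> n (Suc i)))\<^sup>2"
      if i: "i < n" for i
    proof -
      define a where "a = real (Suc i) * (pi / real n)"
      \<comment> \<open>The grid refers to multiples of \<open>pi / n\<close>, the sine nodes to
        multiples of \<open>pi / (n + 1)\<close>; over the whole range they differ by at most
        \<open>pi / (n + 1)\<close>.\<close>
      have "a - dst_node n i = real (Suc i) / real n * (pi / (real n + 1))"
        using i by (simp add: a_def dst_node_def field_simps)
      also have "\<bar>\<dots>\<bar> \<le> 1 * (pi / (real n + 1))"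
        unfolding abs_mult using i by (intro mult_mono) auto
      finally have "\<bar>a - dst_node n i\<bar> < e / 2" using elim(2) by linarith
      moreover have "\<bar>\<xi> n (Suc i) - a\<bar> < e / 2" using elim(3)[rule_format, of "Suc i"] i unfolding a_def by simp
      ultimately have "\<bar>dst_node n i - \<xi> n (Suc i)\<bar> \<le> e" by linarith
      then have "L * \<bar>dst_node n i - \<xi> n (Suc i)\<bar> \<le> (L + 1) * e" using L(1) e by (intro mult_mono) auto
      also have "\<dots> = sqrt (\<delta> / 6)" using L(1) by (simp add: e_def)
      finally have "\<bar>p (dst_node n i) - p (\<xi> n (Suc i))\<bar> \<le> sqrt (\<delta> / 6)"
        using L(2)[of "dst_node n i" "\<xi> n (Suc i)"] by linarith
      then have "\<bar>p (dst_node n i) - p (\<xi> n (Suc i))\<bar>\<^sup>2 \<le> (sqrt (\<delta> / 6))\<^sup>2" by (intro power_mono) auto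
      then have 1: "(p (dst_node n i) - p (\<xi> n (Suc i)))\<^sup>2 \<le> \<delta> / 6" using \<delta> by simp
      show ?thesis
        using power2_sum_le[of "p (dst_node n i) - p (\<xi> n (Suc i))" "p (\<xi> n (Suc i)) - f (\<xi> n (Suc i))"] 1
        by (simp add: power2_commute)
    qed
    have "(\<Sum>i<n. (p (dst_node n i) - f (\<xi> n (Suc i)))\<^sup>2)
        \<le> (\<Sum>i<n. 2 * (\<delta> / 6) + 2 * (f (\<xi> n (Suc i)) - p (\<xi> n (Suc i)))\<^sup>2)"
      using near by (intro sum_mono) auto
    also have "\<dots> = \<delta> / 3 * real n + 2 * (\<Sum>i<n. (f (\<xi> n (Suc i)) - p (\<xi> n (Suc i)))\<^sup>2)"
      by (simp add: sum.distrib sum_distrib_left)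
    also have "(\<Sum>i<n. (f (\<xi> n (Suc i)) - p (\<xi> n (Suc i)))\<^sup>2) = (\<Sum>i\<in>{1..n}. (f (\<xi> n i) - p (\<xi> n i))\<^sup>2)"
      using sum.atLeast1_atMost_eq[of "\<lambda>i. (f (\<xi> n i) - p (\<xi> n i))\<^sup>2" n] by simp
    finally have "(\<Sum>i<n. (p (dst_node n i) - f (\<xi> n (Suc i)))\<^sup>2) \<le> \<delta> / 3 * real n + 2 * (3 * \<delta> * real n)"
      using elim(1) by linarith
    also have "\<dots> = 19 / 3 * (\<delta> * real n)" by simp
    finally have S: "(\<Sum>i<n. (p (dst_node n i) - f (\<xi> n (Suc i)))\<^sup>2) \<le> 19 / 3 * (\<delta> * real n)" .
    have "real n * circle_mean (\<lambda>x. (f x - p x)\<^sup>2) \<le> real n * \<delta>" using mean by (intro mult_left_mono) auto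
    then have "real n * circle_mean (\<lambda>x. (f x - p x)\<^sup>2) \<le> \<delta> * real n" by (simp only: mult.commute)
    moreover have "3 * C \<le> \<delta> * real n" using elim(4) \<delta> by (simp add: field_simps)
    moreover have "\<delta> * real n \<ge> 0" using \<delta> by simp
    moreover have "\<eta> * real n = 24 * (\<delta> * real n)" by (simp add: \<delta>_def)
    ultimately show ?case
      using dst_cost_le[OF fb pb, of n "\<lambda>i. f (\<xi> n (Suc i))"] C[of n] S by linarith
  qed
qed

section \<open>Density of the samples\<close>

text \<open>Turns a nonnegligible set into an interval, which receives a positive proportion of
  every grid. Without such an interval, each cell with a value within \<open>e\<close> of
  \<open>z\<close> has oscillation at least \<open>e\<close>. Such cells and their mirror images
  have arbitrarily small total length, so the values near \<open>z\<close> would be taken on a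
  negligible set only.\<close>

lemma essential_value_interval:
  assumes f: "riemann_integrable f (-pi) pi" and even: "\<forall>x\<in>{-pi..pi}. f (- x) = f x"
    and z: "z \<in> essential_range {-pi..pi} f" and e: "e > 0"
  shows "\<exists>\<alpha> \<beta>. 0 \<le> \<alpha> \<and> \<alpha> < \<beta> \<and> \<beta> \<le> pi \<and> (\<forall>x\<in>{\<alpha>..\<beta>}. \<bar>f x - z\<bar> < 2 * e)"
proof (rule ccontr)
  assume no: "\<not> ?thesis"
  define E where "E = {x \<in> {-pi..pi}. \<bar>f x - z\<bar> < e}"
  have "negligible E" unfolding negligible_outer_le
  proof (intro allI impI)
    fix \<epsilon> :: real assume \<epsilon>: "\<epsilon> > 0"
    \<comment> \<open>There are at most \<open>d * N / e\<close> bad cells, each of measure at most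
      \<open>2 * pi / N\<close> together with its mirror image: in total
      \<open>2 * pi * d / e = \<epsilon>\<close>.\<close>
    define d where "d = \<epsilon> * e / (2 * pi)"
    have d: "d > 0" using \<epsilon> e by (simp add: d_def)
    from riemann_integrable_half_oscillation[OF f d]
    obtain N c where N: "N > 0" and c0: "\<And>j. 0 \<le> (c j :: real)"
      and osc: "\<And>j x y. j < N \<Longrightarrow> x \<in> half_cell N j \<Longrightarrow> y \<in> half_cell N j \<Longrightarrow> \<bar>f x - f y\<bar> \<le> c j"
      and cs: "(\<Sum>j<N. c j) \<le> d * real N" by blast
    define w where "w = pi / real N"
    have w: "w > 0" using N by (simp add: w_def)
    define Bad where "Bad = {j. j < N \<and> e \<le> c j}"
    have fin: "finite Bad" by (simp add: Bad_def)
    have "real (card Bad) * e = (\<Sum>j\<in>Bad. e)" by simp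
    also have "\<dots> \<le> (\<Sum>j\<in>Bad. c j)" by (intro sum_mono) (simp add: Bad_def)
    also have "\<dots> \<le> (\<Sum>j<N. c j)" using c0 by (intro sum_mono2) (auto simp: Bad_def)
    finally have bad: "real (card Bad) * e \<le> d * real N" using cs by simp
    have meets: "j \<in> Bad" if j: "j < N" and x: "x \<in> half_cell N j" "\<bar>f x - z\<bar> < e" for j x
    proof (rule ccontr)
      assume "j \<notin> Bad"
      then have "c j < e" using j by (simp add: Bad_def)
      have sub: "half_cell N j \<subseteq> {0..pi}" using half_cell_Union[OF N] j by blast
      have hc: "half_cell N j = {real j * w .. real (Suc j) * w}" by (simp add: half_cell_def w_def)
      have lt: "real j * w < real (Suc j) * w" using w by simp
      then have "0 \<le> real j * w" "real (Suc j) * w \<le> pi" using sub unfolding hc by auto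
      moreover have "\<bar>f y - z\<bar> < 2 * e" if "y \<in> {real j * w .. real (Suc j) * w}" for y
        using osc[OF j, of y x] that x \<open>c j < e\<close> unfolding hc by auto
      ultimately show False using no lt by blast
    qed
    define K where "K j = half_cell N j \<union> {- (real (Suc j) * w) .. - (real j * w)}" for j
    define T where "T = (\<Union>j\<in>Bad. K j)"
    have Kl: "K j \<in> lmeasurable" for j by (auto simp: K_def half_cell_def)
    have mK: "measure lebesgue (K j) \<le> 2 * w" for j
    proof -
      have "measure lebesgue (K j) \<le> measure lebesgue (half_cell N j) + measure lebesgue {- (real (Suc j) * w) .. - (real j * w)}"
        unfolding K_def by (intro measure_Un_le) (auto simp: half_cell_def)
      also have "\<dots> = 2 * w" using w by (simp add: half_cell_def w_def[symmetric] algebra_simps)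
      finally show ?thesis .
    qed
    have "E \<subseteq> T"
    proof
      fix x assume x: "x \<in> E"
      have "\<bar>x\<bar> \<in> {0..pi}" using x by (auto simp: E_def)
      then obtain j where j: "j < N" "\<bar>x\<bar> \<in> half_cell N j" using half_cell_Union[OF N] by blast
      have "f \<bar>x\<bar> = f x" using even x by (auto simp: E_def abs_if)
      then have "j \<in> Bad" using j x by (intro meets[of j "\<bar>x\<bar>"]) (auto simp: E_def)
      moreover have "x \<in> K j" using j(2) by (auto simp: K_def half_cell_def w_def abs_if split: if_splits)
      ultimately show "x \<in> T" by (auto simp: T_def)
    qed
    moreover have "T \<in> lmeasurable" unfolding T_def using fin Kl by (intro fmeasurable.finite_UN) auto
    moreover have "measure lebesgue T \<le> \<epsilon>"
    proof -
      have "measure lebesgue T \<le> (\<Sum>j\<in>Bad. measure lebesgue (K j))"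
        unfolding T_def using fin Kl by (intro measure_UNION_le) (auto simp: fmeasurable_def)
      also have "\<dots> \<le> (\<Sum>j\<in>Bad. 2 * w)" using mK by (intro sum_mono) auto
      also have "\<dots> = 2 * w / e * (real (card Bad) * e)" using e by simp
      also have "\<dots> \<le> 2 * w / e * (d * real N)" using bad e w by (intro mult_left_mono) auto
      also have "\<dots> = \<epsilon>" using e N by (simp add: w_def d_def)
      finally show ?thesis .
    qed
    ultimately show "\<exists>T. E \<subseteq> T \<and> T \<in> lmeasurable \<and> measure lebesgue T \<le> \<epsilon>" by blast
  qed
  then show False using z e by (simp add: essential_range_def E_def)
qed

lemma card_nat_real_interval_ge:
  assumes "0 \<le> u"
  shows "v - u - 1 \<le> real (card {k::nat. u \<le> real k \<and> real k \<le> v})"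
proof (cases "u \<le> v")
  case True
  have "{nat \<lceil>u\<rceil>..nat \<lfloor>v\<rfloor>} \<subseteq> {k::nat. u \<le> real k \<and> real k \<le> v}"
    using assms True by (auto simp: nat_le_iff le_nat_iff ceiling_le_iff le_floor_iff)
  moreover have "finite {k::nat. u \<le> real k \<and> real k \<le> v}" using True by (intro card_nat_real_interval_le) auto
  ultimately have "card {nat \<lceil>u\<rceil>..nat \<lfloor>v\<rfloor>} \<le> card {k::nat. u \<le> real k \<and> real k \<le> v}" by (rule card_mono[rotated])
  then have "Suc (nat \<lfloor>v\<rfloor>) - nat \<lceil>u\<rceil> \<le> card {k::nat. u \<le> real k \<and> real k \<le> v}" by simp
  then have "int (nat \<lfloor>v\<rfloor>) + 1 - int (nat \<lceil>u\<rceil>) \<le> int (card {k::nat. u \<le> real k \<and> real k \<le> v})" by linarith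
  moreover have "int (nat \<lfloor>v\<rfloor>) = \<lfloor>v\<rfloor>" "int (nat \<lceil>u\<rceil>) = \<lceil>u\<rceil>" using assms True by auto
  ultimately have "\<lfloor>v\<rfloor> + 1 - \<lceil>u\<rceil> \<le> int (card {k::nat. u \<le> real k \<and> real k \<le> v})" by simp
  then show ?thesis by linarith
next
  case False
  then have "v - u - 1 < 0" by simp
  then show ?thesis by (meson less_imp_le of_nat_0_le_iff order_trans)
qed

text \<open>After a margin \<open>d\<close> at both ends, which absorbs the deviation of the grid,
  at least \<open>d * n / pi - 1\<close> indices of one parity remain; this is at least half of
  \<open>d * n / pi\<close> once the latter is 2 or more.\<close>

lemma grid_parity_count:
  assumes grid: "asymptotically_uniform_grid 0 pi \<xi>" and \<alpha>\<beta>: "0 \<le> \<alpha>" "\<alpha> < \<beta>" "\<beta> \<le> pi"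
  shows "\<exists>c>0. \<forall>\<^sub>F n in sequentially. c * real n \<le> real (card {i. i < n \<and> (even i \<longleftrightarrow> b) \<and> \<xi> n (Suc i) \<in> {\<alpha>..\<beta>}})"
proof -
  define d where "d = (\<beta> - \<alpha>) / 4"
  have d: "d > 0" using \<alpha>\<beta> by (simp add: d_def)
  define r :: nat where "r = (if b then 0 else 1)"
  have ev1: "\<forall>\<^sub>F n in sequentially. \<forall>i\<in>{1..n}. \<bar>\<xi> n i - real i * (pi / real n)\<bar> < d"
    by (rule asymptotically_uniform_grid_eventually[OF grid d])
  have ev2: "\<forall>\<^sub>F n in sequentially. 2 * pi / d \<le> real n"
    using filterlim_real_sequentially by (simp add: filterlim_at_top)
  have "\<forall>\<^sub>F n in sequentially. d / (2 * pi) * real n \<le> real (card {i. i < n \<and> (even i \<longleftrightarrow> b) \<and> \<xi> n (Suc i) \<in> {\<alpha>..\<beta>}})"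
    using ev1 ev2
  proof eventually_elim
    case (elim n)
    define q where "q = d * real n / pi"
    have nd: "q \<ge> 2" using elim(2) d by (simp add: q_def field_simps)
    then have n: "n > 0" by (cases n) (auto simp: q_def)
    define X where "X = (\<alpha> + d) * (real n / pi)"
    define Y where "Y = (\<beta> - d) * (real n / pi)"
    define u where "u = (X - 1 - real r) / 2"
    define v where "v = (Y - 1 - real r) / 2"
    have "Y - X = ((\<beta> - d) - (\<alpha> + d)) * (real n / pi)" unfolding X_def Y_def by (rule left_diff_distrib[symmetric])
    also have "(\<beta> - d) - (\<alpha> + d) = 2 * d" unfolding d_def by argo
    finally have "Y - X = 2 * q" by (simp add: q_def)
    then have vu: "v - u = q" unfolding u_def v_def diff_divide_distrib[symmetric] by simp
    have "X = \<alpha> * (real n / pi) + q" by (simp add: X_def q_def distrib_right add_divide_distrib)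
    moreover have "0 \<le> \<alpha> * (real n / pi)" using \<alpha>\<beta>(1) by simp
    ultimately have "X \<ge> q" by linarith
    moreover have "real r \<le> 1" by (simp add: r_def)
    ultimately have u: "u \<ge> 0" using nd unfolding u_def by simp
    have "(\<lambda>k. 2 * k + r) ` {k::nat. u \<le> real k \<and> real k \<le> v}
        \<subseteq> {i. i < n \<and> (even i \<longleftrightarrow> b) \<and> \<xi> n (Suc i) \<in> {\<alpha>..\<beta>}}"
    proof
      fix i assume "i \<in> (\<lambda>k. 2 * k + r) ` {k::nat. u \<le> real k \<and> real k \<le> v}"
      then obtain k where k: "u \<le> real k" "real k \<le> v" "i = 2 * k + r" by blast
      have si: "real (Suc i) = 2 * real k + real r + 1" using k(3) by simp
      have l: "X \<le> real (Suc i)" and r: "real (Suc i) \<le> Y"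
        using k(1,2) unfolding u_def v_def si by (simp_all add: divide_le_eq le_divide_eq)
      have pos: "pi / real n \<ge> 0" by simp
      have inv: "c * (real n / pi) * (pi / real n) = c" for c :: real using n by simp
      have ab: "\<alpha> + d \<le> real (Suc i) * (pi / real n)" "real (Suc i) * (pi / real n) \<le> \<beta> - d"
        using mult_right_mono[OF l pos] mult_right_mono[OF r pos] unfolding X_def Y_def inv .
      have "real n * (pi / real n) = pi" using n by simp
      then have "real (Suc i) * (pi / real n) < real n * (pi / real n)" using ab(2) d \<alpha>\<beta>(3) by linarith
      then have "real (Suc i) < real n" by (rule mult_right_less_imp_less) simp
      then have i: "i < n" by simp
      then have "\<bar>\<xi> n (Suc i) - real (Suc i) * (pi / real n)\<bar> < d" using elim(1)[rule_format, of "Suc i"] by simp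
      then have "\<xi> n (Suc i) \<in> {\<alpha>..\<beta>}" using ab by auto
      moreover have "even i \<longleftrightarrow> b" by (simp add: k(3) r_def)
      ultimately show "i \<in> {i. i < n \<and> (even i \<longleftrightarrow> b) \<and> \<xi> n (Suc i) \<in> {\<alpha>..\<beta>}}" using i by simp
    qed
    then have "card ((\<lambda>k. 2 * k + r) ` {k::nat. u \<le> real k \<and> real k \<le> v})
        \<le> card {i. i < n \<and> (even i \<longleftrightarrow> b) \<and> \<xi> n (Suc i) \<in> {\<alpha>..\<beta>}}" by (intro card_mono) auto
    moreover have "card ((\<lambda>k. 2 * k + r) ` {k::nat. u \<le> real k \<and> real k \<le> v}) = card {k::nat. u \<le> real k \<and> real k \<le> v}"
      by (rule card_image) (auto simp: inj_on_def)
    moreover have "v - u - 1 \<le> real (card {k::nat. u \<le> real k \<and> real k \<le> v})" by (rule card_nat_real_interval_ge[OF u])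
    ultimately have "q - 1 \<le> real (card {i. i < n \<and> (even i \<longleftrightarrow> b) \<and> \<xi> n (Suc i) \<in> {\<alpha>..\<beta>}})"
      unfolding vu by linarith
    moreover have "d / (2 * pi) * real n = q / 2" by (simp add: q_def)
    ultimately show ?case using nd by simp
  qed
  moreover have "d / (2 * pi) > 0" using d by simp
  ultimately show ?thesis by blast
qed

text \<open>The constant has to be uniform in \<open>y\<close>, which is later taken from the
  samples of the \<open>n\<close>-th grid. A finite net of step \<open>e / 4\<close> in the open
  range suffices, as every window of length \<open>e\<close> contains the
  \<open>h\<close>-neighborhood of a net point.\<close>

lemma grid_values_dense:
  assumes f: "riemann_integrable f (-pi) pi" and even: "\<forall>x\<in>{-pi..pi}. f (- x) = f x"
    and grid: "asymptotically_uniform_grid 0 pi \<xi>" and e: "e > 0"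
    and ess: "\<And>z. m < z \<Longrightarrow> z < M \<Longrightarrow> z \<in> essential_range {-pi..pi} f"
  shows "\<exists>c>0. \<forall>\<^sub>F n in sequentially. \<forall>y. m \<le> y \<longrightarrow> y + e \<le> M \<longrightarrow>
     c * real n \<le> real (card {i. i < n \<and> (even i \<longleftrightarrow> b) \<and> y < f (\<xi> n (Suc i)) \<and> f (\<xi> n (Suc i)) < y + e})"
proof -
  define h where "h = e / 4"
  have h: "h > 0" using e by (simp add: h_def)
  define Z where "Z = {z \<in> (\<lambda>l. m + real l * h) ` {..nat \<lceil>(M - m) / h\<rceil>}. m < z \<and> z < M}"
  have finZ: "finite Z" by (simp add: Z_def)
  have "\<forall>z\<in>Z. \<exists>c>0. \<forall>\<^sub>F n in sequentially. c * real n \<le> real (card {i. i < n \<and> (even i \<longleftrightarrow> b) \<and> \<bar>f (\<xi> n (Suc i)) - z\<bar> < h})"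
  proof
    fix z assume z: "z \<in> Z"
    have "z \<in> essential_range {-pi..pi} f" using z ess by (auto simp: Z_def)
    from essential_value_interval[OF f even this, of "h / 2"] h
    have "\<exists>\<alpha> \<beta>. 0 \<le> \<alpha> \<and> \<alpha> < \<beta> \<and> \<beta> \<le> pi \<and> (\<forall>x\<in>{\<alpha>..\<beta>}. \<bar>f x - z\<bar> < h)" by simp
    then obtain \<alpha> \<beta> where \<alpha>\<beta>: "0 \<le> \<alpha>" "\<alpha> < \<beta>" "\<beta> \<le> pi" "\<And>x. x \<in> {\<alpha>..\<beta>} \<Longrightarrow> \<bar>f x - z\<bar> < h" by blast
    obtain c where c: "c > 0" "\<forall>\<^sub>F n in sequentially. c * real n \<le> real (card {i. i < n \<and> (even i \<longleftrightarrow> b) \<and> \<xi> n (Suc i) \<in> {\<alpha>..\<beta>}})"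
      using grid_parity_count[OF grid \<alpha>\<beta>(1-3), of b] by blast
    from c(2) have "\<forall>\<^sub>F n in sequentially. c * real n \<le> real (card {i. i < n \<and> (even i \<longleftrightarrow> b) \<and> \<bar>f (\<xi> n (Suc i)) - z\<bar> < h})"
    proof eventually_elim
      case (elim n)
      have "card {i. i < n \<and> (even i \<longleftrightarrow> b) \<and> \<xi> n (Suc i) \<in> {\<alpha>..\<beta>}} \<le> card {i. i < n \<and> (even i \<longleftrightarrow> b) \<and> \<bar>f (\<xi> n (Suc i)) - z\<bar> < h}"
        using \<alpha>\<beta>(4) by (intro card_mono) auto
      then show ?case using elim by linarith
    qed
    then show "\<exists>c>0. \<forall>\<^sub>F n in sequentially. c * real n \<le> real (card {i. i < n \<and> (even i \<longleftrightarrow> b) \<and> \<bar>f (\<xi> n (Suc i)) - z\<bar> < h})"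
      using c(1) by blast
  qed
  from bchoice[OF this] obtain c where c: "\<And>z. z \<in> Z \<Longrightarrow> c z > 0"
    "\<And>z. z \<in> Z \<Longrightarrow> \<forall>\<^sub>F n in sequentially. c z * real n \<le> real (card {i. i < n \<and> (even i \<longleftrightarrow> b) \<and> \<bar>f (\<xi> n (Suc i)) - z\<bar> < h})"
    by blast
  \<comment> \<open>The 1 keeps the minimum defined when the net is empty.\<close>
  define c0 where "c0 = Min (insert 1 (c ` Z))"
  have c0: "c0 > 0" using c(1) finZ by (simp add: c0_def)
  have c0le: "c0 \<le> c z" if "z \<in> Z" for z unfolding c0_def using finZ that by (intro Min_le) auto
  have "\<forall>\<^sub>F n in sequentially. \<forall>z\<in>Z. c z * real n \<le> real (card {i. i < n \<and> (even i \<longleftrightarrow> b) \<and> \<bar>f (\<xi> n (Suc i)) - z\<bar> < h})"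
    using finZ c(2) by (intro eventually_ball_finite) auto
  then have "\<forall>\<^sub>F n in sequentially. \<forall>y. m \<le> y \<longrightarrow> y + e \<le> M \<longrightarrow>
     c0 * real n \<le> real (card {i. i < n \<and> (even i \<longleftrightarrow> b) \<and> y < f (\<xi> n (Suc i)) \<and> f (\<xi> n (Suc i)) < y + e})"
  proof eventually_elim
    case (elim n)
    show ?case
    proof (intro allI impI)
      fix y assume y: "m \<le> y" "y + e \<le> M"
      \<comment> \<open>The resulting \<open>z\<close> lies above \<open>y + h\<close> and not above
        \<open>y + 2 * h\<close>, so its \<open>h\<close>-neighborhood stays between
        \<open>y\<close> and \<open>y + 3 * h\<close>.\<close>
      define l where "l = nat \<lfloor>(y + 2 * h - m) / h\<rfloor>"
      define z where "z = m + real l * h"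
      have "(y + 2 * h - m) / h \<ge> 0" using y h by simp
      then have l: "real l \<le> (y + 2 * h - m) / h" "(y + 2 * h - m) / h < real l + 1" unfolding l_def by linarith+
      have zl: "z \<le> y + 2 * h" using l(1) h by (simp add: z_def field_simps)
      have zg: "y + h < z" using l(2) h by (simp add: z_def field_simps)
      have e4: "e = 4 * h" by (simp add: h_def)
      have "(y + 2 * h - m) / h \<le> (M - m) / h" using y h unfolding e4 by (intro divide_right_mono) auto
      then have "real l \<le> (M - m) / h" using l(1) by linarith
      then have "l \<le> nat \<lceil>(M - m) / h\<rceil>" by linarith
      moreover have "m < z" "z < M" using zl zg y h unfolding e4 by linarith+
      ultimately have zZ: "z \<in> Z" by (auto simp: Z_def z_def)
      have "c0 * real n \<le> c z * real n" using c0le[OF zZ] by (intro mult_right_mono) auto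
      also have "\<dots> \<le> real (card {i. i < n \<and> (even i \<longleftrightarrow> b) \<and> \<bar>f (\<xi> n (Suc i)) - z\<bar> < h})" using elim zZ by blast
      also have "card {i. i < n \<and> (even i \<longleftrightarrow> b) \<and> \<bar>f (\<xi> n (Suc i)) - z\<bar> < h} \<le>
          card {i. i < n \<and> (even i \<longleftrightarrow> b) \<and> y < f (\<xi> n (Suc i)) \<and> f (\<xi> n (Suc i)) < y + e}"
      proof (intro card_mono Collect_mono)
        fix i
        have "y < v \<and> v < y + e" if "\<bar>v - z\<bar> < h" for v
          using that zl zg h unfolding e4 by linarith
        then show "i < n \<and> (even i \<longleftrightarrow> b) \<and> \<bar>f (\<xi> n (Suc i)) - z\<bar> < h \<longrightarrow>
            i < n \<and> (even i \<longleftrightarrow> b) \<and> y < f (\<xi> n (Suc i)) \<and> f (\<xi> n (Suc i)) < y + e" by blast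
      qed simp
      finally show "c0 * real n \<le> real (card {i. i < n \<and> (even i \<longleftrightarrow> b) \<and> y < f (\<xi> n (Suc i)) \<and> f (\<xi> n (Suc i)) < y + e})"
        by simp
    qed
  qed
  then show ?thesis using c0 by blast
qed

section \<open>Parity of the eigenvectors\<close>

lemma char_poly_of_real_diagonalized:
  fixes A V V' :: "real mat"
  assumes A: "A \<in> carrier_mat n n" and V: "V \<in> carrier_mat n n" and V': "V' \<in> carrier_mat n n"
    and inv: "V' * V = 1\<^sub>m n" and AV: "A * V = V * mat_diag n d"
  shows "char_poly (map_mat complex_of_real A) = (\<Prod>j<n. [:- complex_of_real (d j), 1:])"
proof -
  let ?c = "map_mat complex_of_real"
  have inv': "V * V' = 1\<^sub>m n" by (rule mat_mult_left_right_inverse[OF V' V inv])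
  have "A = A * (V * V')" using A inv' by simp
  also have "\<dots> = A * V * V'" using A V V' by (simp add: assoc_mult_mat[of _ n n _ n _ n])
  finally have A_eq: "A = V * mat_diag n d * V'" unfolding AV .
  have D: "?c (mat_diag n d) = mat_diag n (\<lambda>j. complex_of_real (d j))"
    by (rule eq_matI) (auto simp: mat_diag_def)
  have "similar_mat_wit (?c A) (mat_diag n (\<lambda>j. complex_of_real (d j))) (?c V) (?c V')"
  proof (rule similar_mat_witI)
    show "?c V * ?c V' = 1\<^sub>m n" "?c V' * ?c V = 1\<^sub>m n"
      unfolding of_real_hom.mat_hom_mult[OF V V', symmetric] of_real_hom.mat_hom_mult[OF V' V, symmetric] inv inv'
      by (rule of_real_hom.mat_hom_one)+
    have "?c A = ?c (V * mat_diag n d) * ?c V'"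
      unfolding A_eq using V V' by (intro of_real_hom.mat_hom_mult[of _ n n _ n]) auto
    also have "?c (V * mat_diag n d) = ?c V * ?c (mat_diag n d)"
      using V by (intro of_real_hom.mat_hom_mult[of _ n n _ n]) auto
    finally show "?c A = ?c V * mat_diag n (\<lambda>j. complex_of_real (d j)) * ?c V'" unfolding D .
  qed (use A V V' in auto)
  then have "char_poly (?c A) = char_poly (mat_diag n (\<lambda>j. complex_of_real (d j)))"
    by (intro char_poly_similar) (auto simp: similar_mat_def)
  also have "\<dots> = (\<Prod>a\<leftarrow>diag_mat (mat_diag n (\<lambda>j. complex_of_real (d j))). [:- a, 1:])"
    by (rule char_poly_upper_triangular[of _ n]) (auto simp: mat_diag_def)
  also have "diag_mat (mat_diag n (\<lambda>j. complex_of_real (d j))) = map (\<lambda>j. complex_of_real (d j)) [0..<n]"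
    by (auto simp: diag_mat_def mat_diag_def)
  also have "(\<Prod>a\<leftarrow>map (\<lambda>j. complex_of_real (d j)) [0..<n]. [:- a, 1:]) = (\<Prod>j<n. [:- complex_of_real (d j), 1:])"
    by (simp add: prod.distinct_set_conv_list[symmetric] atLeast0LessThan comp_def)
  finally show ?thesis .
qed

text \<open>Real counterparts of the matrices: the spectral decomposition and the parity argument
  stay over the reals, and only the characteristic polynomials are transferred to the complex
  matrices.\<close>

definition real_toeplitz :: "nat \<Rightarrow> (real \<Rightarrow> real) \<Rightarrow> real mat" where
  "real_toeplitz n f = Matrix.mat n n (\<lambda>(s, t). cosine_coeff f (int s - int t))"

definition real_flip :: "nat \<Rightarrow> real mat" where
  "real_flip n = Matrix.mat n n (\<lambda>(i, j). if i + j + 1 = n then 1 else 0)"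

definition dst_mat :: "nat \<Rightarrow> real mat" where
  "dst_mat n = Matrix.mat n n (\<lambda>(i, s). dst n i s)"

definition sign_mat :: "nat \<Rightarrow> real mat" where
  "sign_mat n = mat_diag n (\<lambda>i. (-1) ^ i)"

lemma carrier_mats [simp]: "real_toeplitz n f \<in> carrier_mat n n" "real_flip n \<in> carrier_mat n n"
  "dst_mat n \<in> carrier_mat n n" "sign_mat n \<in> carrier_mat n n"
  by (simp_all add: real_toeplitz_def real_flip_def dst_mat_def sign_mat_def)

lemma real_flip_mult:
  assumes "B \<in> carrier_mat n n" "i < n" "j < n"
  shows "(real_flip n * B) $$ (i, j) = B $$ (n - 1 - i, j)"
proof -
  have "(real_flip n * B) $$ (i, j) = (\<Sum>k<n. (if i + k + 1 = n then 1 else 0) * B $$ (k, j))"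
    using assms by (simp add: real_flip_def scalar_prod_def atLeast0LessThan)
  also have "\<dots> = (\<Sum>k<n. if k = n - 1 - i then B $$ (n - 1 - i, j) else 0)"
    using assms(2) by (intro sum.cong refl) auto
  finally have "(real_flip n * B) $$ (i, j) = (\<Sum>k<n. if k = n - 1 - i then B $$ (n - 1 - i, j) else 0)" .
  then show ?thesis using assms by simp
qed

lemma mult_real_flip:
  assumes "B \<in> carrier_mat n n" "i < n" "j < n"
  shows "(B * real_flip n) $$ (i, j) = B $$ (i, n - 1 - j)"
proof -
  have "(B * real_flip n) $$ (i, j) = (\<Sum>k<n. B $$ (i, k) * (if k + j + 1 = n then 1 else 0))"
    using assms by (simp add: real_flip_def scalar_prod_def atLeast0LessThan)
  also have "\<dots> = (\<Sum>k<n. if k = n - 1 - j then B $$ (i, n - 1 - j) else 0)"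
    using assms(3) by (intro sum.cong refl) auto
  finally have "(B * real_flip n) $$ (i, j) = (\<Sum>k<n. if k = n - 1 - j then B $$ (i, n - 1 - j) else 0)" .
  then show ?thesis using assms by simp
qed

lemma dst_mat_involution: "dst_mat n * dst_mat n = 1\<^sub>m n"
proof (rule eq_matI)
  fix i j assume "i < dim_row (1\<^sub>m n)" "j < dim_col (1\<^sub>m n)"
  then have ij: "i < n" "j < n" by auto
  have "(dst_mat n * dst_mat n) $$ (i, j) = (\<Sum>s<n. dst n i s * dst n s j)"
    using ij by (simp add: dst_mat_def scalar_prod_def atLeast0LessThan)
  also have "\<dots> = (\<Sum>s<n. dst n i s * dst n j s)" by (simp only: dst_sym[of n j])
  finally show "(dst_mat n * dst_mat n) $$ (i, j) = 1\<^sub>m n $$ (i, j)" using ij dst_orthonormal by simp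
qed (auto simp: dst_mat_def)

lemma dst_mat_transpose: "(dst_mat n)\<^sup>T = dst_mat n"
  by (rule eq_matI) (auto simp: dst_mat_def dst_sym)

lemma flip_dst_mat: "real_flip n * dst_mat n = dst_mat n * sign_mat n"
proof (rule eq_matI)
  fix s i assume "s < dim_row (dst_mat n * sign_mat n)" "i < dim_col (dst_mat n * sign_mat n)"
  then have si: "s < n" "i < n" by (auto simp: dst_mat_def sign_mat_def mat_diag_def)
  have "(real_flip n * dst_mat n) $$ (s, i) = dst n i (n - 1 - s)"
    using si by (subst real_flip_mult) (auto simp: dst_mat_def dst_sym)
  also have "\<dots> = dst n s i * (-1) ^ i" using dst_flip[OF si(1)] by (simp add: dst_sym)
  also have "\<dots> = (dst_mat n * sign_mat n) $$ (s, i)"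
    unfolding sign_mat_def using si by (subst mat_diag_mult_right[of _ n]) (auto simp: dst_mat_def)
  finally show "(real_flip n * dst_mat n) $$ (s, i) = (dst_mat n * sign_mat n) $$ (s, i)" .
qed (auto simp: real_flip_def dst_mat_def sign_mat_def mat_diag_def)

text \<open>The two products have coefficient indices of opposite sign at each position, and
  \<open>cosine_coeff f\<close> is even in its index.\<close>

lemma flip_toeplitz_commute: "real_flip n * real_toeplitz n f = real_toeplitz n f * real_flip n"
proof (rule eq_matI)
  fix s t assume "s < dim_row (real_toeplitz n f * real_flip n)" "t < dim_col (real_toeplitz n f * real_flip n)"
  then have st: "s < n" "t < n" by (auto simp: real_toeplitz_def real_flip_def)
  have "int (n - 1 - s) - int t = - (int s - int (n - 1 - t))" using st by auto
  then have "cosine_coeff f (int (n - 1 - s) - int t) = cosine_coeff f (int s - int (n - 1 - t))"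
    by (metis cosine_coeff_minus)
  then show "(real_flip n * real_toeplitz n f) $$ (s, t) = (real_toeplitz n f * real_flip n) $$ (s, t)"
    using st by (subst real_flip_mult, simp_all, subst mult_real_flip) (simp_all add: real_toeplitz_def)
qed (auto simp: real_flip_def real_toeplitz_def)

lemma square_mult_carrier [simp]:
  "X \<in> carrier_mat n n \<Longrightarrow> Y \<in> carrier_mat n n \<Longrightarrow> X * Y \<in> carrier_mat n n"
  by (rule mult_carrier_mat)

text \<open>The Toeplitz matrix in the sine basis. Since \<open>dst_mat n\<close> is symmetric and
  its own inverse, it stands on both sides.\<close>

definition dst_conj :: "nat \<Rightarrow> (real \<Rightarrow> real) \<Rightarrow> real mat" where
  "dst_conj n f = dst_mat n * real_toeplitz n f * dst_mat n"

lemma dst_conj_carrier [simp]: "dst_conj n f \<in> carrier_mat n n"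
  unfolding dst_conj_def by (intro mult_carrier_mat[of _ n n]) simp_all

lemma dst_conj_sym:
  assumes "i < n" "k < n"
  shows "dst_conj n f $$ (i, k) = dst_conj n f $$ (k, i)"
proof -
  let ?U = "dst_mat n" and ?C = "real_toeplitz n f"
  have CT: "?C\<^sup>T = ?C"
  proof (rule eq_matI)
    fix s t assume "s < dim_row ?C" "t < dim_col ?C"
    then show "?C\<^sup>T $$ (s, t) = ?C $$ (s, t)"
      using cosine_coeff_minus[of f "int s - int t"] by (simp add: real_toeplitz_def)
  qed (simp_all add: real_toeplitz_def)
  have "(?U * ?C * ?U)\<^sup>T = ?U\<^sup>T * (?U * ?C)\<^sup>T" by (rule transpose_mult[of _ n n _ n]) simp_all
  also have "(?U * ?C)\<^sup>T = ?C\<^sup>T * ?U\<^sup>T" by (rule transpose_mult[of _ n n _ n]) simp_all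
  finally have "(dst_conj n f)\<^sup>T = dst_conj n f"
    unfolding dst_conj_def CT dst_mat_transpose by (simp add: assoc_mult_mat[of _ n n _ n _ n])
  then show ?thesis using assms by (metis carrier_matD dst_conj_carrier index_transpose_mat(1))
qed

text \<open>In the sine basis the flip becomes \<open>sign_mat n\<close>, so
  \<open>dst_conj n f\<close> commutes with it. Comparing the entries at \<open>(i, k)\<close>
  equates \<open>(-1) ^ i\<close> and \<open>(-1) ^ k\<close> times the same number.\<close>

lemma dst_conj_parity:
  assumes ik: "i < n" "k < n" and p: "even i \<noteq> even k"
  shows "dst_conj n f $$ (i, k) = 0"
proof -
  let ?U = "dst_mat n" and ?C = "real_toeplitz n f" and ?S = "sign_mat n" and ?F = "real_flip n"
  note assoc = assoc_mult_mat[of _ n n _ n _ n]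
  have "?U * (?U * ?S) = ?U * ?U * ?S" by (rule assoc[symmetric]) simp_all
  then have S: "?S = ?U * (?F * ?U)" unfolding flip_dst_mat by (simp only: dst_mat_involution left_mult_one_mat[of _ n n] carrier_mats)
  have "?S * dst_conj n f = ?U * ?F * (?U * ?U) * ?C * ?U"
    unfolding dst_conj_def by (subst S) (simp add: assoc)
  also have "\<dots> = ?U * (?F * ?C) * ?U" unfolding dst_mat_involution by (simp add: assoc right_mult_one_mat[of _ n n])
  also have "\<dots> = ?U * (?C * ?F) * ?U" unfolding flip_toeplitz_commute ..
  also have "\<dots> = ?U * ?C * (?F * ?U)" by (simp add: assoc)
  also have "\<dots> = dst_conj n f * ?S" unfolding flip_dst_mat dst_conj_def by (simp add: assoc)
  finally have "(?S * dst_conj n f) $$ (i, k) = (dst_conj n f * ?S) $$ (i, k)" by simp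
  then have "(-1) ^ i * dst_conj n f $$ (i, k) = dst_conj n f $$ (i, k) * (-1) ^ k"
    unfolding sign_mat_def mat_diag_mult_left[OF dst_conj_carrier] mat_diag_mult_right[OF dst_conj_carrier]
    using ik by simp
  then show ?thesis using p by (auto simp: minus_one_power_iff split: if_splits)
qed

text \<open>By \<open>dst_conj_parity\<close> the matrix splits into an even and an odd block.
  Diagonalizing each block over its own index set makes the parity of \<open>j\<close> the parity of
  the \<open>j\<close>-th eigenvector.\<close>

lemma dst_conj_spectral:
  "\<exists>w l. (\<forall>i<n. \<forall>k<n. (\<Sum>j<n. w i j * w k j) = (if i = k then 1 else 0)) \<and>
    (\<forall>i<n. \<forall>k<n. (\<Sum>j<n. w j i * w j k) = (if i = k then 1 else 0)) \<and>
    (\<forall>i<n. \<forall>j<n. even i \<noteq> even j \<longrightarrow> w i j = (0::real)) \<and>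
    (\<forall>i<n. \<forall>k<n. dst_conj n f $$ (i, k) = (\<Sum>j<n. w i j * l j * w k j))"
proof -
  define I where "I b = {i. i < n \<and> even i = b}" for b
  define P where "P b w l \<longleftrightarrow> (\<forall>i\<in>I b. \<forall>k\<in>I b. (\<Sum>j\<in>I b. w i j * w k j) = (if i = k then 1 else 0)) \<and>
    (\<forall>i\<in>I b. \<forall>k\<in>I b. (\<Sum>j\<in>I b. w j i * w j k) = (if i = k then 1 else 0)) \<and>
    (\<forall>i\<in>I b. \<forall>k\<in>I b. dst_conj n f $$ (i, k) = (\<Sum>j\<in>I b. w i j * l j * w k j))"
    for b and w :: "nat \<Rightarrow> nat \<Rightarrow> real" and l
  have "\<forall>b. \<exists>w l. P b w l"
    unfolding P_def by (intro allI real_spectral_theorem_on) (auto simp: I_def intro: dst_conj_sym)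
  from choice[OF this] obtain W where "\<forall>b. \<exists>l. P b (W b) l" by blast
  from choice[OF this] obtain L where "\<And>b. P b (W b) (L b)" by blast
  then have WL: "\<And>b i k. i \<in> I b \<Longrightarrow> k \<in> I b \<Longrightarrow> (\<Sum>j\<in>I b. W b i j * W b k j) = (if i = k then 1 else 0)"
    "\<And>b i k. i \<in> I b \<Longrightarrow> k \<in> I b \<Longrightarrow> (\<Sum>j\<in>I b. W b j i * W b j k) = (if i = k then 1 else 0)"
    "\<And>b i k. i \<in> I b \<Longrightarrow> k \<in> I b \<Longrightarrow> dst_conj n f $$ (i, k) = (\<Sum>j\<in>I b. W b i j * L b j * W b k j)"
    unfolding P_def by blast+
  define w where "w i j = (if even i = even j then W (even j) i j else 0)" for i j
  define l where "l j = L (even j) j" for j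
  have red: "(\<Sum>j<n. h j) = (\<Sum>j\<in>I b. h' j)"
    if "\<And>j. j \<in> I b \<Longrightarrow> h j = h' j" "\<And>j. j < n \<Longrightarrow> even j \<noteq> b \<Longrightarrow> h j = 0" for h h' :: "nat \<Rightarrow> real" and b
    by (rule sum.mono_neutral_cong_right) (use that in \<open>auto simp: I_def\<close>)
  have zero: "(\<Sum>j<n. w i j * g j * w k j) = 0" "(\<Sum>j<n. w j i * g j * w j k) = 0" if "even i \<noteq> even k" for i k g
  proof -
    have z: "w i j * g j * w k j = 0" "w j i * g j * w j k = 0" for j using that by (auto simp: w_def)
    show "(\<Sum>j<n. w i j * g j * w k j) = 0" "(\<Sum>j<n. w j i * g j * w j k) = 0"
      unfolding z by simp_all
  qed
  have 1: "(\<Sum>j<n. w i j * w k j) = (if i = k then 1 else 0)" if "i < n" "k < n" for i k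
  proof (cases "even i = even k")
    case True
    have "(\<Sum>j<n. w i j * w k j) = (\<Sum>j\<in>I (even i). W (even i) i j * W (even i) k j)"
      by (rule red) (use True in \<open>auto simp: w_def I_def\<close>)
    moreover have "i \<in> I (even i)" "k \<in> I (even i)" using that True by (simp_all add: I_def)
    ultimately show ?thesis using WL(1) by simp
  next
    case False
    then show ?thesis using zero(1)[OF False, of "\<lambda>_. 1"] by auto
  qed
  have 2: "(\<Sum>j<n. w j i * w j k) = (if i = k then 1 else 0)" if "i < n" "k < n" for i k
  proof (cases "even i = even k")
    case True
    have "(\<Sum>j<n. w j i * w j k) = (\<Sum>j\<in>I (even i). W (even i) j i * W (even i) j k)"
      by (rule red) (use True in \<open>auto simp: w_def I_def\<close>)
    moreover have "i \<in> I (even i)" "k \<in> I (even i)" using that True by (simp_all add: I_def)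
    ultimately show ?thesis using WL(2) by simp
  next
    case False
    then show ?thesis using zero(2)[OF False, of "\<lambda>_. 1"] by auto
  qed
  have 3: "dst_conj n f $$ (i, k) = (\<Sum>j<n. w i j * l j * w k j)" if "i < n" "k < n" for i k
  proof (cases "even i = even k")
    case True
    have "(\<Sum>j<n. w i j * l j * w k j) = (\<Sum>j\<in>I (even i). W (even i) i j * L (even i) j * W (even i) k j)"
      by (rule red) (use True in \<open>auto simp: w_def l_def I_def\<close>)
    moreover have "i \<in> I (even i)" "k \<in> I (even i)" using that True by (simp_all add: I_def)
    ultimately show ?thesis using WL(3) by simp
  next
    case False
    then show ?thesis using zero(1)[OF False, of l] dst_conj_parity[OF that False] by simp
  qed
  show ?thesis
    by (intro exI[of _ w] exI[of _ l] conjI) (use 1 2 3 in \<open>auto simp: w_def\<close>)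
qed

text \<open>The columns of \<open>V = U * W\<close> are common eigenvectors of the Toeplitz matrix
  and of the flip. The flip has eigenvalue \<open>(-1) ^ j\<close> on column \<open>j\<close>, hence
  the product of both has \<open>(-1) ^ j * l j\<close>.\<close>

lemma toeplitz_parity_spectrum:
  assumes f: "bounded_meas f" and even: "\<forall>x\<in>{-pi..pi}. f (- x) = f x"
  shows "\<exists>w l. (\<forall>i<n. \<forall>k<n. (\<Sum>j<n. w i j * w k j) = (if i = k then 1 else 0)) \<and>
    (\<forall>i<n. \<forall>k<n. (\<Sum>j<n. w j i * w j k) = (if i = k then 1 else 0)) \<and>
    (\<forall>i<n. \<forall>j<n. even i \<noteq> even j \<longrightarrow> w i j = (0::real)) \<and>
    (\<forall>\<mu>. dst_cost n f \<mu> = (\<Sum>i<n. \<Sum>j<n. (w i j)\<^sup>2 * (l j - \<mu> i)\<^sup>2)) \<and>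
    char_poly (toeplitz n (\<lambda>\<theta>. complex_of_real (f \<theta>))) = (\<Prod>j<n. [:- complex_of_real (l j), 1:]) \<and>
    char_poly (flipped_toeplitz n (\<lambda>\<theta>. complex_of_real (f \<theta>))) = (\<Prod>j<n. [:- complex_of_real ((-1) ^ j * l j), 1:]) \<and>
    (\<forall>j<n. \<forall>M. (\<forall>x\<in>{-pi..pi}. f x \<le> M) \<longrightarrow> l j \<le> M) \<and>
    (\<forall>j<n. \<forall>m. (\<forall>x\<in>{-pi..pi}. m \<le> f x) \<longrightarrow> m \<le> l j)"
proof -
  obtain w l where w1: "\<forall>i<n. \<forall>k<n. (\<Sum>j<n. w i j * w k j) = (if i = k then 1 else (0::real))"
    and w2: "\<forall>i<n. \<forall>k<n. (\<Sum>j<n. w j i * w j k) = (if i = k then 1 else 0)"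
    and w3: "\<forall>i<n. \<forall>j<n. even i \<noteq> even j \<longrightarrow> w i j = 0"
    and w4: "\<forall>i<n. \<forall>k<n. dst_conj n f $$ (i, k) = (\<Sum>j<n. w i j * l j * w k j)"
    using dst_conj_spectral[of n f] by blast
  let ?U = "dst_mat n" and ?C = "real_toeplitz n f" and ?S = "sign_mat n" and ?F = "real_flip n"
    and ?A = "dst_conj n f" and ?D = "mat_diag n l"
  note assoc = assoc_mult_mat[of _ n n _ n _ n]
  have D [simp]: "?D \<in> carrier_mat n n" by simp
  define W where "W = Matrix.mat n n (\<lambda>(i, j). w i j)"
  have W [simp]: "W \<in> carrier_mat n n" "W\<^sup>T \<in> carrier_mat n n" by (simp_all add: W_def)
  have WW: "W\<^sup>T * W = 1\<^sub>m n"
    by (rule eq_matI) (simp_all add: W_def scalar_prod_def atLeast0LessThan w2)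
  have AW: "?A * W = W * ?D"
  proof (rule eq_matI)
    fix i k assume "i < dim_row (W * ?D)" "k < dim_col (W * ?D)"
    then have ik: "i < n" "k < n" by (auto simp: W_def mat_diag_def)
    have "(?A * W) $$ (i, k) = (\<Sum>p<n. ?A $$ (i, p) * w p k)"
      using ik carrier_matD[OF dst_conj_carrier[of n f]] by (simp add: W_def scalar_prod_def atLeast0LessThan)
    also have "\<dots> = (\<Sum>p<n. \<Sum>j<n. w i j * l j * (w p j * w p k))"
      using w4 ik by (intro sum.cong refl) (simp add: sum_distrib_right mult.assoc)
    also have "\<dots> = (\<Sum>j<n. \<Sum>p<n. w i j * l j * (w p j * w p k))" by (rule sum.swap)
    also have "\<dots> = (\<Sum>j<n. if j = k then w i k * l k else 0)"
      using w2 ik by (intro sum.cong refl) (simp add: sum_distrib_left[symmetric])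
    also have "\<dots> = (W * ?D) $$ (i, k)"
      unfolding mat_diag_mult_right[OF W(1)] using ik by (simp add: W_def)
    finally show "(?A * W) $$ (i, k) = (W * ?D) $$ (i, k)" .
  qed (use carrier_matD[OF dst_conj_carrier[of n f]] in \<open>auto simp: W_def mat_diag_def\<close>)
  \<comment> \<open>\<open>W\<close> vanishes between indices of different parity, so it commutes
    with the signs; this transfers the parity of the sine vectors to the eigenvectors.\<close>
  have SW: "?S * W = W * ?S"
    unfolding sign_mat_def mat_diag_mult_right[OF W(1)] mat_diag_mult_left[OF W(1)]
  proof (rule eq_matI)
    fix i j assume "i < dim_row (Matrix.mat n n (\<lambda>(i, j). W $$ (i, j) * (-1) ^ j))" "j < dim_col (Matrix.mat n n (\<lambda>(i, j). W $$ (i, j) * (-1::real) ^ j))"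
    then have ij: "i < n" "j < n" by auto
    have "(-1) ^ i * w i j = w i j * (-1) ^ j"
      using w3 ij by (cases "even i = even j") (auto simp: minus_one_power_iff)
    then show "Matrix.mat n n (\<lambda>(i, j). (-1) ^ i * W $$ (i, j)) $$ (i, j) = Matrix.mat n n (\<lambda>(i, j). W $$ (i, j) * (-1) ^ j) $$ (i, j)"
      using ij by (simp add: W_def)
  qed simp_all
  define V where "V = ?U * W"
  define V' where "V' = W\<^sup>T * ?U"
  have V [simp]: "V \<in> carrier_mat n n" "V' \<in> carrier_mat n n" by (simp_all add: V_def V'_def)
  have VV: "V' * V = 1\<^sub>m n"
  proof -
    have "V' * V = W\<^sup>T * (?U * ?U) * W" unfolding V_def V'_def by (simp add: assoc)
    then show ?thesis unfolding dst_mat_involution using WW by (simp add: right_mult_one_mat[of _ n n])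
  qed
  have CU: "?C * ?U = ?U * ?A"
  proof -
    have "?U * ?A = ?U * ?U * (?C * ?U)" unfolding dst_conj_def by (simp add: assoc)
    then show ?thesis unfolding dst_mat_involution by (simp add: left_mult_one_mat[of _ n n])
  qed
  have CV: "?C * V = V * ?D"
  proof -
    have "?C * V = ?C * ?U * W" unfolding V_def by (simp add: assoc)
    also have "\<dots> = ?U * (?A * W)" unfolding CU by (simp add: assoc)
    also have "\<dots> = V * ?D" unfolding AW V_def by (simp add: assoc)
    finally show ?thesis .
  qed
  have FV: "?F * V = V * ?S"
  proof -
    have "?F * V = ?F * ?U * W" unfolding V_def by (simp add: assoc)
    also have "\<dots> = ?U * (?S * W)" unfolding flip_dst_mat by (simp add: assoc)
    also have "\<dots> = V * ?S" unfolding SW V_def by (simp add: assoc)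
    finally show ?thesis .
  qed
  have FCV: "?F * ?C * V = V * mat_diag n (\<lambda>j. (-1) ^ j * l j)"
  proof -
    have "?F * ?C * V = ?F * (?C * V)" by (simp add: assoc)
    also have "\<dots> = ?F * V * ?D" unfolding CV by (simp add: assoc)
    also have "\<dots> = V * (?S * ?D)" unfolding FV by (simp add: assoc)
    finally show ?thesis unfolding sign_mat_def by simp
  qed
  have T: "toeplitz n (\<lambda>\<theta>. complex_of_real (f \<theta>)) = map_mat complex_of_real ?C"
    by (rule eq_matI) (simp_all add: toeplitz_def real_toeplitz_def fourier_coeff_eq_cosine_coeff[OF f even])
  have H: "flipped_toeplitz n (\<lambda>\<theta>. complex_of_real (f \<theta>)) = map_mat complex_of_real (?F * ?C)"
  proof -
    have "flip_mat n = map_mat complex_of_real ?F" by (rule eq_matI) (simp_all add: flip_mat_def real_flip_def)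
    then show ?thesis unfolding flipped_toeplitz_def T
      by (simp add: of_real_hom.mat_hom_mult[of _ n n _ n])
  qed
  \<comment> \<open>Column \<open>i\<close> of the residual is written first in the sine basis, then
    in the eigenbasis. Both changes preserve the sum of squares, and the final coordinates are
    \<open>(l j - \<mu> i) * w i j\<close>.\<close>
  have cost: "dst_cost n f \<mu> = (\<Sum>i<n. \<Sum>j<n. (w i j)\<^sup>2 * (l j - \<mu> i)\<^sup>2)" for \<mu>
    unfolding dst_cost_def
  proof (rule sum.cong[OF refl])
    fix i assume "i \<in> {..<n}"
    then have i: "i < n" by simp
    have row: "(\<Sum>t<n. cosine_coeff f (int s - int t) * dst n i t) - \<mu> i * dst n i s =
        (\<Sum>k<n. dst n s k * (?A $$ (k, i) - (if k = i then \<mu> i else 0)))" if s: "s < n" for s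
    proof -
      have "(\<Sum>t<n. cosine_coeff f (int s - int t) * dst n i t) = (?C * ?U) $$ (s, i)"
        using i s by (simp add: real_toeplitz_def dst_mat_def scalar_prod_def atLeast0LessThan dst_sym[of n i])
      also have "\<dots> = (\<Sum>k<n. dst n s k * ?A $$ (k, i))"
        unfolding CU using i s carrier_matD[OF dst_conj_carrier[of n f]]
        by (simp add: dst_mat_def scalar_prod_def atLeast0LessThan)
      finally have "(\<Sum>t<n. cosine_coeff f (int s - int t) * dst n i t) = (\<Sum>k<n. dst n s k * ?A $$ (k, i))" .
      moreover have "(\<Sum>k<n. dst n s k * (if k = i then \<mu> i else 0)) = \<mu> i * dst n i s"
        using i by (simp add: if_distrib[of "\<lambda>x. _ * x"] dst_sym[of n s i] mult.commute cong: if_cong)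
      ultimately show ?thesis by (simp add: right_diff_distrib sum_subtractf)
    qed
    have "(\<Sum>s<n. ((\<Sum>t<n. cosine_coeff f (int s - int t) * dst n i t) - \<mu> i * dst n i s)\<^sup>2)
        = (\<Sum>s<n. (\<Sum>k<n. dst n s k * (?A $$ (k, i) - (if k = i then \<mu> i else 0)))\<^sup>2)"
      by (intro sum.cong refl) (simp only: row lessThan_iff)
    also have "\<dots> = (\<Sum>k<n. (?A $$ (k, i) - (if k = i then \<mu> i else 0))\<^sup>2)"
    proof (rule orthogonal_sum_squares)
      fix j k assume "j < n" "k < n"
      then show "(\<Sum>s<n. dst n s j * dst n s k) = (if j = k then 1 else 0)"
        using dst_orthonormal[of j n k] by (simp only: dst_sym[of n j] dst_sym[of n k])
    qed
    also have "\<dots> = (\<Sum>k<n. (\<Sum>j<n. w k j * ((l j - \<mu> i) * w i j))\<^sup>2)"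
    proof (intro sum.cong refl)
      fix k assume "k \<in> {..<n}"
      then have k: "k < n" by simp
      have "?A $$ (k, i) = (\<Sum>j<n. w k j * l j * w i j)" using w4 k i by blast
      moreover have "(if k = i then \<mu> i else 0) = \<mu> i * (\<Sum>j<n. w k j * w i j)" using w1 k i by simp
      ultimately have "?A $$ (k, i) - (if k = i then \<mu> i else 0) = (\<Sum>j<n. w k j * ((l j - \<mu> i) * w i j))"
        by (simp add: sum_distrib_left sum_subtractf[symmetric] algebra_simps)
      then show "(?A $$ (k, i) - (if k = i then \<mu> i else 0))\<^sup>2 = (\<Sum>j<n. w k j * ((l j - \<mu> i) * w i j))\<^sup>2" by simp
    qed
    also have "\<dots> = (\<Sum>j<n. ((l j - \<mu> i) * w i j)\<^sup>2)"
      by (rule orthogonal_sum_squares) (use w2 in blast)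
    also have "\<dots> = (\<Sum>j<n. (w i j)\<^sup>2 * (l j - \<mu> i)\<^sup>2)" by (simp add: power_mult_distrib mult.commute)
    finally show "(\<Sum>s<n. ((\<Sum>t<n. cosine_coeff f (int s - int t) * dst n i t) - \<mu> i * dst n i s)\<^sup>2)
      = (\<Sum>j<n. (w i j)\<^sup>2 * (l j - \<mu> i)\<^sup>2)" .
  qed
  have ev: "(\<Sum>t<n. cosine_coeff f (int s - int t) * V $$ (t, j)) = l j * V $$ (s, j)" if "s < n" "j < n" for s j
  proof -
    have "(?C * V) $$ (s, j) = (\<Sum>t<n. cosine_coeff f (int s - int t) * V $$ (t, j))"
      using that carrier_matD[OF V(1)] by (simp add: real_toeplitz_def scalar_prod_def atLeast0LessThan)
    moreover have "(V * ?D) $$ (s, j) = V $$ (s, j) * l j"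
      unfolding mat_diag_mult_right[OF V(1)] using that by simp
    ultimately show ?thesis using CV by (simp add: mult.commute)
  qed
  have V't: "V' = V\<^sup>T"
    unfolding V_def V'_def using transpose_mult[of ?U n n W n] by (simp add: dst_mat_transpose)
  have unit: "(\<Sum>s<n. (V $$ (s, j))\<^sup>2) = 1" if "j < n" for j
  proof -
    have "(V\<^sup>T * V) $$ (j, j) = (\<Sum>s<n. (V $$ (s, j))\<^sup>2)"
      using that carrier_matD[OF V(1)] by (simp add: scalar_prod_def atLeast0LessThan power2_eq_square)
    then show ?thesis using VV that unfolding V't by simp
  qed
  have up: "l j \<le> M" if "j < n" "\<forall>x\<in>{-pi..pi}. f x \<le> M" for j M
    using that ev unit by (intro toeplitz_eigenvalue_le[OF f, of M n "\<lambda>s. V $$ (s, j)" "l j"]) auto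
  have lo: "m \<le> l j" if "j < n" "\<forall>x\<in>{-pi..pi}. m \<le> f x" for j m
    using that ev unit by (intro toeplitz_eigenvalue_ge[OF f, of m n "\<lambda>s. V $$ (s, j)" "l j"]) auto
  have cT: "char_poly (toeplitz n (\<lambda>\<theta>. complex_of_real (f \<theta>))) = (\<Prod>j<n. [:- complex_of_real (l j), 1:])"
    unfolding T by (rule char_poly_of_real_diagonalized[OF _ V VV CV]) simp
  have cH: "char_poly (flipped_toeplitz n (\<lambda>\<theta>. complex_of_real (f \<theta>))) = (\<Prod>j<n. [:- complex_of_real ((-1) ^ j * l j), 1:])"
    unfolding H by (rule char_poly_of_real_diagonalized[OF _ V VV FCV]) simp
  show ?thesis
    by (intro exI[of _ w] exI[of _ l] conjI allI impI w1[rule_format] w2[rule_format] w3[rule_format] cost cT cH up lo) assumption+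
qed

theorem theorem9:
  fixes f :: "real \<Rightarrow> real" and \<xi> :: "nat \<Rightarrow> nat \<Rightarrow> real"
  assumes riemann: "riemann_integrable f (-pi) pi"
    and even: "\<forall>x \<in> {-pi..pi}. f (- x) = f x"
    and connected_range: "connected (f ` {-pi..pi})"
    and essential_values: "f ` {-pi..pi} \<subseteq> essential_range {-pi..pi} f"
    and grid: "asymptotically_uniform_grid 0 pi \<xi>"
  shows "\<exists>(\<psi> :: nat \<Rightarrow> nat \<Rightarrow> real) (ev_T :: nat \<Rightarrow> nat \<Rightarrow> complex) (ev_H :: nat \<Rightarrow> nat \<Rightarrow> complex).
     (\<forall>n\<ge>1.
        eigenvalue_ordering (toeplitz n (\<lambda>\<theta>. complex_of_real (f \<theta>))) (ev_T n) \<and>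
        eigenvalue_ordering (flipped_toeplitz n (\<lambda>\<theta>. complex_of_real (f \<theta>))) (ev_H n) \<and>
        (\<forall>i \<in> {1..n}.
           ev_T n i = complex_of_real (f (\<xi> n i) + \<psi> n i) \<and>
           ev_H n i = (-1) ^ (i + 1) * ev_T n i)) \<and>
     (\<lambda>n. MAX i \<in> {1..n}. \<bar>\<psi> n i\<bar>) \<longlonglongrightarrow> 0"
proof -

  \<comment> \<open>The range of the symbol\<close>
  have fb: "bounded_meas f" by (rule riemann_integrable_imp_bounded_meas[OF riemann])
  let ?R = "f ` {-pi..pi}"
  define m where "m = Inf ?R"
  define M where "M = Sup ?R"
  have "bounded ?R" using fb by (simp add: bounded_meas_def)
  then have bdd: "bdd_above ?R" "bdd_below ?R"
    by (rule bounded_imp_bdd_above, rule bounded_imp_bdd_below)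
  have ne: "?R \<noteq> {}" by simp
  have mM: "m \<le> f x" "f x \<le> M" if "x \<in> {-pi..pi}" for x
    unfolding m_def M_def using that bdd by (auto intro: cInf_lower cSup_upper)
  \<comment> \<open>Only interior values are covered, as \<open>m\<close> and \<open>M\<close> may
    fail to be attained.\<close>
  have ess: "z \<in> essential_range {-pi..pi} f" if z: "m < z" "z < M" for z
  proof -
    obtain a where a: "a \<in> ?R" "a < z" using z(1) cInf_less_iff[OF ne bdd(2), of z] unfolding m_def by blast
    obtain b where b: "b \<in> ?R" "z < b" using z(2) less_cSup_iff[OF ne bdd(1), of z] unfolding M_def by blast
    have "z \<in> ?R" by (rule connectedD_interval[OF connected_range a(1) b(1)]) (use a b in auto)
    then show ?thesis using essential_values by blast
  qed

  \<comment> \<open>Spectral data for every size\<close>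
  define P where "P n w l \<longleftrightarrow> (\<forall>i<n. \<forall>k<n. (\<Sum>j<n. w i j * w k j) = (if i = k then 1 else 0)) \<and>
    (\<forall>i<n. \<forall>k<n. (\<Sum>j<n. w j i * w j k) = (if i = k then 1 else 0)) \<and>
    (\<forall>i<n. \<forall>j<n. even i \<noteq> even j \<longrightarrow> w i j = (0::real)) \<and>
    (\<forall>\<mu>. dst_cost n f \<mu> = (\<Sum>i<n. \<Sum>j<n. (w i j)\<^sup>2 * (l j - \<mu> i)\<^sup>2)) \<and>
    char_poly (toeplitz n (\<lambda>\<theta>. complex_of_real (f \<theta>))) = (\<Prod>j<n. [:- complex_of_real (l j), 1:]) \<and>
    char_poly (flipped_toeplitz n (\<lambda>\<theta>. complex_of_real (f \<theta>))) = (\<Prod>j<n. [:- complex_of_real ((-1) ^ j * l j), 1:]) \<and>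
    (\<forall>j<n. \<forall>M. (\<forall>x\<in>{-pi..pi}. f x \<le> M) \<longrightarrow> l j \<le> M) \<and>
    (\<forall>j<n. \<forall>m. (\<forall>x\<in>{-pi..pi}. m \<le> f x) \<longrightarrow> m \<le> l j)" for n w l
  have "\<forall>n. \<exists>w l. P n w l" unfolding P_def by (intro allI toeplitz_parity_spectrum[OF fb even])
  from choice[OF this] obtain w where "\<forall>n. \<exists>l. P n (w n) l" by blast
  from choice[OF this] obtain l where P: "\<forall>n. P n (w n) (l n)" by blast
  note spec = P[unfolded P_def, THEN spec]
  note rows = spec[THEN conjunct1, rule_format]
  note cols = spec[THEN conjunct2, THEN conjunct1, rule_format]
  note par = spec[THEN conjunct2, THEN conjunct2, THEN conjunct1, rule_format]
  note spec' = spec[THEN conjunct2, THEN conjunct2, THEN conjunct2]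
  note cost = spec'[THEN conjunct1, rule_format]
  note cT = spec'[THEN conjunct2, THEN conjunct1]
  note cH = spec'[THEN conjunct2, THEN conjunct2, THEN conjunct1]
  note up = spec'[THEN conjunct2, THEN conjunct2, THEN conjunct2, THEN conjunct1, rule_format]
  note lo = spec'[THEN conjunct2, THEN conjunct2, THEN conjunct2, THEN conjunct2, rule_format]

  \<comment> \<open>Matching within the parity classes\<close>
  define \<mu> where "\<mu> n i = f (\<xi> n (Suc i))" for n i
  have \<mu>: "m \<le> \<mu> n i" "\<mu> n i \<le> M" if "i < n" for n i
  proof -
    have "\<xi> n (Suc i) \<in> {0..pi}" using grid that unfolding asymptotically_uniform_grid_def by auto
    then have "\<xi> n (Suc i) \<in> {-pi..pi}" using pi_gt_zero by auto
    then show "m \<le> \<mu> n i" "\<mu> n i \<le> M" unfolding \<mu>_def by (rule mM)+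
  qed
  define I where "I n b = {i :: nat. i < n \<and> even i = b}" for n b
  have finI: "finite (I n b)" for n b by (simp add: I_def)
  define comonotone where "comonotone n b \<sigma> \<longleftrightarrow> bij_betw \<sigma> (I n b) (I n b) \<and>
      (\<forall>i\<in>I n b. \<forall>k\<in>I n b. \<mu> n i < \<mu> n k \<longrightarrow> l n (\<sigma> i) \<le> l n (\<sigma> k))" for n b \<sigma>
  have ex: "\<exists>\<sigma>. comonotone n b \<sigma>" for n b
    unfolding comonotone_def by (rule comonotone_bijection[OF finI])
  define s where "s n b = (SOME \<sigma>. comonotone n b \<sigma>)" for n b
  have "comonotone n b (s n b)" for n b unfolding s_def by (rule someI_ex[OF ex])
  then have s: "\<And>n b. bij_betw (s n b) (I n b) (I n b)"
    "\<And>n b i k. i \<in> I n b \<Longrightarrow> k \<in> I n b \<Longrightarrow> \<mu> n i < \<mu> n k \<Longrightarrow> l n (s n b i) \<le> l n (s n b k)"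
    unfolding comonotone_def by blast+
  \<comment> \<open>The matchings of the two classes merge into a permutation that preserves parity,
    so that the sign of a flipped eigenvalue depends only on its position.\<close>
  define \<sigma> where "\<sigma> n i = s n (even i) i" for n i
  have \<sigma>I: "bij_betw (\<sigma> n) (I n b) (I n b)" for n b
    using s(1)[of n b] by (rule bij_betw_cong[THEN iffD1, rotated]) (simp add: \<sigma>_def I_def)
  have \<sigma>: "bij_betw (\<sigma> n) {..<n} {..<n}" for n
  proof -
    have "bij_betw (\<sigma> n) (I n True \<union> I n False) (I n True \<union> I n False)"
      by (rule bij_betw_combine[OF \<sigma>I \<sigma>I]) (auto simp: I_def)
    moreover have "I n True \<union> I n False = {..<n}" by (auto simp: I_def)
    ultimately show ?thesis by simp
  qed
  have \<sigma>p: "\<sigma> n i < n" "even (\<sigma> n i) = even i" if "i < n" for n i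
    using bij_betwE[OF \<sigma>I[of n "even i"]] that by (auto simp: I_def)

  \<comment> \<open>Uniform closeness of matched pairs\<close>
  have close: "\<forall>\<^sub>F n in sequentially. \<forall>i\<in>I n b. \<bar>l n (\<sigma> n i) - \<mu> n i\<bar> \<le> e" if e: "e > 0" for e b
  proof -
    have e2: "e / 2 > 0" using e by simp
    obtain c where c: "c > 0" and dense: "\<forall>\<^sub>F n in sequentially. \<forall>y. m \<le> y \<longrightarrow> y + e / 2 \<le> M \<longrightarrow>
       c * real n \<le> real (card {i. i < n \<and> (even i \<longleftrightarrow> b) \<and> y < f (\<xi> n (Suc i)) \<and> f (\<xi> n (Suc i)) < y + e / 2})"
      using grid_values_dense[OF riemann even grid e2 ess, of m M b] by blast
    \<comment> \<open>Half of \<open>c * (e / 2)\<^sup>2\<close>, the cost per index that a single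
      bad pair would enforce.\<close>
    define \<eta> where "\<eta> = c * (e / 2)\<^sup>2 / 2"
    have \<eta>: "\<eta> > 0" using c e by (simp add: \<eta>_def)
    show ?thesis
      using dense dst_cost_grid_small[OF riemann even grid \<eta>] eventually_gt_at_top[of 0]
    proof eventually_elim
      case (elim n)
      define Q where "Q = (\<Sum>i\<in>I n b. \<Sum>j\<in>I n b. (w n i j)\<^sup>2 * (l n j - \<mu> n i)\<^sup>2)"
      have "Q \<le> (\<Sum>i\<in>I n b. \<Sum>j<n. (w n i j)\<^sup>2 * (l n j - \<mu> n i)\<^sup>2)"
        unfolding Q_def by (intro sum_mono sum_mono2) (auto simp: I_def)
      also have "\<dots> \<le> (\<Sum>i<n. \<Sum>j<n. (w n i j)\<^sup>2 * (l n j - \<mu> n i)\<^sup>2)"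
        by (intro sum_mono2) (auto simp: I_def intro!: sum_nonneg)
      also have "\<dots> \<le> \<eta> * real n" using elim(2) unfolding cost \<mu>_def .
      finally have Q: "Q \<le> \<eta> * real n" .
      \<comment> \<open>Entries of \<open>w\<close> between the classes vanish, so the squares have
        row and column sums 1 within a class.\<close>
      have row: "(\<Sum>j\<in>I n b. (w n i j)\<^sup>2) = 1" if "i \<in> I n b" for i
      proof -
        have "(\<Sum>j\<in>I n b. (w n i j)\<^sup>2) = (\<Sum>j<n. (w n i j)\<^sup>2)"
          using that par by (intro sum.mono_neutral_left) (auto simp: I_def)
        then show ?thesis using rows[of i n i] that by (simp add: power2_eq_square I_def)
      qed
      have col: "(\<Sum>i\<in>I n b. (w n i j)\<^sup>2) = 1" if "j \<in> I n b" for j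
      proof -
        have "(\<Sum>i\<in>I n b. (w n i j)\<^sup>2) = (\<Sum>i<n. (w n i j)\<^sup>2)"
          using that par by (intro sum.mono_neutral_left) (auto simp: I_def)
        then show ?thesis using cols[of j n j] that by (simp add: power2_eq_square I_def)
      qed
      have mono: "l n (\<sigma> n i) \<le> l n (\<sigma> n k)" if "i \<in> I n b" "k \<in> I n b" "\<mu> n i < \<mu> n k" for i k
        using s(2)[OF that] that(1,2) by (simp add: \<sigma>_def I_def)
      have contra: False if cnt: "c * real n \<le> real N" "real N * (e / 2)\<^sup>2 \<le> Q" for N :: nat
      proof -
        have "c * real n * (e / 2)\<^sup>2 \<le> real N * (e / 2)\<^sup>2" using cnt(1) by (intro mult_right_mono) auto
        also have "\<dots> \<le> \<eta> * real n" using cnt(2) Q by linarith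
        also have "\<dots> = c * real n * (e / 2)\<^sup>2 / 2" by (simp add: \<eta>_def)
        finally have "c * real n * (e / 2)\<^sup>2 \<le> 0" by simp
        moreover have "c * real n * (e / 2)\<^sup>2 > 0" using c e elim(3) by simp
        ultimately show False by simp
      qed
      show ?case
      proof
        fix i assume i: "i \<in> I n b"
        then have i_n: "i < n" by (simp add: I_def)
        \<comment> \<open>As the eigenvalues lie between \<open>m\<close> and \<open>M\<close>, a
          gap above \<open>e\<close> leaves room in the range for the window of length
          \<open>e / 2\<close> next to the sample, as the density of the samples requires. For
          constant \<open>f\<close> this already excludes a gap.\<close>
        have lM: "m \<le> l n (\<sigma> n i)" "l n (\<sigma> n i) \<le> M"
          by (rule lo[OF \<sigma>p(1)[OF i_n] mM(1)], assumption, rule up[OF \<sigma>p(1)[OF i_n] mM(2)])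
        show "\<bar>l n (\<sigma> n i) - \<mu> n i\<bar> \<le> e"
        proof (rule ccontr)
          assume "\<not> ?thesis"
          then consider "l n (\<sigma> n i) > \<mu> n i + e" | "l n (\<sigma> n i) < \<mu> n i - e" by linarith
          then show False
          proof cases
            case 1
            have "real (card {k\<in>I n b. \<mu> n i < \<mu> n k \<and> \<mu> n k < \<mu> n i + e / 2}) * (e / 2)\<^sup>2 \<le> Q"
              unfolding Q_def
              by (rule comonotone_transport_above[where I = "I n b" and W = "\<lambda>i j. (w n i j)\<^sup>2" and \<mu> = "\<mu> n"
                  and \<nu> = "l n" and \<sigma> = "\<sigma> n" and e = e and k = i])
                (use finI row col \<sigma>I mono e i 1 in auto)
            moreover have "\<mu> n i + e / 2 \<le> M" using 1 lM(2) e by linarith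
            from elim(1)[rule_format, OF \<mu>(1)[OF i_n] this]
            have "c * real n \<le> real (card {k\<in>I n b. \<mu> n i < \<mu> n k \<and> \<mu> n k < \<mu> n i + e / 2})"
              by (simp add: I_def \<mu>_def conj_assoc)
            ultimately show False by (rule contra[rotated])
          next
            case 2
            have "real (card {k\<in>I n b. \<mu> n i - e / 2 < \<mu> n k \<and> \<mu> n k < \<mu> n i}) * (e / 2)\<^sup>2 \<le> Q"
              unfolding Q_def
              by (rule comonotone_transport_below[where I = "I n b" and W = "\<lambda>i j. (w n i j)\<^sup>2" and \<mu> = "\<mu> n"
                  and \<nu> = "l n" and \<sigma> = "\<sigma> n" and e = e and k = i])
                (use finI row col \<sigma>I mono e i 2 in auto)
            moreover have le: "m \<le> \<mu> n i - e / 2" using 2 lM(1) e by linarith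
            have "(\<mu> n i - e / 2) + e / 2 \<le> M" using \<mu>(2)[OF i_n] by simp
            from elim(1)[rule_format, OF le this]
            have "c * real n \<le> real (card {k\<in>I n b. \<mu> n i - e / 2 < \<mu> n k \<and> \<mu> n k < \<mu> n i})"
              by (simp add: I_def \<mu>_def conj_assoc)
            ultimately show False by (rule contra[rotated])
          qed
        qed
      qed
    qed
  qed

  \<comment> \<open>The orderings and the errors\<close>
  define \<psi> where "\<psi> n i = l n (\<sigma> n (i - 1)) - f (\<xi> n i)" for n i
  define ev_T where "ev_T n i = complex_of_real (l n (\<sigma> n (i - 1)))" for n i
  \<comment> \<open>Prescribed by the claim; it remains to see that these are the eigenvalues.
    Position \<open>i\<close>, counted from 1, belongs to index \<open>i - 1\<close>, counted from
    0, so by parity the sign is \<open>(-1) ^ \<sigma> n (i - 1)\<close>.\<close>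
  define ev_H where "ev_H n i = (-1) ^ (i + 1) * ev_T n i" for n i
  have eT: "eigenvalue_ordering (toeplitz n (\<lambda>\<theta>. complex_of_real (f \<theta>))) (ev_T n)" for n
  proof -
    have "(\<Prod>i=1..n. [:- ev_T n i, 1:]) = (\<Prod>i<n. [:- complex_of_real (l n (\<sigma> n i)), 1:])"
      by (simp add: prod.atLeast1_atMost_eq ev_T_def)
    also have "\<dots> = (\<Prod>j<n. [:- complex_of_real (l n j), 1:])"
      by (rule prod.reindex_bij_betw[OF \<sigma>])
    finally show ?thesis unfolding eigenvalue_ordering_def cT by (simp add: toeplitz_def)
  qed
  have eH: "eigenvalue_ordering (flipped_toeplitz n (\<lambda>\<theta>. complex_of_real (f \<theta>))) (ev_H n)" for n
  proof -
    have "(\<Prod>i=1..n. [:- ev_H n i, 1:]) = (\<Prod>i<n. [:- ev_H n (Suc i), 1:])"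
      using prod.atLeast1_atMost_eq[of "\<lambda>i. [:- ev_H n i, 1:]" n] by simp
    also have "\<dots> = (\<Prod>i<n. [:- complex_of_real ((-1) ^ \<sigma> n i * l n (\<sigma> n i)), 1:])"
    proof (intro prod.cong refl)
      fix i assume "i \<in> {..<n}"
      then have "even (\<sigma> n i) = even i" using \<sigma>p(2) by simp
      then have "ev_H n (Suc i) = complex_of_real ((-1) ^ \<sigma> n i * l n (\<sigma> n i))"
        by (simp add: ev_H_def ev_T_def minus_one_power_iff)
      then show "[:- ev_H n (Suc i), 1:] = [:- complex_of_real ((-1) ^ \<sigma> n i * l n (\<sigma> n i)), 1:]" by simp
    qed
    also have "\<dots> = (\<Prod>j<n. [:- complex_of_real ((-1) ^ j * l n j), 1:])"
      by (rule prod.reindex_bij_betw[OF \<sigma>])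
    finally show ?thesis unfolding eigenvalue_ordering_def cH by (simp add: flipped_toeplitz_def flip_mat_def)
  qed
  have eTH: "ev_T n i = complex_of_real (f (\<xi> n i) + \<psi> n i) \<and> ev_H n i = (-1) ^ (i + 1) * ev_T n i" for n i
    by (simp add: ev_T_def \<psi>_def ev_H_def)
  have lim: "(\<lambda>n. MAX i \<in> {1..n}. \<bar>\<psi> n i\<bar>) \<longlonglongrightarrow> 0"
  proof (rule tendstoI)
    fix e :: real assume e: "e > 0"
    then have "e / 2 > 0" by simp
    from close[OF this, of True] close[OF this, of False] eventually_gt_at_top[of 0]
    show "\<forall>\<^sub>F n in sequentially. dist (MAX i \<in> {1..n}. \<bar>\<psi> n i\<bar>) 0 < e"
    proof eventually_elim
      case (elim n)
      have "\<bar>\<psi> n i\<bar> \<le> e / 2" if "i \<in> {1..n}" for i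
      proof -
        have "i - 1 \<in> I n True \<or> i - 1 \<in> I n False" using that by (auto simp: I_def)
        then have "\<bar>l n (\<sigma> n (i - 1)) - \<mu> n (i - 1)\<bar> \<le> e / 2" using elim(1,2) by blast
        then show ?thesis using that by (simp add: \<psi>_def \<mu>_def)
      qed
      then have "(MAX i \<in> {1..n}. \<bar>\<psi> n i\<bar>) \<le> e / 2"
        using elim(3) by (intro Max.boundedI) auto
      moreover have "0 \<le> (MAX i \<in> {1..n}. \<bar>\<psi> n i\<bar>)"
      proof -
        have "\<bar>\<psi> n 1\<bar> \<le> (MAX i \<in> {1..n}. \<bar>\<psi> n i\<bar>)" using elim(3) by (intro Max_ge) auto
        then show ?thesis by linarith
      qed
      ultimately show ?case using e by simp
    qed
  qed
  show ?thesis
    by (rule exI[of _ \<psi>], rule exI[of _ ev_T], rule exI[of _ ev_H])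
      (simp only: eT eH eTH lim simp_thms, simp)
qed

end
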